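(* Let $S_1\colon H_1\to\mathcal{G}_1$ be a non-zero compact linear operator between real Hilbert spaces with tensor product problem $S=(S_d\colon H_d\to\mathcal{G}_d)_{d\in\mathbb{N}}$, let $P\in\{\mathfrak{S},\mathfrak{A}\}$, and for each $d\in\mathbb{N}$ let $\emptyset\ne I_d\subseteq\{1,\dots,d\}$. Let $S_I=(S_{d,I_d})_{d\in\mathbb{N}}$, where $S_{d,I_d}=S_d|_{P_{I_d}(H_d)}$ is the restriction of $S_d$ to the $I_d$-(anti)symmetric subspace $P_{I_d}(H_d)$ of $H_d$. Then for every $d\in\mathbb{N}$ the set $$\{(\lambda_{d,i},\xi_{d,i})\mid1\le i<\#\nabla_d+1\}=\{(\widetilde\lambda_{d,\boldsymbol k},\widetilde\xi_{\boldsymbol k})\mid\boldsymbol k\in\nabla_d\}$$ is the set of (non-trivial) eigenpairs of $W_{d,I_d}=S_{d,I_d}^\dagger S_{d,I_d}\colon P_{I_d}(H_d)\to P_{I_d}(H_d)$. Thus, for every $n\in\mathbb{N}_0$ and all $d\in\mathbb{N}$, the linear algorithm $A_{n,d}'\colon P_{I_d}(H_d)\to P_{I_d}(\mathcal{G}_d)$ given by $$A_{n,d}'f=\sum_{i=1}^{\min\{n,\#\nabla_d\}}\langle f,\xi_{d,i}\rangle_{H_d}\cdot S_d\xi_{d,i}$$ is $n$th optimal for $S_{d,I_d}$ with respect to the worst case setting. Furthermore, $$e^{\mathrm{wor}}(n,d;P_{I_d}(H_d))=\Delta^{\mathrm{wor}}(A_{n,d}';P_{I_d}(H_d))=\sq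rt{\lambda_{d,n+1}}.$$
   Context: $H_d=H_1\otimes\cdots\otimes H_1$, $\mathcal{G}_d=\mathcal{G}_1\otimes\cdots\otimes\mathcal{G}_1$ ($d$-fold Hilbert space tensor products), $S_d=S_1\otimes\cdots\otimes S_1$. (Anti)symmetrizers: for $X\in\{H,\mathcal{G}\}$ and $\emptyset\ne I\subseteq\{1,\dots,d\}$ let $\mathcal{S}_I$ be the set of permutations of $\{1,\dots,d\}$ fixing every element outside $I$, and for $\pi\in\mathcal{S}_I$ let $U_\pi$ be the unitary operator on $X_d$ with $U_\pi(f_1\otimes\cdots\otimes f_d)=f_{\pi(1)}\otimes\cdots\otimes f_{\pi(d)}$. Then $\mathfrak{S}_I=\frac1{\#\mathcal{S}_I}\sum_{\pi\in\mathcal{S}_I}U_\pi$ and $\mathfrak{A}_I=\frac1{\#\mathcal{S}_I}\sum_{\pi\in\mathcal{S}_I}(-1)^{|\pi|}U_\pi$ (with $(-1)^{|\pi|}$ the sign of $\pi$) are orthogonal projections, and $P_I(X_d)$ denotes the range, with the inner product of $X_d$. Eigenpairs: let $\{(\lambda_m,\phi_m)\mid m\in\mathcal{M}_1\}$, $\mathcal{M}_1=\{m\in\mathbb{N}\mid m<v+1\}$, $v\in\mathbb{N}\cup\{\infty\}$, be the non-trivial eigenpairs of $S_1^\dagger S_1$, i.e. $\lambda_1\ge\lambda_2\ge\dots>0$ are the positive eigenvalues with multiplicity and $\phi_m$ corresponding orthonormal eigenvectors. Write $I_d=\{i_1<\cdots<i_{\#I_d}\}$ and let $\nabla_d=\{\boldsymbol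 k\in(\mathcal{M}_1)^d\mid k_{i_1}\le k_{i_2}\le\cdots\le k_{i_{\#I_d}}\}$ if $P=\mathfrak{S}$, and $\nabla_d=\{\boldsymbol k\in(\mathcal{M}_1)^d\mid k_{i_1}<k_{i_2}<\cdots<k_{i_{\#I_d}}\}$ if $P=\mathfrak{A}$. For $\boldsymbol k\in\nabla_d$ let $\boldsymbol M(\boldsymbol k)!$ be the product of the factorials of the multiplicities with which the distinct values among $(k_i)_{i\in I_d}$ occur, and set $\widetilde\lambda_{d,\boldsymbol k}=\prod_{l=1}^d\lambda_{k_l}$ and $\widetilde\xi_{\boldsymbol k}=\sqrt{\#\mathcal{S}_{I_d}/\boldsymbol M(\boldsymbol k)!}\;P_{I_d}(\phi_{k_1}\otimes\cdots\otimes\phi_{k_d})$. Let $\psi\colon\{i\in\mathbb{N}\mid i<\#\nabla_d+1\}\to\nabla_d$ be a bijection such that $\lambda_{d,i}=\widetilde\lambda_{d,\psi(i)}$ is non-increasing in $i$; put $\xi_{d,i}=\widetilde\xi_{\psi(i)}$, and $\lambda_{d,i}=0$ for $i>\#\nabla_d$. "The non-trivial eigenpairs" of $W_{d,I_d}$ means: the $\xi_{d,i}$ are orthonormal eigenvectors for the eigenvalues $\lambda_{d,i}>0$, and these exhaust the positive eigenvalues with multiplicity. Errors: for a map $A\colon P_{I_d}(H_d)\to\mathcal{G}_d$, $\Delta^{\mathrm{wor}}(A;P_{I_d}(H_d))=\sup\{\|S_df-Af\mid\mathcal{G}_d\|\mid f\in P_{I_d}(H_d),\|f\mid H_d\|\le1\}$,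 and $e^{\mathrm{wor}}(n,d;P_{I_d}(H_d))$ is the infimum of $\Delta^{\mathrm{wor}}(A;P_{I_d}(H_d))$ over all algorithms $A=\varphi\circ N$ with arbitrary $\varphi\colon\mathbb{R}^n\to\mathcal{G}_d$ and either $N(f)=(L_1(f),\dots,L_n(f))$ with continuous (not necessarily linear) $L_j$, or adaptive $N(f)=(y_1,\dots,y_n)$, $y_1=L_1(f)$, $y_j=L_j(f;y_1,\dots,y_{j-1})$ with every $L_j(\cdot\,;y_1,\dots,y_{j-1})$ a continuous linear functional (for $n=0$: constant maps). An algorithm using at most $n$ pieces of information is $n$th optimal if it attains this infimum. *)

theory Defs
  imports "HOL-Analysis.Analysis"
begin

section \<open>Operators on subspaces\<close>

text \<open>
  The one-dimensional source and target spaces are types of class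
  \<open>{real_inner, complete_space}\<close>. Since the tensor power depends on the number \<open>d\<close> of factors,
  the spaces built from them are closed subspaces of an ambient inner product
  space, and operators on them are functions whose values outside the subspace are irrelevant.
\<close>

definition linear_on :: "'a::real_vector set \<Rightarrow> ('a \<Rightarrow> 'b::real_vector) \<Rightarrow> bool" where
  "linear_on V T \<longleftrightarrow>
     (\<forall>x\<in>V. \<forall>y\<in>V. T (x + y) = T x + T y) \<and> (\<forall>c. \<forall>x\<in>V. T (c *\<^sub>R x) = c *\<^sub>R T x)"

definition cont_linear_on ::
    "'a::real_normed_vector set \<Rightarrow> ('a \<Rightarrow> 'b::real_normed_vector) \<Rightarrow> bool" where
  "cont_linear_on V T \<longleftrightarrow> linear_on V T \<and> continuous_on V T"

definition compact_operator :: "('a::real_normed_vector \<Rightarrow> 'b::real_normed_vector) \<Rightarrow> bool" where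
  "compact_operator T \<longleftrightarrow> linear T \<and> compact (closure (T ` cball 0 1))"

text \<open>
  Relative version of \<^const>\<open>adjoint\<close>: the Hilbert space adjoint of \<open>T\<close> regarded as an
  operator defined on the complete subspace \<open>V\<close>, so that its values lie in \<open>V\<close>.
\<close>

definition adjoint_on :: "'a::real_inner set \<Rightarrow> ('a \<Rightarrow> 'b::real_inner) \<Rightarrow> 'b \<Rightarrow> 'a" where
  "adjoint_on V T y = (THE x. x \<in> V \<and> (\<forall>v\<in>V. inner (T v) y = inner v x))"

text \<open>
  The last clause says that the positive eigenvalues are exhausted with multiplicity: each
  \<open>\<mu> > 0\<close> occurs as \<open>lam j\<close> exactly as often as the dimension of its eigenspace
  (not at all if that space is zero).
\<close>

definition nontrivial_eigenpairs ::
    "'a::real_inner set \<Rightarrow> ('a \<Rightarrow> 'a) \<Rightarrow> 'i set \<Rightarrow> ('i \<Rightarrow> real) \<Rightarrow> ('i \<Rightarrow> 'a) \<Rightarrow> bool" where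
  "nontrivial_eigenpairs V W J lam \<phi> \<longleftrightarrow>
     (\<forall>j\<in>J. lam j > 0 \<and> \<phi> j \<in> V \<and> W (\<phi> j) = lam j *\<^sub>R \<phi> j) \<and>
     (\<forall>i\<in>J. \<forall>j\<in>J. inner (\<phi> i) (\<phi> j) = (if i = j then 1 else 0)) \<and>
     (\<forall>\<mu>>0. {x \<in> V. W x = \<mu> *\<^sub>R x} = span (\<phi> ` {j \<in> J. lam j = \<mu>}))"


section \<open>Hilbert space tensor powers\<close>

text \<open>
  \<open>X\<close> together with the map \<open>t\<close> is a \<open>d\<close>-fold Hilbert space tensor power of \<open>'h\<close>, where
  \<open>t f\<close> is the elementary tensor \<open>f 1 \<otimes> \<dots> \<otimes> f d\<close>: the span of the elementary tensors is
  the algebraic tensor product with its canonical inner product, and \<open>X\<close> is its completion.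
  These properties determine \<open>(X, t)\<close> up to a unique isometric isomorphism. By the inner product
  formula, \<open>t f\<close> depends on the values of \<open>f\<close> on \<open>{1..d}\<close> only.
\<close>

definition hilbert_tensor_power ::
    "nat \<Rightarrow> 'k::real_inner set \<Rightarrow> ((nat \<Rightarrow> 'h::real_inner) \<Rightarrow> 'k) \<Rightarrow> bool" where
  "hilbert_tensor_power d X t \<longleftrightarrow>
     (\<forall>f. \<forall>i\<in>{1..d}. linear (\<lambda>x. t (f(i := x)))) \<and>
     (\<forall>f g. inner (t f) (t g) = (\<Prod>i=1..d. inner (f i) (g i))) \<and>
     X = closure (span (range t)) \<and> complete X"

text \<open>
  The unique continuous linear operator on \<open>X\<close> that maps each elementary tensor \<open>t f\<close> to \<open>F f\<close>
  (\<^const>\<open>extensional\<close> fixes its irrelevant values outside \<open>X\<close>).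
\<close>

definition tensor_extension ::
    "'k::real_inner set \<Rightarrow> ((nat \<Rightarrow> 'h) \<Rightarrow> 'k) \<Rightarrow> ((nat \<Rightarrow> 'h) \<Rightarrow> 'l::real_inner) \<Rightarrow> 'k \<Rightarrow> 'l" where
  "tensor_extension X t F =
     (THE T. T \<in> extensional X \<and> cont_linear_on X T \<and> (\<forall>f. T (t f) = F f))"

definition tensor_power_operator ::
    "'k::real_inner set \<Rightarrow> ((nat \<Rightarrow> 'h) \<Rightarrow> 'k) \<Rightarrow> ((nat \<Rightarrow> 'g) \<Rightarrow> 'l::real_inner) \<Rightarrow> ('h \<Rightarrow> 'g) \<Rightarrow> 'k \<Rightarrow> 'l" where
  "tensor_power_operator X t u S = tensor_extension X t (\<lambda>f. u (\<lambda>i. S (f i)))"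

definition perm_operator ::
    "'k::real_inner set \<Rightarrow> ((nat \<Rightarrow> 'h) \<Rightarrow> 'k) \<Rightarrow> (nat \<Rightarrow> nat) \<Rightarrow> 'k \<Rightarrow> 'k" where
  "perm_operator X t \<pi> = tensor_extension X t (\<lambda>f. t (\<lambda>i. f (\<pi> i)))"


section \<open>Symmetrizers and antisymmetrizers\<close>

datatype projector_kind = Symmetrizer | Antisymmetrizer

primrec perm_weight :: "projector_kind \<Rightarrow> (nat \<Rightarrow> nat) \<Rightarrow> real" where
  "perm_weight Symmetrizer \<pi> = 1"
| "perm_weight Antisymmetrizer \<pi> = of_int (sign \<pi>)"

definition tensor_projector ::
    "projector_kind \<Rightarrow> 'k::real_inner set \<Rightarrow> ((nat \<Rightarrow> 'h) \<Rightarrow> 'k) \<Rightarrow> nat set \<Rightarrow> 'k \<Rightarrow> 'k" where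
  "tensor_projector P X t I x =
     (1 / real (card {\<pi>. \<pi> permutes I})) *\<^sub>R
       (\<Sum>\<pi> | \<pi> permutes I. perm_weight P \<pi> *\<^sub>R perm_operator X t \<pi> x)"

definition projected_space ::
    "projector_kind \<Rightarrow> 'k::real_inner set \<Rightarrow> ((nat \<Rightarrow> 'h) \<Rightarrow> 'k) \<Rightarrow> nat set \<Rightarrow> 'k set" where
  "projected_space P X t I = tensor_projector P X t I ` X"


section \<open>Index sets and eigenpairs\<close>

definition ecard :: "'a set \<Rightarrow> enat" where
  "ecard A = (if finite A then enat (card A) else \<infinity>)"

definition initial_segment :: "enat \<Rightarrow> nat set" where
  "initial_segment v = {m. 1 \<le> m \<and> enat m < v + 1}"

definition nabla :: "projector_kind \<Rightarrow> enat \<Rightarrow> nat \<Rightarrow> nat set \<Rightarrow> (nat \<Rightarrow> nat) set" where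
  "nabla P v d I =
     {k \<in> {1..d} \<rightarrow>\<^sub>E initial_segment v.
        case P of Symmetrizer \<Rightarrow> mono_on I k | Antisymmetrizer \<Rightarrow> strict_mono_on I k}"

definition mult_fact :: "nat set \<Rightarrow> (nat \<Rightarrow> nat) \<Rightarrow> nat" where
  "mult_fact I k = (\<Prod>m\<in>k ` I. fact (card {i \<in> I. k i = m}))"

definition lam_tilde :: "nat \<Rightarrow> (nat \<Rightarrow> real) \<Rightarrow> (nat \<Rightarrow> nat) \<Rightarrow> real" where
  "lam_tilde d lam k = (\<Prod>l=1..d. lam (k l))"

definition xi_tilde ::
    "projector_kind \<Rightarrow> 'k::real_inner set \<Rightarrow> ((nat \<Rightarrow> 'h) \<Rightarrow> 'k) \<Rightarrow> nat set \<Rightarrow>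
      (nat \<Rightarrow> 'h) \<Rightarrow> (nat \<Rightarrow> nat) \<Rightarrow> 'k" where
  "xi_tilde P X t I \<phi> k =
     sqrt (real (card {\<pi>. \<pi> permutes I}) / real (mult_fact I k)) *\<^sub>R
       tensor_projector P X t I (t (\<lambda>i. \<phi> (k i)))"


section \<open>Algorithms and worst case errors\<close>

text \<open>
  Vectors in \<open>\<real>\<^sup>n\<close> are lists of length \<open>n\<close>.
  In the adaptive case \<open>L j ys\<close> is the functional used in step \<open>j\<close> after the values \<open>ys\<close> (a list
  of length \<open>j - 1\<close>) have been observed.
\<close>

primrec adaptive_info :: "(nat \<Rightarrow> real list \<Rightarrow> 'a \<Rightarrow> real) \<Rightarrow> nat \<Rightarrow> 'a \<Rightarrow> real list" where
  "adaptive_info L 0 f = []"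
| "adaptive_info L (Suc j) f =
     (let ys = adaptive_info L j f in ys @ [L (Suc j) ys f])"

definition continuous_information :: "nat \<Rightarrow> 'a::real_normed_vector set \<Rightarrow> ('a \<Rightarrow> real list) set" where
  "continuous_information n V =
     {N. \<exists>L. (\<forall>j\<in>{1..n}. continuous_on V (L j)) \<and>
             N = (\<lambda>f. map (\<lambda>j. L j f) [1..<n+1])}"

definition adaptive_information :: "nat \<Rightarrow> 'a::real_normed_vector set \<Rightarrow> ('a \<Rightarrow> real list) set" where
  "adaptive_information n V =
     {N. \<exists>L. (\<forall>j\<in>{1..n}. \<forall>ys. length ys = j - 1 \<longrightarrow> cont_linear_on V (L j ys)) \<and>
             N = adaptive_info L n}"

definition algorithms ::
    "nat \<Rightarrow> 'a::real_normed_vector set \<Rightarrow> 'b set \<Rightarrow> ('a \<Rightarrow> 'b) set" where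
  "algorithms n V G =
     {A. \<exists>N \<in> continuous_information n V \<union> adaptive_information n V. \<exists>\<phi>.
           (\<forall>y. length y = n \<longrightarrow> \<phi> y \<in> G) \<and> (\<forall>f\<in>V. A f = \<phi> (N f))}"

definition linear_algorithms ::
    "nat \<Rightarrow> 'a::real_normed_vector set \<Rightarrow> 'b::real_vector set \<Rightarrow> ('a \<Rightarrow> 'b) set" where
  "linear_algorithms n V G =
     {A. \<exists>L g. (\<forall>j\<in>{1..n}. cont_linear_on V (L j) \<and> g j \<in> G) \<and>
               (\<forall>f\<in>V. A f = (\<Sum>j=1..n. L j f *\<^sub>R g j))}"

text \<open>Errors are extended reals, since the error of an arbitrary algorithm may be infinite.\<close>

definition worst_error ::
    "'a::real_normed_vector set \<Rightarrow> ('a \<Rightarrow> 'b::real_normed_vector) \<Rightarrow> ('a \<Rightarrow> 'b) \<Rightarrow> ereal" where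
  "worst_error V S A = (SUP f \<in> {f \<in> V. norm f \<le> 1}. ereal (norm (S f - A f)))"

definition minimal_error ::
    "nat \<Rightarrow> 'a::real_normed_vector set \<Rightarrow> 'b::real_normed_vector set \<Rightarrow> ('a \<Rightarrow> 'b) \<Rightarrow> ereal" where
  "minimal_error n V G S = (INF A \<in> algorithms n V G. worst_error V S A)"

definition nth_optimal ::
    "nat \<Rightarrow> 'a::real_normed_vector set \<Rightarrow> 'b::real_normed_vector set \<Rightarrow>
      ('a \<Rightarrow> 'b) \<Rightarrow> ('a \<Rightarrow> 'b) \<Rightarrow> bool" where
  "nth_optimal n V G S A \<longleftrightarrow>
     (\<exists>m\<le>n. A \<in> algorithms m V G) \<and> worst_error V S A = minimal_error n V G S"

end

theory Submission
  imports Defs "HOL-Homology.Homology"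
begin

text \<open>
  The operator \<open>S\<^sub>d\<close> commutes with the projector \<open>P\<close>, and \<open>S\<^sub>d\<^sup>\<dagger> S\<^sub>d\<close> acts on elementary tensors
  of the \<open>\<phi>\<^sub>m\<close> as multiplication by the product of the eigenvalues; hence the vectors \<open>\<xi>\<^sub>k\<close>,
  which are orthonormal because only rearrangements of \<open>k\<close> contribute to the inner products, are
  eigenvectors. They are exhaustive since a vector of the projected space orthogonal to all of them
  is orthogonal to every tensor whose factors lie in the closed span of the \<open>\<phi>\<^sub>m\<close>, hence to the
  range of \<open>S\<^sub>d\<^sup>\<dagger>\<close>.

  The upper error bound is the Pythagorean theorem. For the lower bound, restrict an algorithm to
  the unit sphere of the span of the first \<open>n + 1\<close> eigenvectors: by the Borsuk--Ulam theorem there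
  is an \<open>f\<close> such that \<open>f\<close> and \<open>-f\<close> have the same \<open>n\<close> information values. That theorem follows
  from the fact that odd maps of spheres have odd degree, whose induction step deforms an odd map
  into one that preserves the equator. This is possible after approximation by a Lipschitz map,
  because the Lipschitz image of the equator misses a line through the origin.
\<close>

section \<open>The Borsuk--Ulam theorem\<close>

text \<open>Information functionals may be nonlinear, so their common zero set need not be a
  subspace and a dimension count does not yield the fooling pair \<open>f\<close>,
  \<open>-f\<close>; this is what requires topology. Adaptive linear information is handled by the
  same theorem, with the functionals frozen along the branch on which all answers are 0: linearity
  turns equal answers at \<open>f\<close> and \<open>-f\<close> into zero answers. The tensor power
  and permutation operators are given by definite descriptions, so their existence has to be proved.
  A map on elementary tensors extends only if it is bounded on all finite combinations of them. For
  the tensor power of \<open>S1\<close> this becomes a comparison of Gram kernels: differences of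
  products telescope into sums of Schur products of positive semidefinite kernels. The eigenvectors
  need not span the source space; only the range of the adjoint lies in their closed span.
  Exhaustion is therefore expressed by the operator vanishing on the orthogonal complement of the
  eigenvectors, not by completeness of an orthonormal system.\<close>

definition unit_sphere :: "nat \<Rightarrow> (nat \<Rightarrow> real) set" where
  "unit_sphere n = {x. L2_set x {..n} = 1 \<and> (\<forall>i>n. x i = 0)}"

definition normalized :: "nat \<Rightarrow> (nat \<Rightarrow> real) \<Rightarrow> nat \<Rightarrow> real" where
  "normalized n x = (\<lambda>i. x i / L2_set x {..n})"

text \<open>Ties the concrete set to the space \<open>nsphere n\<close>, for which
  \<open>Brouwer_degree2\<close> is available; this is why points are sequences that vanish beyond
  \<open>n\<close>.\<close>

lemma nsphere_eq: "nsphere n = top_of_set (unit_sphere n)"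
  unfolding nsphere euclidean_product_topology unit_sphere_def L2_set_def
  by (metis (no_types, lifting) real_sqrt_eq_1_iff)

lemma topspace_nsphere: "topspace (nsphere n) = unit_sphere n"
  by (simp add: nsphere_eq)

lemma continuous_map_nsphere_iff:
  "continuous_map (nsphere m) (nsphere n) f \<longleftrightarrow>
    continuous_on (unit_sphere m) f \<and> f \<in> unit_sphere m \<rightarrow> unit_sphere n"
  by (simp add: nsphere_eq)

lemma uminus_in_unit_sphere [simp]: "(\<lambda>i. - x i) \<in> unit_sphere n \<longleftrightarrow> x \<in> unit_sphere n"
  by (simp add: unit_sphere_def L2_set_def)

lemma unit_sphere_mono: "x \<in> unit_sphere m \<Longrightarrow> m \<le> n \<Longrightarrow> x \<in> unit_sphere n"
proof -
  assume x: "x \<in> unit_sphere m" and mn: "m \<le> n"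
  have "(\<Sum>i\<le>n. (x i)\<^sup>2) = (\<Sum>i\<le>m. (x i)\<^sup>2)"
    using x mn by (intro sum.mono_neutral_right) (auto simp: unit_sphere_def)
  then show ?thesis
    using x mn by (auto simp: unit_sphere_def L2_set_def)
qed

lemma abs_le_L2_set:
  assumes "finite A" "i \<in> A"
  shows "\<bar>f i\<bar> \<le> L2_set f A"
proof -
  have "\<bar>f i\<bar> \<le> L2_set (\<lambda>i. \<bar>f i\<bar>) A"
    using member_le_L2_set[OF assms, of "\<lambda>i. \<bar>f i\<bar>"] by simp
  then show ?thesis by (simp add: L2_set_def)
qed

lemma abs_le_1_unit_sphere: "x \<in> unit_sphere n \<Longrightarrow> \<bar>x i\<bar> \<le> 1"
  using abs_le_L2_set[of "{..n}" i x] by (cases "i \<le> n") (auto simp: unit_sphere_def)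

lemma L2_set_minus_swap: "L2_set (\<lambda>i. f i - g i) A = L2_set (\<lambda>i. g i - f i) A"
  by (simp add: L2_set_def power2_commute)

lemma abs_L2_set_diff_le: "\<bar>L2_set f A - L2_set g A\<bar> \<le> L2_set (\<lambda>i. f i - g i) A"
proof -
  have "L2_set f A \<le> L2_set (\<lambda>i. f i - g i) A + L2_set g A" for f g
    using L2_set_triangle_ineq[of "\<lambda>i. f i - g i" g A] by simp
  from this[of f g] this[of g f] L2_set_minus_swap[of f g A] show ?thesis by simp
qed

lemma continuous_on_L2_set [continuous_intros]:
  "(\<And>i. i \<in> A \<Longrightarrow> continuous_on S (\<lambda>x. f x i)) \<Longrightarrow> continuous_on S (\<lambda>x. L2_set (f x) A)"
  unfolding L2_set_def by (intro continuous_intros) auto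

lemma normalized_in_unit_sphere:
  assumes "\<exists>i\<le>n. x i \<noteq> 0" "\<forall>i>n. x i = 0"
  shows "normalized n x \<in> unit_sphere n"
proof -
  have "L2_set x {..n} > 0"
    using assms by (metis L2_set_eq_0_iff L2_set_nonneg atMost_iff finite_atMost less_eq_real_def)
  moreover have "L2_set (normalized n x) {..n} = L2_set x {..n} * (1 / L2_set x {..n})"
    unfolding normalized_def by (subst L2_set_left_distrib) auto
  ultimately show ?thesis using assms by (simp add: unit_sphere_def normalized_def)
qed

lemma normalized_unit_sphere: "x \<in> unit_sphere n \<Longrightarrow> normalized n x = x"
  by (simp add: unit_sphere_def normalized_def)

text \<open>The sphere is closed in a product of intervals, which is compact by Tychonoff.\<close>

lemma compact_unit_sphere: "compact (unit_sphere n)"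
proof -
  let ?B = "Pi\<^sub>E UNIV (\<lambda>i::nat. {-1..1::real})"
  have "compactin (product_topology (\<lambda>i::nat. euclideanreal) UNIV) ?B"
    by (subst compactin_PiE) auto
  then have "compact ?B"
    by (simp add: euclidean_product_topology)
  moreover have "closed (unit_sphere n)"
  proof -
    have "unit_sphere n = {x. L2_set x {..n} = 1} \<inter> (\<Inter>i\<in>{n<..}. {x. x i = 0})"
      by (auto simp: unit_sphere_def)
    moreover have "closed {x::nat\<Rightarrow>real. L2_set x {..n} = 1}"
      by (intro closed_Collect_eq continuous_intros) auto
    moreover have "closed {x::nat\<Rightarrow>real. x i = 0}" for i
      by (intro closed_Collect_eq continuous_intros) auto
    ultimately show ?thesis by (auto intro!: closed_INT closed_Int)
  qed
  moreover have "unit_sphere n \<subseteq> ?B"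
    using abs_le_1_unit_sphere by (force simp: abs_le_iff)
  ultimately show ?thesis
    by (metis compact_Int_closed inf.absorb_iff2)
qed

text \<open>The straight-line homotopy, projected radially to the sphere; \<open>nz\<close> says
  that the segments avoid the origin.\<close>

lemma homotopic_normalized:
  assumes f: "continuous_on (unit_sphere m) f" and g: "continuous_on (unit_sphere m) g"
    and f0: "\<And>x i. x \<in> unit_sphere m \<Longrightarrow> i > n \<Longrightarrow> f x i = 0"
    and g0: "\<And>x i. x \<in> unit_sphere m \<Longrightarrow> i > n \<Longrightarrow> g x i = 0"
    and nz: "\<And>x t. x \<in> unit_sphere m \<Longrightarrow> 0 \<le> t \<Longrightarrow> t \<le> 1 \<Longrightarrow> \<exists>i\<le>n. (1 - t) * f x i + t * g x i \<noteq> 0"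
  shows "homotopic_with (\<lambda>x. True) (nsphere m) (nsphere n)
           (\<lambda>x. normalized n (f x)) (\<lambda>x. normalized n (g x))"
proof -
  let ?k = "\<lambda>z i. (1 - fst z) * f (snd z) i + fst z * g (snd z) i"
  let ?D = "{0..1::real} \<times> unit_sphere m"
  have cf: "continuous_on ?D (\<lambda>z. f (snd z) i)" for i
    by (rule continuous_on_product_then_coordinatewise, rule continuous_on_compose2[OF f])
       (auto intro: continuous_intros)
  have cg: "continuous_on ?D (\<lambda>z. g (snd z) i)" for i
    by (rule continuous_on_product_then_coordinatewise, rule continuous_on_compose2[OF g])
       (auto intro: continuous_intros)
  have ck: "continuous_on ?D (\<lambda>z. ?k z i)" for i
    by (intro continuous_intros cf cg)
  have "L2_set (?k z) {..n} \<noteq> 0" if "z \<in> ?D" for z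
  proof
    assume "L2_set (?k z) {..n} = 0"
    then have "\<forall>i\<le>n. ?k z i = 0" by (simp add: L2_set_eq_0_iff)
    then show False using nz[of "snd z" "fst z"] that by auto
  qed
  then have c: "continuous_on ?D (\<lambda>z. normalized n (?k z))"
    unfolding normalized_def
    by (intro continuous_on_coordinatewise_then_product continuous_intros ck cf cg) auto
  have m: "(\<lambda>z. normalized n (?k z)) \<in> ?D \<rightarrow> unit_sphere n"
    using nz f0 g0 by (auto intro!: normalized_in_unit_sphere)
  have "continuous_map (prod_topology (top_of_set {0..1}) (nsphere m)) (nsphere n)
          (\<lambda>z. normalized n (?k z))"
    using c m by (simp add: nsphere_eq flip: subtopology_Times)
  then show ?thesis
    unfolding homotopic_with_def by (intro exI[of _ "\<lambda>z. normalized n (?k z)"]) auto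
qed

text \<open>Stone-Weierstrass for the functions that are Lipschitz in the l1 distance: they form an
  algebra because they are bounded on the compact sphere, and the coordinates separate
  points.\<close>

lemma Lipschitz_approximation:
  assumes h: "continuous_on (unit_sphere n) h" and "e > 0"
  obtains p :: "(nat \<Rightarrow> real) \<Rightarrow> real" and L where
    "continuous_on (unit_sphere n) p" "L \<ge> 0"
    "\<And>x y. x \<in> unit_sphere n \<Longrightarrow> y \<in> unit_sphere n \<Longrightarrow> \<bar>p x - p y\<bar> \<le> L * (\<Sum>i\<le>n. \<bar>x i - y i\<bar>)"
    "\<And>x. x \<in> unit_sphere n \<Longrightarrow> \<bar>h x - p x\<bar> < e"
proof -
  let ?S = "unit_sphere n" and ?d = "\<lambda>x y :: nat \<Rightarrow> real. \<Sum>i\<le>n. \<bar>x i - y i\<bar>"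
  define LS where "LS p \<longleftrightarrow> continuous_on ?S p \<and> (\<exists>L\<ge>0. \<forall>x\<in>?S. \<forall>y\<in>?S. \<bar>p x - p y\<bar> \<le> L * ?d x y)"
    for p :: "(nat \<Rightarrow> real) \<Rightarrow> real"
  have LSI: "LS p" if "continuous_on ?S p" "L \<ge> 0"
    "\<And>x y. x \<in> ?S \<Longrightarrow> y \<in> ?S \<Longrightarrow> \<bar>p x - p y\<bar> \<le> L * ?d x y" for p L
    unfolding LS_def using that by blast
  have LSE: thesis if "LS p" "\<And>L. L \<ge> 0 \<Longrightarrow> (\<And>x y. x \<in> ?S \<Longrightarrow> y \<in> ?S \<Longrightarrow> \<bar>p x - p y\<bar> \<le> L * ?d x y) \<Longrightarrow> thesis"
    for p thesis
    using that unfolding LS_def by blast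
  have LSc: "continuous_on ?S p" if "LS p" for p using that LS_def by blast
  have "\<exists>p. LS p \<and> (\<forall>x\<in>?S. \<bar>h x - p x\<bar> < e)"
  proof (rule Stone_Weierstrass_HOL[OF compact_unit_sphere])
    show "LS (\<lambda>x. c)" for c
      by (rule LSI[of _ 0]) (simp_all add: continuous_on_const)
    show "LS (\<lambda>x. f x + g x)" if fg: "LS f \<and> LS g" for f g
    proof -
      have f: "LS f" and g: "LS g" using fg by auto
      obtain K where K: "K \<ge> 0" "\<And>x y. x \<in> ?S \<Longrightarrow> y \<in> ?S \<Longrightarrow> \<bar>f x - f y\<bar> \<le> K * ?d x y"
        using LSE[OF f] by metis
      obtain L where L: "L \<ge> 0" "\<And>x y. x \<in> ?S \<Longrightarrow> y \<in> ?S \<Longrightarrow> \<bar>g x - g y\<bar> \<le> L * ?d x y"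
        using LSE[OF g] by metis
      show ?thesis
      proof (rule LSI)
        show "\<bar>f x + g x - (f y + g y)\<bar> \<le> (K + L) * ?d x y" if "x \<in> ?S" "y \<in> ?S" for x y
          unfolding distrib_right using K(2)[OF that] L(2)[OF that] by linarith
      qed (use K(1) L(1) LSc[OF f] LSc[OF g] in \<open>auto intro: continuous_on_add\<close>)
    qed
    show "LS (\<lambda>x. f x * g x)" if fg: "LS f \<and> LS g" for f g
    proof -
      have f: "LS f" and g: "LS g" using fg by auto
      obtain K where K: "K \<ge> 0" "\<And>x y. x \<in> ?S \<Longrightarrow> y \<in> ?S \<Longrightarrow> \<bar>f x - f y\<bar> \<le> K * ?d x y"
        using LSE[OF f] by metis
      obtain L where L: "L \<ge> 0" "\<And>x y. x \<in> ?S \<Longrightarrow> y \<in> ?S \<Longrightarrow> \<bar>g x - g y\<bar> \<le> L * ?d x y"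
        using LSE[OF g] by metis
      have "bounded (f ` ?S)" "bounded (g ` ?S)"
        using LSc f g compact_unit_sphere by (auto intro!: compact_imp_bounded compact_continuous_image)
      then obtain A B where A: "\<And>x. x \<in> ?S \<Longrightarrow> \<bar>f x\<bar> \<le> A" and B: "\<And>x. x \<in> ?S \<Longrightarrow> \<bar>g x\<bar> \<le> B"
        unfolding bounded_iff by auto
      show ?thesis
      proof (rule LSI)
        show "\<bar>f x * g x - f y * g y\<bar> \<le> (\<bar>A\<bar> * L + \<bar>B\<bar> * K) * ?d x y"
          if x: "x \<in> ?S" and y: "y \<in> ?S" for x y
        proof -
          have "f x * g x - f y * g y = f x * (g x - g y) + g y * (f x - f y)"
            by (simp add: algebra_simps)
          then have "\<bar>f x * g x - f y * g y\<bar> \<le> \<bar>f x\<bar> * \<bar>g x - g y\<bar> + \<bar>g y\<bar> * \<bar>f x - f y\<bar>"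
            by (metis abs_mult abs_triangle_ineq)
          also have "\<dots> \<le> \<bar>A\<bar> * (L * ?d x y) + \<bar>B\<bar> * (K * ?d x y)"
          proof (intro add_mono mult_mono)
            show "\<bar>f x\<bar> \<le> \<bar>A\<bar>" "\<bar>g y\<bar> \<le> \<bar>B\<bar>" using A[OF x] B[OF y] by linarith+
          qed (use K(2)[OF x y] L(2)[OF x y] in auto)
          finally show ?thesis by (simp only: distrib_right mult.assoc)
        qed
      qed (use K(1) L(1) LSc[OF f] LSc[OF g] in \<open>auto intro: continuous_on_mult\<close>)
    qed
    show "\<exists>f. LS f \<and> f x \<noteq> f y" if xy: "x \<in> ?S \<and> y \<in> ?S \<and> x \<noteq> y" for x y
    proof -
      obtain i where i: "x i \<noteq> y i" using xy by auto
      then have "i \<le> n" using xy by (metis (mono_tags, lifting) mem_Collect_eq not_le unit_sphere_def)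
      have "LS (\<lambda>u. u i)"
      proof (rule LSI[of _ 1])
        show "\<bar>u i - v i\<bar> \<le> 1 * ?d u v" for u v :: "nat \<Rightarrow> real"
          using member_le_sum[of i "{..n}" "\<lambda>i. \<bar>u i - v i\<bar>"] \<open>i \<le> n\<close> by simp
      qed (auto intro: continuous_on_subset[OF continuous_on_product_coordinates])
      then show ?thesis using i by blast
    qed
    show "continuous_on ?S f" if "LS f" for f using that by (rule LSc)
  qed (use assms in auto)
  then obtain p where p: "LS p" "\<And>x. x \<in> ?S \<Longrightarrow> \<bar>h x - p x\<bar> < e" by blast
  show thesis
    by (rule LSE[OF p(1)]) (rule that[OF LSc[OF p(1)] _ _ p(2)])
qed

text \<open>Preimages of \<open>K ^ (m + 1)\<close> grid points at mutual distance \<open>1 / K\<close> lie in different cells of a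
  partition of \<open>[-1, 1] ^ m\<close> into \<open>O(K ^ m)\<close> cells.\<close>

lemma no_Lipschitz_surjection:
  assumes "L \<ge> 0"
    and Y: "\<And>y i. y \<in> Y \<Longrightarrow> i < m \<Longrightarrow> \<bar>y i\<bar> \<le> 1"
    and F: "\<And>y z i. y \<in> Y \<Longrightarrow> z \<in> Y \<Longrightarrow> i \<le> m \<Longrightarrow> \<bar>F y i - F z i\<bar> \<le> L * (\<Sum>k<m. \<bar>y k - z k\<bar>)"
  shows "\<exists>z::nat \<Rightarrow> real. (\<forall>i\<le>m. 0 < z i \<and> z i \<le> 1) \<and> (\<forall>y\<in>Y. \<exists>i\<le>m. F y i \<noteq> z i)"
proof (rule ccontr)
  assume neg: "\<not> ?thesis"
  \<comment> \<open>As \<open>A > L * m\<close>, points in a common cell of side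
    \<open>1 / (K * A)\<close> have images less than \<open>1 / K\<close> apart.\<close>
  define A where "A = nat \<lceil>L * m\<rceil> + 1"
  have A: "L * m < A" "A > 0" unfolding A_def using assms(1) by (auto, linarith)
  \<comment> \<open>\<open>K\<close> exceeds \<open>(2 * A + 1) ^ m\<close>, so that the
    \<open>K ^ (m + 1)\<close> grid points outnumber the \<open>(2 * K * A + 1) ^ m\<close>
    cells.\<close>
  define K where "K = (2 * A + 1) ^ m + 1"
  have K: "K > 0" by (simp add: K_def)
  define Q where "Q = K * A"
  have Q: "Q > 0" using A K by (simp add: Q_def)
  let ?J = "{..m} \<rightarrow>\<^sub>E {1..K}"
  have "\<exists>y\<in>Y. \<forall>i\<le>m. F y i = j i / K" if "j \<in> ?J" for j
    using neg that K by (auto simp: PiE_iff Ball_def dest!: spec[of _ "\<lambda>i. j i / real K"])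
  then obtain y where y: "\<And>j. j \<in> ?J \<Longrightarrow> y j \<in> Y" "\<And>j i. j \<in> ?J \<Longrightarrow> i \<le> m \<Longrightarrow> F (y j) i = j i / K"
    by metis
  \<comment> \<open>The cell of the preimage of grid point \<open>j\<close>: integer parts after
    \<open>[-1, 1]\<close> is rescaled to \<open>[0, 2 * Q]\<close>.\<close>
  define c where "c j = (\<lambda>i\<in>{..<m}. nat \<lfloor>(y j i + 1) * Q\<rfloor>)" for j
  have "inj_on c ?J"
  proof (rule inj_onI)
    fix j j' assume j: "j \<in> ?J" and j': "j' \<in> ?J" and eq: "c j = c j'"
    have d: "\<bar>y j k - y j' k\<bar> \<le> 1 / Q" if k: "k < m" for k
    proof -
      have "nat \<lfloor>(y j k + 1) * Q\<rfloor> = nat \<lfloor>(y j' k + 1) * Q\<rfloor>"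
        using fun_cong[OF eq, of k] k by (simp add: c_def)
      moreover have "(y j k + 1) * Q \<ge> 0" "(y j' k + 1) * Q \<ge> 0"
        using Y[OF y(1)[OF j] k] Y[OF y(1)[OF j'] k] by (auto simp: abs_le_iff)
      ultimately have "\<lfloor>(y j k + 1) * Q\<rfloor> = \<lfloor>(y j' k + 1) * Q\<rfloor>"
        by (simp add: nat_eq_iff)
      then have "\<bar>(y j k + 1) * Q - (y j' k + 1) * Q\<bar> \<le> 1" by linarith
      then have "\<bar>y j k - y j' k\<bar> * Q \<le> 1"
        using Q by (simp add: abs_mult flip: left_diff_distrib)
      then show ?thesis using Q by (simp add: field_simps)
    qed
    have "j i = j' i" if i: "i \<le> m" for i
    proof -
      have "\<bar>real (j i) / K - j' i / K\<bar> \<le> L * (\<Sum>k<m. \<bar>y j k - y j' k\<bar>)"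
        using F[OF y(1)[OF j] y(1)[OF j'] i] y(2)[OF j i] y(2)[OF j' i] by simp
      also have "\<dots> \<le> L * (\<Sum>k<m. 1 / Q)"
        by (intro mult_left_mono sum_mono d assms) auto
      also have "\<dots> = L * m / Q" by simp
      also have "\<dots> < A / Q" using A Q by (intro divide_strict_right_mono) auto
      also have "\<dots> = 1 / K" using A by (simp add: Q_def)
      finally have "\<bar>real (j i) - j' i\<bar> / K < 1 / K"
        using K by (simp add: abs_divide flip: diff_divide_distrib)
      then have "\<bar>real (j i) - j' i\<bar> < 1" using K by (simp add: divide_less_cancel)
      then show ?thesis by linarith
    qed
    then show "j = j'" using j j' by (intro PiE_ext[OF j j']) auto
  qed
  moreover have "c ` ?J \<subseteq> {..<m} \<rightarrow>\<^sub>E {..2 * Q}"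
  proof (rule image_subsetI)
    fix j assume j: "j \<in> ?J"
    have "nat \<lfloor>(y j i + 1) * Q\<rfloor> \<le> 2 * Q" if "i < m" for i
    proof -
      have "y j i + 1 \<le> 2" using Y[OF y(1)[OF j] that] by (auto simp: abs_le_iff)
      then have "(y j i + 1) * Q \<le> 2 * Q" using Q by simp
      then show ?thesis by (simp add: nat_le_iff floor_le_iff)
    qed
    then show "c j \<in> {..<m} \<rightarrow>\<^sub>E {..2 * Q}" by (auto simp: c_def)
  qed
  ultimately have "card ?J \<le> card ({..<m} \<rightarrow>\<^sub>E {..2 * Q})"
    by (intro card_inj_on_le[of c]) (auto intro: finite_PiE)
  then have "K ^ Suc m \<le> (2 * Q + 1) ^ m" by (simp add: card_PiE)
  also have "\<dots> \<le> (K * (2 * A + 1)) ^ m"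
    using K by (intro power_mono) (auto simp: Q_def algebra_simps)
  also have "\<dots> = K ^ m * (2 * A + 1) ^ m" by (rule power_mult_distrib)
  finally have "K \<le> (2 * A + 1) ^ m" using K by simp
  then show False by (simp add: K_def)
qed

text \<open>Apply the previous lemma to the cone \<open>y \<mapsto> \<parallel>y\<parallel> * p (y / \<parallel>y\<parallel>)\<close>, whose Lipschitz constant is controlled by that
  of \<open>p\<close>; it vanishes at \<open>0\<close> since \<open>normalized n 0\<close> is multiplied by \<open>0\<close>.\<close>

lemma missed_line:
  assumes L: "L \<ge> 0"
    and Lip: "\<And>x y i. x \<in> unit_sphere n \<Longrightarrow> y \<in> unit_sphere n \<Longrightarrow> i \<le> Suc n \<Longrightarrow>
      \<bar>p x i - p y i\<bar> \<le> L * (\<Sum>k\<le>n. \<bar>x k - y k\<bar>)"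
    and M: "\<And>x i. x \<in> unit_sphere n \<Longrightarrow> i \<le> Suc n \<Longrightarrow> \<bar>p x i\<bar> \<le> M"
    and odd: "\<And>x i. x \<in> unit_sphere n \<Longrightarrow> i \<le> Suc n \<Longrightarrow> p (\<lambda>i. - x i) i = - p x i"
    and below: "\<And>x. x \<in> unit_sphere n \<Longrightarrow> L2_set (p x) {..Suc n} \<ge> 1 / 2"
  obtains e :: "nat \<Rightarrow> real" where "e (Suc n) = 1" "\<And>i. i > Suc n \<Longrightarrow> e i = 0"
    "\<And>x r. x \<in> unit_sphere n \<Longrightarrow> \<exists>i\<le>Suc n. e i \<noteq> r * p x i"
proof -
  \<comment> \<open>The point \<open>(s / B) * w\<close> constructed at the end must lie in the unit
    cube. There \<open>s \<le> 2 * (n + 2)\<close>, since \<open>p w\<close> has norm at least 1/2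
    and \<open>z\<close> has \<open>n + 2\<close> coordinates in \<open>(0, 1]\<close>.\<close>
  define B where "B = 2 * real (n + 2)"
  have B: "B > 0" by (simp add: B_def)
  define Y where "Y = {y::nat\<Rightarrow>real. (\<forall>i. \<bar>y i\<bar> \<le> 1) \<and> (\<forall>i>n. y i = 0)}"
  define F where "F y i = B * L2_set y {..n} * p (normalized n y) i" for y i
  let ?D = "\<lambda>x y. \<Sum>k\<le>n. \<bar>x k - y k :: real\<bar>"
  have D0: "?D x y \<ge> 0" for x y by (simp add: sum_nonneg)
  have M0: "M \<ge> 0"
    using M[of "normalized n (\<lambda>i. if i = 0 then 1 else 0)" 0] normalized_in_unit_sphere[of n "\<lambda>i. if i = 0 then 1 else 0"]
    by force
  have norm_le_D: "\<bar>L2_set y {..n} - L2_set z {..n}\<bar> \<le> ?D y z" for y z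
    using abs_L2_set_diff_le[of y "{..n}" z] L2_set_le_sum_abs[of "\<lambda>i. y i - z i" "{..n}"] by linarith
  have nz: "y = (\<lambda>_. 0)" if "y \<in> Y" "L2_set y {..n} = 0" for y
  proof
    show "y i = 0" for i
      using that by (cases "i \<le> n") (auto simp: Y_def L2_set_eq_0_iff)
  qed
  have in_sph: "normalized n y \<in> unit_sphere n" if "y \<in> Y" "L2_set y {..n} \<noteq> 0" for y
    using that by (intro normalized_in_unit_sphere) (auto simp: Y_def L2_set_eq_0_iff)
  have F0: "\<bar>F y i\<bar> \<le> B * M * L2_set y {..n}" if "y \<in> Y" "i \<le> Suc n" for y i
  proof (cases "L2_set y {..n} = 0")
    case False
    then have "B * L2_set y {..n} * \<bar>p (normalized n y) i\<bar> \<le> B * L2_set y {..n} * M"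
      using M[OF in_sph[OF that(1) False] that(2)] B by (intro mult_left_mono) auto
    then show ?thesis using B by (simp add: F_def abs_mult algebra_simps)
  qed (simp add: F_def)
  have FL: "\<bar>F y i - F z i\<bar> \<le> B * (M + L * (n + 2)) * ?D y z" if y: "y \<in> Y" and z: "z \<in> Y" and i: "i \<le> Suc n" for y z i
  proof -
    let ?y = "L2_set y {..n}" and ?z = "L2_set z {..n}"
    have le: "B * M * ?D y z \<le> B * (M + L * (n + 2)) * ?D y z"
      using B L D0[of y z] by (intro mult_right_mono mult_left_mono) auto
    consider "?y = 0" | "?z = 0" | "?y \<noteq> 0" "?z \<noteq> 0" by blast
    then show ?thesis
    proof cases
      case 1
      then have "\<bar>F y i - F z i\<bar> \<le> B * M * ?z" using F0[OF z i] by (simp add: F_def)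
      also have "?z \<le> ?D y z" using norm_le_D[of y z] 1 by simp
      then have "B * M * ?z \<le> B * M * ?D y z" using B M0 by (intro mult_left_mono) auto
      finally show ?thesis using le by simp
    next
      case 2
      then have "\<bar>F y i - F z i\<bar> \<le> B * M * ?y" using F0[OF y i] by (simp add: F_def)
      also have "?y \<le> ?D y z" using norm_le_D[of y z] 2 by simp
      then have "B * M * ?y \<le> B * M * ?D y z" using B M0 by (intro mult_left_mono) auto
      finally show ?thesis using le by simp
    next
      case 3
      then have yp: "?y > 0" and zp: "?z > 0" using L2_set_nonneg less_eq_real_def by metis+
      let ?u = "normalized n y" and ?v = "normalized n z"
      have u: "?u \<in> unit_sphere n" and v: "?v \<in> unit_sphere n" using in_sph y z 3 by auto
      \<comment> \<open>Normalization alone has unbounded Lipschitz constant near the origin; the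
        factor \<open>?z\<close> coming from the cone compensates this.\<close>
      have "?z * \<bar>?u k - ?v k\<bar> \<le> \<bar>y k - z k\<bar> + ?D y z" if k: "k \<le> n" for k
      proof -
        have "?z * \<bar>?u k - ?v k\<bar> = \<bar>?z * (?u k - ?v k)\<bar>" using zp by (simp add: abs_mult)
        also have "?z * (?u k - ?v k) = (y k - z k) + (y k / ?y) * (?z - ?y)"
          using yp zp by (simp add: normalized_def field_simps)
        also have "\<bar>\<dots>\<bar> \<le> \<bar>y k - z k\<bar> + \<bar>y k / ?y\<bar> * \<bar>?z - ?y\<bar>"
          by (metis abs_mult abs_triangle_ineq)
        also have "\<bar>y k / ?y\<bar> \<le> 1"
          using abs_le_1_unit_sphere[OF u, of k] by (simp add: normalized_def)
        then have "\<bar>y k / ?y\<bar> * \<bar>?z - ?y\<bar> \<le> 1 * ?D y z"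
          using norm_le_D[of y z] by (intro mult_mono) (auto simp: abs_minus_commute)
        finally show ?thesis by simp
      qed
      then have "(\<Sum>k\<le>n. ?z * \<bar>?u k - ?v k\<bar>) \<le> (\<Sum>k\<le>n. \<bar>y k - z k\<bar> + ?D y z)"
        by (intro sum_mono) auto
      also have "\<dots> = (n + 2) * ?D y z" by (simp add: sum.distrib algebra_simps)
      finally have zD: "?z * ?D ?u ?v \<le> (n + 2) * ?D y z" by (simp add: sum_distrib_left)
      have "F y i - F z i = B * ((?y - ?z) * p ?u i + ?z * (p ?u i - p ?v i))"
        by (simp add: F_def algebra_simps)
      then have "\<bar>F y i - F z i\<bar> = B * \<bar>(?y - ?z) * p ?u i + ?z * (p ?u i - p ?v i)\<bar>"
        using B by (simp add: abs_mult)
      also have "\<dots> \<le> B * (\<bar>?y - ?z\<bar> * \<bar>p ?u i\<bar> + ?z * \<bar>p ?u i - p ?v i\<bar>)"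
        using B zp abs_triangle_ineq[of "(?y - ?z) * p ?u i" "?z * (p ?u i - p ?v i)"]
        by (simp add: abs_mult)
      also have "\<dots> \<le> B * (?D y z * M + ?z * (L * ?D ?u ?v))"
        using B M[OF u i] Lip[OF u v i] norm_le_D[of y z] D0[of y z] zp
        by (intro mult_left_mono add_mono mult_mono) auto
      also have "\<dots> = B * (M * ?D y z + L * (?z * ?D ?u ?v))"
        by (simp add: algebra_simps)
      also have "\<dots> \<le> B * (M * ?D y z + L * ((n + 2) * ?D y z))"
        using zD B L by (intro mult_left_mono add_left_mono) auto
      finally show ?thesis by (simp add: algebra_simps)
    qed
  qed
  have "\<exists>z::nat \<Rightarrow> real. (\<forall>i\<le>Suc n. 0 < z i \<and> z i \<le> 1) \<and> (\<forall>y\<in>Y. \<exists>i\<le>Suc n. F y i \<noteq> z i)"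
    by (rule no_Lipschitz_surjection[where L = "B * (M + L * (n + 2))"])
       (use FL B L M0 in \<open>auto simp: Y_def lessThan_Suc_atMost\<close>)
  then obtain z where z: "\<And>i. i \<le> Suc n \<Longrightarrow> 0 < z i \<and> z i \<le> 1"
    "\<And>y. y \<in> Y \<Longrightarrow> \<exists>i\<le>Suc n. F y i \<noteq> z i" by blast
  \<comment> \<open>All coordinates of \<open>z\<close> are positive, so it can be rescaled to last
    coordinate 1, the form needed for projecting along \<open>e\<close>.\<close>
  define e where "e i = (if i \<le> Suc n then z i / z (Suc n) else 0)" for i
  show thesis
  proof
    have zS: "z (Suc n) > 0" using z(1) by blast
    then show "e (Suc n) = 1" by (simp add: e_def)
    show "e i = 0" if "i > Suc n" for i using that by (simp add: e_def)
    show "\<exists>i\<le>Suc n. e i \<noteq> r * p x i" if x: "x \<in> unit_sphere n" for x r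
    proof (rule ccontr)
      assume "\<not> (\<exists>i\<le>Suc n. e i \<noteq> r * p x i)"
      then have ei: "e i = r * p x i" if "i \<le> Suc n" for i using that by blast
      have zi: "z i = (r * z (Suc n)) * p x i" if "i \<le> Suc n" for i
      proof -
        have "z i / z (Suc n) = r * p x i" using ei[OF that] that unfolding e_def by simp
        then show ?thesis using zS by (simp add: divide_eq_eq ac_simps)
      qed
      \<comment> \<open>The cone contains only nonnegative multiples of values of \<open>p\<close>;
        by oddness a negative multiple is a positive one at the antipode.\<close>
      obtain s w where w: "w \<in> unit_sphere n" and s: "s \<ge> 0"
        and zs: "\<And>i. i \<le> Suc n \<Longrightarrow> z i = s * p w i"
      proof (cases "r \<ge> 0")
        case True
        then have "r * z (Suc n) \<ge> 0" using zS by simp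
        then show ?thesis using that[OF x _ zi] by blast
      next
        case False
        show ?thesis
        proof (rule that)
          show "(\<lambda>i. - x i) \<in> unit_sphere n" using x by simp
          show "0 \<le> - r * z (Suc n)" using False zS by (simp add: mult_nonpos_nonneg)
          show "z i = - r * z (Suc n) * p (\<lambda>i. - x i) i" if "i \<le> Suc n" for i
            unfolding odd[OF x that] by (subst zi[OF that]) simp
        qed
      qed
      have "s * (1/2) \<le> s * L2_set (p w) {..Suc n}"
        using below[OF w] s by (intro mult_left_mono) auto
      also have "\<dots> = L2_set z {..Suc n}"
        using s zs by (subst L2_set_right_distrib) (auto intro!: L2_set_cong)
      also have "\<dots> \<le> (\<Sum>i\<le>Suc n. \<bar>z i\<bar>)" by (rule L2_set_le_sum_abs)
      also have "\<dots> \<le> (\<Sum>i\<le>Suc n. 1)" using z(1) by (intro sum_mono) (auto simp: less_imp_le)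
      finally have sB: "s \<le> B" by (simp add: B_def)
      have s0: "s > 0" using zs[of "Suc n"] zS s by (cases "s = 0") auto
      define y where "y i = s / B * w i" for i
      have "\<bar>y i\<bar> \<le> 1" for i
      proof -
        have "\<bar>y i\<bar> = (s / B) * \<bar>w i\<bar>" using s B by (simp add: y_def abs_mult)
        also have "\<dots> \<le> 1 * 1"
          using abs_le_1_unit_sphere[OF w, of i] sB B s by (intro mult_mono) auto
        finally show ?thesis by simp
      qed
      then have "y \<in> Y" using w by (auto simp: Y_def y_def unit_sphere_def)
      have Ly: "L2_set y {..n} = s / B"
      proof -
      have "s / B * L2_set w {..n} = L2_set y {..n}"
        unfolding y_def using s B by (intro L2_set_right_distrib) simp
      then show ?thesis using w by (simp add: unit_sphere_def)
    qed
      have "normalized n y = w"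
        unfolding normalized_def Ly using s0 B by (auto simp: y_def)
      then have "F y i = z i" if "i \<le> Suc n" for i
        using zs[OF that] B by (simp add: F_def Ly)
      then show False using z(2)[OF \<open>y \<in> Y\<close>] by auto
    qed
  qed
qed

text \<open>By \<open>Borsuk_odd_mapping_degree_step\<close> an odd map that sends the equator to
  itself has degree congruent modulo 2 to that of its restriction to the equator, where the
  induction hypothesis applies. On the two points of the 0-sphere an odd map is the identity or the
  reflection, of degree 1 or -1.\<close>

theorem odd_map_odd_degree:
  assumes "continuous_map (nsphere n) (nsphere n) h"
    and "\<And>x. x \<in> unit_sphere n \<Longrightarrow> h (\<lambda>i. - x i) = (\<lambda>i. - h x i)"
  shows "odd (Brouwer_degree2 n h)"
  using assms
proof (induction n arbitrary: h)
  case 0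
  have mem: "x \<in> unit_sphere 0 \<longleftrightarrow> \<bar>x 0\<bar> = 1 \<and> (\<forall>i>0. x i = 0)" for x
    by (simp add: unit_sphere_def)
  define a :: "nat \<Rightarrow> real" where "a = (\<lambda>i. if i = 0 then 1 else 0)"
  have a: "a \<in> unit_sphere 0" by (simp add: mem a_def)
  have cases: "x = a \<or> x = (\<lambda>i. - a i)" if "x \<in> unit_sphere 0" for x
  proof -
    have "x 0 = 1 \<or> x 0 = - 1" using that by (auto simp: mem)
    then show ?thesis using that by (auto simp: mem a_def fun_eq_iff)
  qed
  have ha: "h a \<in> unit_sphere 0"
    using 0(1) a by (auto simp: continuous_map_nsphere_iff)
  show ?case
  proof (cases "h a = a")
    case True
    have "h x = id x" if "x \<in> unit_sphere 0" for x
      using cases[OF that] True 0(2)[OF a] by auto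
    then have "Brouwer_degree2 0 h = Brouwer_degree2 0 id"
      by (intro Brouwer_degree2_eq) (simp only: topspace_nsphere)
    then show ?thesis by simp
  next
    case False
    have "h x = (\<lambda>i. if i = 0 then - x i else x i)" if "x \<in> unit_sphere 0" for x
    proof -
      have "h a = (\<lambda>i. - a i)" using cases[OF ha] False by blast
      then have "h x = (\<lambda>i. - x i)" using cases[OF that] 0(2)[OF a] by auto
      moreover have "x i = 0" if "i \<noteq> 0" for i using that \<open>x \<in> unit_sphere 0\<close> by (simp add: mem)
      ultimately show ?thesis by auto
    qed
    then have "Brouwer_degree2 0 h = Brouwer_degree2 0 (\<lambda>x i. if i = 0 then - x i else x i)"
      by (intro Brouwer_degree2_eq) (simp only: topspace_nsphere)
    then show ?thesis by (simp only: Brouwer_degree2_reflection) simp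
  qed
next
  case (Suc m)
  note sum.atMost_Suc [simp del]
  let ?n = "Suc m" and ?S = "unit_sphere (Suc m)"
  have hc: "continuous_on ?S h" and hS: "\<And>x. x \<in> ?S \<Longrightarrow> h x \<in> ?S"
    using Suc.prems(1) by (auto simp: continuous_map_nsphere_iff)
  \<comment> \<open>An error of \<open>\<epsilon>\<close> in each of the \<open>m + 2\<close>
    coordinates adds up to 1/2, so the segment from \<open>h x\<close> to the approximation stays at
    distance at least 1/2 from the origin.\<close>
  define \<epsilon> where "\<epsilon> = 1 / (2 * real (m + 2))"
  have \<epsilon>: "\<epsilon> > 0" by (simp add: \<epsilon>_def)
  define good where "good i p L \<longleftrightarrow> continuous_on ?S p \<and> L \<ge> 0 \<and>
    (\<forall>x\<in>?S. \<forall>y\<in>?S. \<bar>p x - p y\<bar> \<le> L * (\<Sum>k\<le>?n. \<bar>x k - y k\<bar>)) \<and>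
    (\<forall>x\<in>?S. \<bar>h x i - p x\<bar> < \<epsilon>)" for i p L
  have "\<exists>p L. good i p L" for i
    by (rule Lipschitz_approximation[OF continuous_on_product_then_coordinatewise[OF hc, of i] \<epsilon>])
       (unfold good_def, blast)
  then obtain p0 L0 where "\<And>i. good i (p0 i) (L0 i)" by metis
  then have p0: "\<And>i. continuous_on ?S (p0 i)" "\<And>i. L0 i \<ge> 0"
    "\<And>i x y. x \<in> ?S \<Longrightarrow> y \<in> ?S \<Longrightarrow> \<bar>p0 i x - p0 i y\<bar> \<le> L0 i * (\<Sum>k\<le>?n. \<bar>x k - y k\<bar>)"
    "\<And>i x. x \<in> ?S \<Longrightarrow> \<bar>h x i - p0 i x\<bar> < \<epsilon>"
    unfolding good_def by blast+
  define L where "L = (\<Sum>i\<le>?n. L0 i)"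
  \<comment> \<open>The odd part of the approximation; since \<open>h\<close> is odd, averaging does
    not worsen the error bound.\<close>
  define p where "p x i = (if i \<le> ?n then (p0 i x - p0 i (\<lambda>i. - x i)) / 2 else 0)" for x i
  have cneg: "continuous_on ?S (\<lambda>x. p0 i (\<lambda>i. - x i))" for i
    by (rule continuous_on_compose2[OF p0(1)])
       (auto intro!: continuous_on_coordinatewise_then_product continuous_intros continuous_on_subset[OF continuous_on_product_coordinates])
  have pc: "continuous_on ?S (\<lambda>x. p x i)" for i
    using p0(1) cneg by (cases "i \<le> ?n") (auto simp: p_def intro!: continuous_intros)
  have podd: "p (\<lambda>i. - x i) i = - p x i" for x i
    by (simp add: p_def field_simps)
  have L: "L \<ge> 0" "\<And>i. i \<le> ?n \<Longrightarrow> L0 i \<le> L"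
    using p0(2) by (auto simp: L_def intro!: sum_nonneg member_le_sum)
  have half: "\<bar>a\<bar> \<le> c \<Longrightarrow> \<bar>b\<bar> \<le> c \<Longrightarrow> \<bar>(a - b) / 2\<bar> \<le> c" for a b c :: real
    by (simp add: abs_le_iff; linarith)
  have pL: "\<bar>p x i - p y i\<bar> \<le> L * (\<Sum>k\<le>?n. \<bar>x k - y k\<bar>)" if "x \<in> ?S" "y \<in> ?S" "i \<le> ?n" for x y i
  proof -
    let ?d = "\<Sum>k\<le>?n. \<bar>x k - y k\<bar>"
    have "\<bar>- x k - - y k\<bar> = \<bar>x k - y k\<bar>" for k by simp
    then have "\<bar>p0 i (\<lambda>i. - x i) - p0 i (\<lambda>i. - y i)\<bar> \<le> L0 i * ?d"
      using p0(3)[of "\<lambda>i. - x i" "\<lambda>i. - y i" i] that by (simp only: uminus_in_unit_sphere)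
    moreover have "p x i - p y i = ((p0 i x - p0 i y) - (p0 i (\<lambda>i. - x i) - p0 i (\<lambda>i. - y i))) / 2"
      using that(3) by (simp add: p_def diff_divide_distrib)
    ultimately have "\<bar>p x i - p y i\<bar> \<le> L0 i * ?d"
      using half p0(3)[OF that(1,2), of i] by metis
    also have "\<dots> \<le> L * ?d" using L(2)[OF that(3)] by (intro mult_right_mono sum_nonneg) auto
    finally show ?thesis .
  qed
  have ph: "\<bar>h x i - p x i\<bar> \<le> \<epsilon>" if "x \<in> ?S" "i \<le> ?n" for x i
  proof -
    have "h x i - p x i = ((h x i - p0 i x) - (h (\<lambda>i. - x i) i - p0 i (\<lambda>i. - x i))) / 2"
      using that(2) Suc.prems(2)[OF that(1)] by (simp add: p_def diff_divide_distrib add_divide_distrib)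
    moreover have "(\<lambda>i. - x i) \<in> ?S" using that(1) by simp
    ultimately show ?thesis
      using half[OF less_imp_le less_imp_le, OF p0(4)[OF that(1), of i] p0(4)[of "\<lambda>i. - x i" i]] by simp
  qed
  have hpd: "L2_set (\<lambda>i. h x i - p x i) {..?n} \<le> 1 / 2" if "x \<in> ?S" for x
  proof -
    have "L2_set (\<lambda>i. h x i - p x i) {..?n} \<le> (\<Sum>i\<le>?n. \<bar>h x i - p x i\<bar>)"
      by (rule L2_set_le_sum_abs)
    also have "\<dots> \<le> (\<Sum>i\<le>?n. \<epsilon>)" using ph[OF that] by (intro sum_mono) auto
    also have "\<dots> = 1 / 2" by (simp add: \<epsilon>_def field_simps)
    finally show ?thesis .
  qed
  have hp: "L2_set (\<lambda>i. (1 - t) * h x i + t * p x i) {..?n} \<ge> 1 / 2" if "x \<in> ?S" "0 \<le> t" "t \<le> 1" for x t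
  proof -
    have "1 - L2_set (\<lambda>i. (1 - t) * h x i + t * p x i) {..?n}
        \<le> L2_set (\<lambda>i. h x i - ((1 - t) * h x i + t * p x i)) {..?n}"
      using abs_L2_set_diff_le[of "h x" "{..?n}" "\<lambda>i. (1 - t) * h x i + t * p x i"] hS[OF that(1)]
      by (simp add: unit_sphere_def)
    also have "\<dots> = t * L2_set (\<lambda>i. h x i - p x i) {..?n}"
      using that by (subst L2_set_right_distrib) (auto simp: algebra_simps)
    also have "\<dots> \<le> 1 * (1 / 2)" using hpd[OF that(1)] that by (intro mult_mono) auto
    finally show ?thesis by simp
  qed
  have pbelow: "L2_set (p x) {..?n} \<ge> 1 / 2" if "x \<in> ?S" for x
    using hp[OF that, of 1] by simp
  have sub: "x \<in> ?S" "x ?n = 0" if "x \<in> unit_sphere m" for x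
    using that by (auto intro: unit_sphere_mono) (simp add: unit_sphere_def)
  \<comment> \<open>The equator has too small a dimension for the cone over its Lipschitz image to
    fill the target. The constant 2 bounds the coordinates of \<open>p\<close>: those of
    \<open>h\<close> are at most 1 and the error is at most
    \<open>\<epsilon> \<le> 1\<close>.\<close>
  obtain e where e: "e ?n = 1" "\<And>i. i > ?n \<Longrightarrow> e i = 0"
    "\<And>x r. x \<in> unit_sphere m \<Longrightarrow> \<exists>i\<le>?n. e i \<noteq> r * p x i"
  proof (rule missed_line[of L m p 2])
    show "\<bar>p x i - p y i\<bar> \<le> L * (\<Sum>k\<le>m. \<bar>x k - y k\<bar>)"
      if "x \<in> unit_sphere m" "y \<in> unit_sphere m" "i \<le> ?n" for x y i
      using pL[of x y i] that sub[of x] sub[of y] by (simp add: sum.atMost_Suc)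
    show "\<bar>p x i\<bar> \<le> 2" if "x \<in> unit_sphere m" "i \<le> ?n" for x i
    proof -
      have x: "x \<in> ?S" using that sub by auto
      have "\<epsilon> \<le> 1" by (simp add: \<epsilon>_def)
      then show ?thesis using ph[OF x that(2)] abs_le_1_unit_sphere[OF hS[OF x], of i] by linarith
    qed
  qed (use podd pbelow sub L in auto)
  \<comment> \<open>On the equator \<open>x ?n = 0\<close> the map \<open>q\<close> is the projection of \<open>p\<close> along \<open>e\<close>, which has no zero as
    \<open>p\<close> misses the line through \<open>e\<close>; off the equator only a proper fraction is subtracted.\<close>
  define q where "q x i = p x i - (1 - \<bar>x ?n\<bar>) * p x ?n * e i" for x i
  define h' where "h' x = normalized ?n (q x)" for x
  have p_nz: "\<exists>i\<le>?n. p x i \<noteq> 0" if "x \<in> ?S" for x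
    using pbelow[OF that] L2_set_0'[of "{..?n}" "p x"] by force
  \<comment> \<open>A zero on the segment means \<open>p x = ?c * p x ?n * e\<close>. The last
    coordinate, where \<open>e\<close> is 1, leaves \<open>p x ?n = 0\<close>, which makes
    \<open>p x\<close> vanish, or \<open>?c = 1\<close>, which puts \<open>x\<close> on the equator
    and \<open>p x\<close> on the line through \<open>e\<close>.\<close>
  have q_seg: "\<exists>i\<le>?n. (1 - t) * p x i + t * q x i \<noteq> 0" if x: "x \<in> ?S" and t: "0 \<le> t" "t \<le> 1" for x t
  proof (rule ccontr)
    let ?c = "t * (1 - \<bar>x ?n\<bar>)"
    assume "\<not> ?thesis"
    then have *: "p x i = ?c * p x ?n * e i" if "i \<le> ?n" for i
      using that by (auto simp: q_def algebra_simps)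
    from *[of ?n] e(1) have "p x ?n * (1 - ?c) = 0" by (simp add: algebra_simps)
    then have "p x ?n = 0 \<or> ?c = 1" by auto
    then show False
    proof
      assume "p x ?n = 0"
      then have "p x i = 0" if "i \<le> ?n" for i using *[OF that] by simp
      then show False using p_nz[OF x] by blast
    next
      assume c: "?c = 1"
      have "\<bar>x ?n\<bar> \<le> 1" using abs_le_1_unit_sphere[OF x] .
      then have "?c \<le> 1 - \<bar>x ?n\<bar>" using t mult_left_le_one_le[of "1 - \<bar>x ?n\<bar>" t] by auto
      then have x0: "x ?n = 0" using c by simp
      then have xm: "x \<in> unit_sphere m"
        using x topspace_nsphere_minus1[of x ?n] by (simp add: topspace_nsphere)
      have "p x ?n \<noteq> 0" 
      proof
        assume "p x ?n = 0"
        then have "p x i = 0" if "i \<le> ?n" for i using *[OF that] by simp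
        then show False using p_nz[OF x] by blast
      qed
      have "e i = inverse (p x ?n) * p x i" if "i \<le> ?n" for i
      proof -
        have "inverse (p x ?n) * p x i = inverse (p x ?n) * (?c * p x ?n * e i)"
          by (rule arg_cong[OF *[OF that]])
        also have "\<dots> = e i" unfolding c using \<open>p x ?n \<noteq> 0\<close> by simp
        finally show ?thesis by simp
      qed
      then show False using e(3)[OF xm, of "inverse (p x ?n)"] by auto
    qed
  qed
  have p0': "p x i = 0" "q x i = 0" if "i > ?n" for x i
    using that e(2) by (auto simp: p_def q_def)
  have h0: "h x i = 0" if "x \<in> ?S" "i > ?n" for x i
    using hS[OF that(1)] that(2) by (simp add: unit_sphere_def)
  have qc: "continuous_on ?S (\<lambda>x. q x i)" for i
    unfolding q_def
    by (intro continuous_intros pc continuous_on_subset[OF continuous_on_product_coordinates]) auto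
  have hom1: "homotopic_with (\<lambda>x. True) (nsphere ?n) (nsphere ?n)
      (\<lambda>x. normalized ?n (h x)) (\<lambda>x. normalized ?n (p x))"
  proof (rule homotopic_normalized)
    show "\<exists>i\<le>?n. (1 - t) * h x i + t * p x i \<noteq> 0" if "x \<in> ?S" "0 \<le> t" "t \<le> 1" for x t
      using hp[OF that] L2_set_0'[of "{..?n}" "\<lambda>i. (1 - t) * h x i + t * p x i"]
      by force
  qed (use hc pc p0' h0 in \<open>auto intro: continuous_on_coordinatewise_then_product\<close>)
  have hom2: "homotopic_with (\<lambda>x. True) (nsphere ?n) (nsphere ?n)
      (\<lambda>x. normalized ?n (p x)) h'"
    unfolding h'_def
    by (rule homotopic_normalized)
       (use pc qc p0' q_seg in \<open>auto intro: continuous_on_coordinatewise_then_product\<close>)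
  have deg: "Brouwer_degree2 ?n h = Brouwer_degree2 ?n h'"
  proof -
    have "Brouwer_degree2 ?n h = Brouwer_degree2 ?n (\<lambda>x. normalized ?n (h x))"
      by (rule Brouwer_degree2_eq) (simp add: topspace_nsphere normalized_unit_sphere hS)
    then show ?thesis using Brouwer_degree2_homotopic[OF hom1] Brouwer_degree2_homotopic[OF hom2] by simp
  qed
  have h'c: "continuous_map (nsphere ?n) (nsphere ?n) h'"
    using homotopic_with_imp_continuous_maps[OF hom2] by simp
  have h'odd: "h' (\<lambda>i. - x i) = (\<lambda>i. - h' x i)" for x
  proof -
    \<comment> \<open>The factor \<open>1 - \<bar>x ?n\<bar>\<close> is even in \<open>x\<close>, so
      \<open>q\<close> inherits oddness from \<open>p\<close>.\<close>
    have "q (\<lambda>i. - x i) = (\<lambda>i. - q x i)"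
      by (auto simp: q_def podd fun_eq_iff algebra_simps)
    then show ?thesis by (simp add: h'_def normalized_def L2_set_def)
  qed
  have h'eq: "h' x \<in> unit_sphere m" if x: "x \<in> unit_sphere m" for x
  proof -
    have "h' x \<in> ?S" using h'c sub(1)[OF x] by (auto simp: continuous_map_nsphere_iff)
    moreover have "q x ?n = 0" using sub(2)[OF x] e(1) by (simp add: q_def)
    then have "h' x ?n = 0" by (simp add: h'_def normalized_def)
    ultimately show ?thesis
      using topspace_nsphere_minus1[of "h' x" ?n] by (simp add: topspace_nsphere)
  qed
  have "even (Brouwer_degree2 ?n h' - Brouwer_degree2 (?n - Suc 0) h')"
    by (rule Borsuk_odd_mapping_degree_step[OF h'c])
       (use h'odd h'eq in \<open>auto simp: topspace_nsphere o_def\<close>)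
  moreover have "odd (Brouwer_degree2 m h')"
  proof (rule Suc.IH)
    have "continuous_on (unit_sphere m) h'"
      using h'c sub(1) by (auto simp: continuous_map_nsphere_iff intro: continuous_on_subset)
    then show "continuous_map (nsphere m) (nsphere m) h'"
      using h'eq by (auto simp: continuous_map_nsphere_iff)
  qed (rule h'odd)
  ultimately show ?case using deg by simp
qed

text \<open>Without such a point, the differences \<open>f x - f (-x)\<close>, padded by a zero
  coordinate \<open>n\<close>, never vanish and normalize to an odd self-map of the sphere. It
  misses a pole, so its degree would be 0 as well as odd.\<close>

theorem Borsuk_Ulam:
  fixes f :: "(nat \<Rightarrow> real) \<Rightarrow> nat \<Rightarrow> real"
  assumes f: "\<And>i. i < n \<Longrightarrow> continuous_on (unit_sphere n) (\<lambda>x. f x i)"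
  obtains x where "x \<in> unit_sphere n" "\<And>i. i < n \<Longrightarrow> f (\<lambda>i. - x i) i = f x i"
proof (rule ccontr)
  assume neg: "\<not> thesis"
  define g where "g x i = (if i < n then f x i - f (\<lambda>i. - x i) i else 0)" for x i
  note found = that
  have nz: "\<exists>i\<le>n. g x i \<noteq> 0" if "x \<in> unit_sphere n" for x
  proof (rule ccontr)
    assume "\<not> ?thesis"
    then have "g x i = 0" if "i < n" for i using that less_imp_le by blast
    then have "f (\<lambda>i. - x i) i = f x i" if "i < n" for i using that by (force simp: g_def)
    then show False using neg found[OF \<open>x \<in> unit_sphere n\<close>] by blast
  qed
  have cneg: "continuous_on (unit_sphere n) (\<lambda>x. f (\<lambda>i. - x i) i)" if "i < n" for i
    by (rule continuous_on_compose2[OF f[OF that]])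
       (auto intro!: continuous_on_coordinatewise_then_product continuous_intros continuous_on_subset[OF continuous_on_product_coordinates])
  have cg: "continuous_on (unit_sphere n) (\<lambda>x. g x i)" for i
    using f cneg by (cases "i < n") (auto simp: g_def intro!: continuous_intros)
  let ?h = "\<lambda>x. normalized n (g x)"
  \<comment> \<open>The homotopy of \<open>?h\<close> with itself serves to obtain its
    continuity.\<close>
  have "homotopic_with (\<lambda>x. True) (nsphere n) (nsphere n) ?h ?h"
    by (rule homotopic_normalized)
       (use cg nz in \<open>auto intro: continuous_on_coordinatewise_then_product simp: g_def simp flip: distrib_right\<close>)
  then have c: "continuous_map (nsphere n) (nsphere n) ?h"
    using homotopic_with_imp_continuous_maps by blast
  have "g (\<lambda>i. - x i) = (\<lambda>i. - g x i)" for x by (auto simp: g_def)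
  then have "odd (Brouwer_degree2 n ?h)"
    by (intro odd_map_odd_degree[OF c]) (simp add: normalized_def L2_set_def)
  moreover have "Brouwer_degree2 n ?h = 0"
  proof (rule Brouwer_degree2_nonsurjective[OF c])
    let ?e = "\<lambda>i. if i = n then 1 else 0 :: real"
    have "?e \<in> unit_sphere n"
      by (auto simp: unit_sphere_def L2_set_def if_distrib[of "\<lambda>x. x\<^sup>2"] cong: if_cong)
    moreover have "?e \<notin> ?h ` unit_sphere n"
    proof
      assume "?e \<in> ?h ` unit_sphere n"
      then obtain x where "?e = ?h x" by blast
      then have "?h x n = 1" by (auto dest!: fun_cong[of _ _ n])
      then show False by (simp add: normalized_def g_def)
    qed
    ultimately show "?h ` topspace (nsphere n) \<noteq> topspace (nsphere n)"
      unfolding topspace_nsphere by blast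
  qed
  ultimately show False by simp
qed

section \<open>Riesz representation and compact operators\<close>

lemma linear_on_0: "linear_on V T \<Longrightarrow> subspace V \<Longrightarrow> T 0 = 0"
  unfolding linear_on_def by (metis scaleR_zero_left subspace_0)

lemma linear_on_add: "linear_on V T \<Longrightarrow> x \<in> V \<Longrightarrow> y \<in> V \<Longrightarrow> T (x + y) = T x + T y"
  by (simp add: linear_on_def)

lemma linear_on_scaleR: "linear_on V T \<Longrightarrow> x \<in> V \<Longrightarrow> T (c *\<^sub>R x) = c *\<^sub>R T x"
  by (simp add: linear_on_def)

lemma linear_on_minus: "linear_on V T \<Longrightarrow> x \<in> V \<Longrightarrow> T (- x) = - T x"
  using linear_on_scaleR[of V T x "-1"] by simp

lemma linear_on_diff:
  "linear_on V T \<Longrightarrow> subspace V \<Longrightarrow> x \<in> V \<Longrightarrow> y \<in> V \<Longrightarrow> T (x - y) = T x - T y"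
  using linear_on_add[of V T x "- y"] linear_on_minus[of V T y] by (simp add: subspace_neg)

lemma linear_on_sum:
  assumes "linear_on V T" "subspace V" "\<And>i. i \<in> A \<Longrightarrow> x i \<in> V"
  shows "T (\<Sum>i\<in>A. c i *\<^sub>R x i) = (\<Sum>i\<in>A. c i *\<^sub>R T (x i))"
  using assms(3)
proof (induction A rule: infinite_finite_induct)
  case (insert a F)
  have "(\<Sum>i\<in>F. c i *\<^sub>R x i) \<in> V"
    using insert assms(2) by (intro subspace_sum subspace_scale) auto
  then show ?case
    using insert assms(1,2) by (simp add: linear_on_add linear_on_scaleR subspace_scale)
qed (simp_all add: linear_on_0[OF assms(1,2)])

lemma cont_linear_on_bounded:
  fixes T :: "'a::real_normed_vector \<Rightarrow> 'b::real_normed_vector"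
  assumes T: "cont_linear_on V T" and V: "subspace V"
  obtains K where "K \<ge> 0" "\<And>x. x \<in> V \<Longrightarrow> norm (T x) \<le> K * norm x"
proof -
  have lin: "linear_on V T" and cont: "continuous_on V T"
    using T by (auto simp: cont_linear_on_def)
  have "0 \<in> V" using V by (rule subspace_0)
  then obtain d where d: "d > 0" "\<And>x. x \<in> V \<Longrightarrow> dist x 0 < d \<Longrightarrow> dist (T x) (T 0) < 1"
    using cont unfolding continuous_on_iff by (metis zero_less_one)
  show thesis
  proof
    show "2 / d \<ge> 0" using d by simp
    show "norm (T x) \<le> 2 / d * norm x" if x: "x \<in> V" for x
    proof (cases "x = 0")
      case True
      then show ?thesis using linear_on_0[OF lin V] by simp
    next
      case False
      \<comment> \<open>Scaling to norm \<open>d / 2\<close> lands strictly inside the ball of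
        radius \<open>d\<close>.\<close>
      let ?c = "d / (2 * norm x)"
      have "norm (T (?c *\<^sub>R x)) < 1"
        using d(2)[of "?c *\<^sub>R x"] d(1) x False linear_on_0[OF lin V] by (simp add: V subspace_scale)
      then show ?thesis
        using x False d(1) by (simp add: linear_on_scaleR[OF lin] field_simps)
    qed
  qed
qed

text \<open>The representer minimizes \<open>\<parallel>v\<parallel>\<^sup>2 - 2 f v\<close>; minimizing sequences are Cauchy by the
  parallelogram law.\<close>

lemma Riesz_representation_on:
  fixes f :: "'a::real_inner \<Rightarrow> real"
  assumes V: "subspace V" "complete V" and f: "cont_linear_on V f"
  obtains x where "x \<in> V" "\<And>v. v \<in> V \<Longrightarrow> f v = inner v x"
proof -
  have lin: "linear_on V f" and cont: "continuous_on V f"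
    using f by (auto simp: cont_linear_on_def)
  obtain K where K: "K \<ge> 0" "\<And>x. x \<in> V \<Longrightarrow> \<bar>f x\<bar> \<le> K * norm x"
    using cont_linear_on_bounded[OF f V(1)] by auto
  define Q where "Q v = (norm v)\<^sup>2 - 2 * f v" for v
  have "Q v \<ge> - K\<^sup>2" if "v \<in> V" for v
  proof -
    have "0 \<le> (norm v - K)\<^sup>2" by simp
    moreover have "f v \<le> K * norm v" using K(2)[OF that] by linarith
    ultimately show ?thesis by (simp add: Q_def power2_eq_square algebra_simps)
  qed
  then have bdd: "bdd_below (Q ` V)" by (intro bdd_belowI2)
  define m where "m = Inf (Q ` V)"
  have ne: "Q ` V \<noteq> {}" using subspace_0[OF V(1)] by auto
  have m_le: "m \<le> Q v" if "v \<in> V" for v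
    unfolding m_def using bdd that by (intro cInf_lower) auto
  have "\<exists>v\<in>V. Q v < m + 1 / Suc n" for n
    using cInf_lessD[OF ne, of "m + 1 / Suc n"] unfolding m_def by auto
  then obtain s where s: "\<And>n. s n \<in> V" "\<And>n. Q (s n) < m + 1 / Suc n" by metis
  have par: "(norm (v - w))\<^sup>2 \<le> 2 * (Q v - m) + 2 * (Q w - m)" if "v \<in> V" "w \<in> V" for v w
  proof -
    let ?u = "(1/2) *\<^sub>R (v + w)"
    have u: "?u \<in> V" using V(1) that by (intro subspace_scale subspace_add)
    have fu: "f ?u = (f v + f w) / 2"
      using that V(1) by (simp add: linear_on_scaleR[OF lin] linear_on_add[OF lin] subspace_add)
    have "(norm (v - w))\<^sup>2 + 4 * (norm ?u)\<^sup>2 = 2 * (norm v)\<^sup>2 + 2 * (norm w)\<^sup>2"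
      unfolding power2_norm_eq_inner by (simp add: inner_simps inner_commute field_simps)
    then show ?thesis using m_le[OF u] fu by (simp add: Q_def field_simps)
  qed
  have "Cauchy s"
    unfolding Cauchy_def
  proof (intro allI impI)
    fix e :: real assume e: "e > 0"
    obtain M where M: "1 / Suc M < e\<^sup>2 / 4"
      using e reals_Archimedean[of "e\<^sup>2 / 4"] by (auto simp: inverse_eq_divide)
    have "dist (s i) (s j) < e" if "i \<ge> M" "j \<ge> M" for i j
    proof -
      have "4 * (Q (s k) - m) < e\<^sup>2" if "k \<ge> M" for k
      proof -
        have "1 / Suc k \<le> 1 / Suc M" using that by (intro divide_left_mono) auto
        then have "Q (s k) - m < e\<^sup>2 / 4" using s(2)[of k] M by linarith
        then show ?thesis by simp
      qed
      from this[OF that(1)] this[OF that(2)] have "(norm (s i - s j))\<^sup>2 < e\<^sup>2"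
        using par[OF s(1) s(1), of i j] by linarith
      then show ?thesis using e by (simp add: dist_norm power2_less_imp_less)
    qed
    then show "\<exists>M. \<forall>m\<ge>M. \<forall>n\<ge>M. dist (s m) (s n) < e" by blast
  qed
  then obtain x where x: "x \<in> V" "s \<longlonglongrightarrow> x"
    using V(2) s(1) unfolding complete_def by blast
  have "(\<lambda>n. f (s n)) \<longlonglongrightarrow> f x"
    using cont x s(1) unfolding continuous_on_sequentially by (auto simp: o_def)
  then have "(\<lambda>n. Q (s n)) \<longlonglongrightarrow> Q x"
    unfolding Q_def by (intro tendsto_intros x)
  moreover have "(\<lambda>n. Q (s n)) \<longlonglongrightarrow> m"
  proof (rule tendsto_sandwich[OF _ _ tendsto_const])
    show "\<forall>\<^sub>F n in sequentially. m \<le> Q (s n)"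
      using m_le s(1) by (intro always_eventually) auto
    show "\<forall>\<^sub>F n in sequentially. Q (s n) \<le> m + 1 / Suc n"
      using s(2) by (intro always_eventually allI less_imp_le)
    show "(\<lambda>n. m + 1 / Suc n) \<longlonglongrightarrow> m"
      using tendsto_add[OF tendsto_const LIMSEQ_inverse_real_of_nat, of m] by (simp add: inverse_eq_divide)
  qed
  ultimately have Qx: "Q x = m" by (rule LIMSEQ_unique)
  show thesis
  proof
    show "f v = inner v x" if v: "v \<in> V" for v
    proof (cases "v = 0")
      case True
      then show ?thesis using linear_on_0[OF lin V(1)] by simp
    next
      case False
      let ?b = "inner v x - f v"
      \<comment> \<open>The minimizer of the quadratic polynomial
        \<open>Q (x + t *\<^sub>R v)\<close> in \<open>t\<close>; as \<open>x\<close> is already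
        minimal, the gain must be zero.\<close>
      define t where "t = - ?b / (norm v)\<^sup>2"
      have "Q x \<le> Q (x + t *\<^sub>R v)"
        using m_le Qx V(1) v x(1) by (simp add: subspace_add subspace_scale)
      also have "\<dots> = Q x + t\<^sup>2 * (norm v)\<^sup>2 + 2 * t * ?b"
        using V(1) v x(1) unfolding Q_def power2_norm_eq_inner
        by (simp add: linear_on_scaleR[OF lin] linear_on_add[OF lin] subspace_scale inner_simps
            inner_commute power2_eq_square algebra_simps)
      also have "\<dots> = Q x - ?b\<^sup>2 / (norm v)\<^sup>2"
        using False unfolding t_def by (simp add: field_simps power2_eq_square)
      finally have "?b\<^sup>2 / (norm v)\<^sup>2 \<le> 0" by simp
      then show ?thesis using False by (simp add: divide_le_0_iff)
    qed
  qed (rule x(1))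
qed

lemma cont_linear_on_inner: "cont_linear_on V (\<lambda>v. inner v y)"
  by (auto simp: cont_linear_on_def linear_on_def inner_simps intro!: continuous_intros)

text \<open>The projection is the Riesz representer, within \<open>V\<close>, of the inner product
  with \<open>x\<close>.\<close>

lemma orthogonal_projection_exists:
  assumes "subspace V" "complete V"
  obtains p where "p \<in> V" "\<And>v. v \<in> V \<Longrightarrow> inner v p = inner v x"
  using Riesz_representation_on[OF assms cont_linear_on_inner[of V x]] by metis

lemma adjoint_on_eqI:
  assumes "subspace V" "x \<in> V" "\<And>v. v \<in> V \<Longrightarrow> inner (T v) y = inner v x"
  shows "adjoint_on V T y = x"
  unfolding adjoint_on_def
proof (rule the_equality)
  fix z assume z: "z \<in> V \<and> (\<forall>v\<in>V. inner (T v) y = inner v z)"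
  then have "inner (z - x) z = inner (z - x) x"
    using assms by (metis subspace_diff)
  then have "inner (z - x) (z - x) = 0" by (simp add: inner_diff_right)
  then show "z = x" by simp
qed (use assms in auto)

lemma cont_linear_on_inner_left:
  assumes "cont_linear_on V T"
  shows "cont_linear_on V (\<lambda>v. inner (T v) y)"
  using assms by (auto simp: cont_linear_on_def linear_on_def inner_simps intro!: continuous_intros)

lemma adjoint_on:
  assumes "subspace V" "complete V" "cont_linear_on V T"
  shows "adjoint_on V T y \<in> V" "v \<in> V \<Longrightarrow> inner (T v) y = inner v (adjoint_on V T y)"
proof -
  obtain x where x: "x \<in> V" "\<And>v. v \<in> V \<Longrightarrow> inner (T v) y = inner v x"
    using Riesz_representation_on[OF assms(1,2) cont_linear_on_inner_left[OF assms(3), of y]] by metis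
  with adjoint_on_eqI[OF assms(1) this]
  show "adjoint_on V T y \<in> V" "v \<in> V \<Longrightarrow> inner (T v) y = inner v (adjoint_on V T y)"
    by auto
qed

text \<open>\<open>adjoint\<close> is an indefinite description; the relative adjoint on
  \<open>UNIV\<close> supplies the witness that makes its defining identity hold.\<close>

lemma adjoint_Hilbert:
  fixes S :: "'a::{real_inner, complete_space} \<Rightarrow> 'b::real_inner"
  assumes "bounded_linear S"
  shows "inner x (adjoint S y) = inner (S x) y"
proof -
  have "cont_linear_on UNIV S"
    using assms by (auto simp: cont_linear_on_def linear_on_def bounded_linear_def linear_add linear_cmul
        intro!: linear_continuous_on)
  then have "\<forall>x y. inner (S x) y = inner x (adjoint_on UNIV S y)"
    using adjoint_on[of UNIV S] by (simp add: complete_UNIV)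
  then have "\<exists>f'. \<forall>x y. inner (S x) y = inner x (f' y)" by blast
  then have "\<forall>x y. inner (S x) y = inner x (adjoint S y)"
    unfolding adjoint_def by (rule someI_ex)
  then show ?thesis by metis
qed

section \<open>Compact operators and their eigenvectors\<close>

lemma compact_operator_bounded_linear:
  assumes "compact_operator S"
  shows "bounded_linear S"
proof -
  have lin: "linear S" and "bounded (S ` cball 0 1)"
    using assms unfolding compact_operator_def
    by (auto intro: bounded_subset[OF compact_imp_bounded closure_subset])
  then obtain K where "\<forall>x\<in>cball 0 1. norm (S x) \<le> K"
    unfolding bounded_iff by auto
  then have K: "norm (S x) \<le> K" if "norm x \<le> 1" for x using that by simp
  have "norm (S x) \<le> norm x * K" for x
  proof (cases "x = 0")
    case False
    have "S ((1 / norm x) *\<^sub>R x) = (1 / norm x) *\<^sub>R S x"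
      by (rule linear_cmul[OF lin])
    then have "norm (S x) / norm x \<le> K" using K[of "(1 / norm x) *\<^sub>R x"] False by simp
    then show ?thesis using False by (simp add: field_simps)
  qed (simp add: linear_0[OF lin])
  then show ?thesis using lin by (auto intro!: bounded_linear_intro simp: linear_add linear_cmul)
qed

lemma compact_operator_subseq:
  assumes S: "compact_operator S" and x: "\<And>n::nat. norm (x n) \<le> 1"
  obtains y r where "strict_mono r" "(\<lambda>n. S (x (r n))) \<longlonglongrightarrow> y"
proof -
  have "S (x n) \<in> closure (S ` cball 0 1)" for n
    using x[of n] closure_subset by fastforce
  then show thesis
    using S that unfolding compact_operator_def compact_def by (metis (no_types, lifting) comp_apply LIMSEQ_iff o_def)
qed

text \<open>Otherwise \<open>S\<close> would attain its positive norm on the orthogonal complement of the eigenvectors, at a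
  further eigenvector.\<close>

lemma eigenvectors_complete:
  fixes S :: "'a::{real_inner, complete_space} \<Rightarrow> 'b::real_inner"
  assumes S: "compact_operator S"
    and eig: "nontrivial_eigenpairs UNIV (adjoint S \<circ> S) M lam \<phi>"
    and z: "\<And>m. m \<in> M \<Longrightarrow> inner z (\<phi> m) = 0"
  shows "S z = 0"
proof (rule ccontr)
  assume Sz: "S z \<noteq> 0"
  interpret S: bounded_linear S using S by (rule compact_operator_bounded_linear)
  note adj = adjoint_Hilbert[OF S.bounded_linear_axioms]
  define W where "W x = adjoint S (S x)" for x
  have W: "inner x (W y) = inner (S x) (S y)" for x y by (simp add: W_def adj)
  define V where "V = {x. \<forall>m\<in>M. inner x (\<phi> m) = 0}"
  have Weig: "W (\<phi> m) = lam m *\<^sub>R \<phi> m" if "m \<in> M" for m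
    using eig that by (simp add: nontrivial_eigenpairs_def W_def)
  \<comment> \<open>The complement of the eigenvectors is invariant under the symmetric operator
    \<open>W\<close>, so the norm of \<open>S\<close> can be maximized inside
    \<open>V\<close>.\<close>
  have VW: "W x \<in> V" if "x \<in> V" for x
  proof -
    have "inner (W x) (\<phi> m) = 0" if "m \<in> M" for m
    proof -
      have "inner (W x) (\<phi> m) = inner x (W (\<phi> m))" by (metis W inner_commute)
      then show ?thesis using Weig[OF that] \<open>x \<in> V\<close> that by (simp add: V_def)
    qed
    then show ?thesis by (simp add: V_def)
  qed
  let ?B = "{x \<in> V. norm x \<le> 1}"
  define s where "s = (SUP x\<in>?B. norm (S x))"
  obtain K where "\<And>x. norm (S x) \<le> norm x * K" using S.bounded by blast
  then have K: "norm (S x) \<le> norm x * \<bar>K\<bar>" for x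
    by (meson abs_ge_self mult_left_mono norm_ge_zero order_trans)
  have "norm (S x) \<le> \<bar>K\<bar>" if "x \<in> ?B" for x
    using order_trans[OF K mult_right_mono[of "norm x" 1 "\<bar>K\<bar>"]] that by simp
  then have bdd: "bdd_above ((\<lambda>x. norm (S x)) ` ?B)" by (auto intro!: bdd_aboveI[of _ "\<bar>K\<bar>"])
  have le_s: "norm (S x) \<le> s" if "x \<in> ?B" for x
    unfolding s_def using bdd that by (rule cSUP_upper2[OF _ _ order_refl])
  have Vscale: "c *\<^sub>R x \<in> V" if "x \<in> V" for c x using that by (simp add: V_def)
  have le_s': "norm (S x) \<le> s * norm x" if "x \<in> V" for x
  proof (cases "x = 0")
    case False
    have "norm (S ((1 / norm x) *\<^sub>R x)) \<le> s" using False that by (intro le_s) (simp add: Vscale)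
    then show ?thesis using False by (simp add: S.scaleR field_simps)
  qed (simp add: S.zero)
  have zV: "z \<in> V" using z by (simp add: V_def)
  have s: "s > 0"
  proof (rule ccontr)
    assume "\<not> s > 0"
    then have "s * norm z \<le> 0" by (simp add: mult_nonpos_nonneg)
    then have "norm (S z) \<le> 0" using le_s'[OF zV] by linarith
    then show False using Sz by simp
  qed
  have "\<exists>x\<in>?B. s - 1 / Suc n < norm (S x)" for n
  proof (rule ccontr)
    assume "\<not> ?thesis"
    then have "\<And>x. x \<in> ?B \<Longrightarrow> norm (S x) \<le> s - 1 / Suc n" by force
    moreover have "?B \<noteq> {}" by (auto simp: V_def intro!: exI[of _ 0])
    ultimately have "s \<le> s - 1 / Suc n" unfolding s_def by (intro cSUP_least)
    then show False by simp
  qed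
  then obtain x where x: "\<And>n. x n \<in> ?B" "\<And>n. s - 1 / Suc n < norm (S (x n))" by metis
  have lim_s: "(\<lambda>n. norm (S (x n))) \<longlonglongrightarrow> s"
  proof (rule tendsto_sandwich[OF _ _ _ tendsto_const])
    show "\<forall>\<^sub>F n in sequentially. norm (S (x n)) \<le> s"
      using le_s[OF x(1)] by (intro always_eventually) auto
    show "\<forall>\<^sub>F n in sequentially. s - 1 / Suc n \<le> norm (S (x n))"
      using x(2) by (intro always_eventually allI less_imp_le)
    show "(\<lambda>n. s - 1 / Suc n) \<longlonglongrightarrow> s"
      using tendsto_diff[OF tendsto_const LIMSEQ_inverse_real_of_nat, of s] by (simp add: inverse_eq_divide)
  qed
  obtain y r where r: "strict_mono r" and y: "(\<lambda>n. S (x (r n))) \<longlonglongrightarrow> y"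
    using compact_operator_subseq[OF S, of x] x(1) by blast
  have normW: "norm (W v) \<le> s * norm (S v)" if "v \<in> V" for v
  proof (cases "W v = 0")
    case False
    have "(norm (W v))\<^sup>2 = inner (S (W v)) (S v)" by (simp add: power2_norm_eq_inner W)
    also have "\<dots> \<le> norm (S (W v)) * norm (S v)" by (rule norm_cauchy_schwarz)
    also have "\<dots> \<le> s * norm (W v) * norm (S v)"
      by (intro mult_right_mono le_s' VW that) simp
    finally show ?thesis using False by (simp add: power2_eq_square)
  qed (use s in simp)
  \<comment> \<open>Along a maximizing sequence the right-hand side tends to 0, so the
    \<open>x n\<close> are approximate eigenvectors for \<open>s\<^sup>2\<close>.\<close>
  have le0: "(norm (W (x n) - s\<^sup>2 *\<^sub>R x n))\<^sup>2 \<le> s\<^sup>2 * (s\<^sup>2 - (norm (S (x n)))\<^sup>2)" for n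
  proof -
    have "(norm (W (x n)))\<^sup>2 \<le> (s * norm (S (x n)))\<^sup>2"
      using x(1) by (intro power_mono normW) auto
    moreover have "s\<^sup>2 * (s\<^sup>2 * (norm (x n))\<^sup>2) \<le> s\<^sup>2 * (s\<^sup>2 * 1)"
      using x(1)[of n] by (intro mult_left_mono) (auto simp: power_le_one)
    moreover have "(norm (W (x n) - s\<^sup>2 *\<^sub>R x n))\<^sup>2
        = (norm (W (x n)))\<^sup>2 - 2 * s\<^sup>2 * (norm (S (x n)))\<^sup>2 + s\<^sup>2 * (s\<^sup>2 * (norm (x n))\<^sup>2)"
    proof -
      have "(norm (a - c *\<^sub>R b))\<^sup>2 = (norm a)\<^sup>2 - 2 * c * inner b a + c * (c * (norm b)\<^sup>2)" for a b :: 'a and c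
        unfolding power2_norm_eq_inner by (simp add: inner_simps inner_commute algebra_simps)
      from this[of "W (x n)" "s\<^sup>2" "x n"] show ?thesis by (simp only: W power2_norm_eq_inner)
    qed
    ultimately show ?thesis by (simp add: algebra_simps power_mult_distrib)
  qed
  have "(\<lambda>n. s\<^sup>2 * (s\<^sup>2 - (norm (S (x n)))\<^sup>2)) \<longlonglongrightarrow> s\<^sup>2 * (s\<^sup>2 - s\<^sup>2)"
    by (intro tendsto_intros lim_s)
  then have lim0: "(\<lambda>n. s\<^sup>2 * (s\<^sup>2 - (norm (S (x n)))\<^sup>2)) \<longlonglongrightarrow> 0" by simp
  have "(\<lambda>n. (norm (W (x n) - s\<^sup>2 *\<^sub>R x n))\<^sup>2) \<longlonglongrightarrow> 0"
    by (rule tendsto_sandwich[OF _ _ tendsto_const lim0])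
       (rule always_eventually, rule allI, rule zero_le_power2 le0)+
  then have "(\<lambda>n. sqrt ((norm (W (x n) - s\<^sup>2 *\<^sub>R x n))\<^sup>2)) \<longlonglongrightarrow> sqrt 0"
    by (rule tendsto_real_sqrt)
  then have "(\<lambda>n. W (x n) - s\<^sup>2 *\<^sub>R x n) \<longlonglongrightarrow> 0"
    by (simp add: tendsto_norm_zero_iff)
  then have d: "(\<lambda>n. W (x (r n)) - s\<^sup>2 *\<^sub>R x (r n)) \<longlonglongrightarrow> 0"
    using r by (auto dest: LIMSEQ_subseq_LIMSEQ simp: o_def)
  have Wlim: "(\<lambda>n. W (x (r n))) \<longlonglongrightarrow> adjoint S y"
  proof -
    have "norm (adjoint S v) \<le> norm v * \<bar>K\<bar>" for v
    proof (cases "adjoint S v = 0")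
      case False
      have "(norm (adjoint S v))\<^sup>2 = inner (S (adjoint S v)) v"
        by (simp add: power2_norm_eq_inner adj)
      also have "\<dots> \<le> norm (S (adjoint S v)) * norm v" by (rule norm_cauchy_schwarz)
      also have "norm (S (adjoint S v)) \<le> norm (adjoint S v) * \<bar>K\<bar>"
        by (rule K)
      finally show ?thesis using False by (simp add: power2_eq_square mult_right_mono algebra_simps)
    qed simp
    moreover have "adjoint S (a + b) = adjoint S a + adjoint S b" for a b
      by (rule vector_eq_ldot[THEN iffD1]) (simp add: adj inner_add_right)
    moreover have "adjoint S (c *\<^sub>R a) = c *\<^sub>R adjoint S a" for c a
      by (rule vector_eq_ldot[THEN iffD1]) (simp add: adj)
    ultimately have "bounded_linear (adjoint S)" by (intro bounded_linear_intro)
    from bounded_linear.tendsto[OF this y] show ?thesis by (simp add: W_def)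
  qed
  \<comment> \<open>Compactness gives convergence of the images \<open>S (x (r n))\<close>; as
    \<open>W x - s\<^sup>2 *\<^sub>R x\<close> tends to 0 along the sequence, the
    \<open>x (r n)\<close> themselves converge to this vector.\<close>
  define w where "w = (1 / s\<^sup>2) *\<^sub>R adjoint S y"
  have "(\<lambda>n. (1 / s\<^sup>2) *\<^sub>R (W (x (r n)) - (W (x (r n)) - s\<^sup>2 *\<^sub>R x (r n)))) \<longlonglongrightarrow> (1 / s\<^sup>2) *\<^sub>R (adjoint S y - 0)"
    by (intro tendsto_intros Wlim d)
  then have xw: "(\<lambda>n. x (r n)) \<longlonglongrightarrow> w" using s by (simp add: w_def)
  then have Sw: "(\<lambda>n. S (x (r n))) \<longlonglongrightarrow> S w" by (rule S.tendsto)
  then have "S w = y" using y LIMSEQ_unique by blast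
  then have Ww: "W w = s\<^sup>2 *\<^sub>R w" using s by (simp add: W_def w_def)
  have "(\<lambda>n. norm (S (x (r n)))) \<longlonglongrightarrow> s"
    using LIMSEQ_subseq_LIMSEQ[OF lim_s r] by (simp add: o_def)
  then have "norm (S w) = s" using tendsto_norm[OF Sw] LIMSEQ_unique by blast
  then have w0: "w \<noteq> 0" using s by (auto simp: S.zero)
  have wV: "inner w (\<phi> m) = 0" if "m \<in> M" for m
  proof -
    have "(\<lambda>n. inner (x (r n)) (\<phi> m)) \<longlonglongrightarrow> inner w (\<phi> m)" by (intro tendsto_intros xw)
    moreover have "inner (x (r n)) (\<phi> m) = 0" for n using x(1)[of "r n"] that by (simp add: V_def)
    ultimately show ?thesis by (simp add: LIMSEQ_const_iff)
  qed
  \<comment> \<open>Exhaustion of the eigenspaces puts \<open>w\<close> into the span of vectors to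
    which it is orthogonal.\<close>
  have "w \<in> {x \<in> UNIV. (adjoint S \<circ> S) x = s\<^sup>2 *\<^sub>R x}" using Ww by (simp add: W_def)
  moreover have "\<forall>\<mu>>0. {x \<in> UNIV. (adjoint S \<circ> S) x = \<mu> *\<^sub>R x} = span (\<phi> ` {j \<in> M. lam j = \<mu>})"
    using eig unfolding nontrivial_eigenpairs_def by blast
  ultimately have "w \<in> span (\<phi> ` {j \<in> M. lam j = s\<^sup>2})"
    using s by (simp only: zero_less_power)
  moreover have "span (\<phi> ` {j \<in> M. lam j = s\<^sup>2}) \<subseteq> {v. inner w v = 0}"
  proof (rule span_minimal)
    show "subspace {v. inner w v = 0}" by (auto simp: subspace_def inner_simps)
  qed (use wV in auto)
  ultimately have "inner w w = 0" by auto
  then show False using w0 by simp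
qed

text \<open>Infinitely many such eigenvectors would have orthogonal images of squared norm at least
  \<open>e\<close>; distinct images are at distance at least \<open>sqrt (2 * e)\<close>, so no
  subsequence converges.\<close>

lemma eigenvalues_finite_above:
  fixes S :: "'a::{real_inner, complete_space} \<Rightarrow> 'b::real_inner"
  assumes S: "compact_operator S"
    and eig: "nontrivial_eigenpairs UNIV (adjoint S \<circ> S) M lam \<phi>" and "e > 0"
  shows "finite {m \<in> M. lam m \<ge> e}"
proof (rule ccontr)
  let ?A = "{m \<in> M. lam m \<ge> e}"
  assume "infinite ?A"
  then obtain g :: "nat \<Rightarrow> _" where g: "inj g" "range g \<subseteq> ?A" using infinite_countable_subset by blast
  note adj = adjoint_Hilbert[OF compact_operator_bounded_linear[OF S]]
  have ip: "inner (S (\<phi> i)) (S (\<phi> j)) = (if i = j then lam j else 0)" if "i \<in> M" "j \<in> M" for i j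
  proof -
    have "inner (S (\<phi> i)) (S (\<phi> j)) = inner (\<phi> i) (adjoint S (S (\<phi> j)))" by (simp add: adj)
    also have "\<dots> = lam j * inner (\<phi> i) (\<phi> j)" using eig that by (simp add: nontrivial_eigenpairs_def)
    also have "inner (\<phi> i) (\<phi> j) = (if i = j then 1 else 0)"
      using eig that by (simp add: nontrivial_eigenpairs_def)
    finally show ?thesis by simp
  qed
  have "norm (\<phi> m) = 1" if "m \<in> M" for m
    using eig that by (simp add: nontrivial_eigenpairs_def norm_eq_1)
  then have "norm (\<phi> (g n)) \<le> 1" for n using g(2) by (simp add: image_subset_iff)
  then obtain y r where r: "strict_mono r" and "(\<lambda>n. S (\<phi> (g (r n)))) \<longlonglongrightarrow> y"
    using compact_operator_subseq[OF S, of "\<lambda>n. \<phi> (g n)"] by blast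
  then have "Cauchy (\<lambda>n. S (\<phi> (g (r n))))" using LIMSEQ_imp_Cauchy by blast
  then obtain n where n: "\<And>i j. i \<ge> n \<Longrightarrow> j \<ge> n \<Longrightarrow> dist (S (\<phi> (g (r i)))) (S (\<phi> (g (r j)))) < sqrt e"
    unfolding Cauchy_def using \<open>e > 0\<close> by (metis real_sqrt_gt_zero)
  let ?i = "g (r n)" and ?j = "g (r (Suc n))"
  have ij: "?i \<noteq> ?j" using r g(1) by (metis injD lessI nat_neq_iff strict_monoD)
  have M: "?i \<in> M" "?j \<in> M" "lam ?i \<ge> e" "lam ?j \<ge> e" using g(2) by auto
  have "(norm (S (\<phi> ?i) - S (\<phi> ?j)))\<^sup>2 = lam ?i + lam ?j"
    unfolding power2_norm_eq_inner using ij M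
    by (simp add: inner_diff_left inner_diff_right ip)
  moreover have "(norm (S (\<phi> ?i) - S (\<phi> ?j)))\<^sup>2 < (sqrt e)\<^sup>2"
    using n[of n "Suc n"] by (intro power_strict_mono) (auto simp: dist_norm)
  ultimately show False using M \<open>e > 0\<close> by simp
qed

section \<open>Optimal algorithms from a singular system\<close>

lemma subspace_closure:
  fixes S :: "'a::real_normed_vector set"
  assumes S: "subspace S"
  shows "subspace (closure S)"
proof (rule subspaceI)
  show "0 \<in> closure S" using subspace_0[OF S] closure_subset by blast
  fix x y and c :: real
  assume "x \<in> closure S"
  then obtain s where s: "\<And>n. s n \<in> S" "s \<longlonglongrightarrow> x" unfolding closure_sequential by blast
  have "(\<lambda>n. c *\<^sub>R s n) \<longlonglongrightarrow> c *\<^sub>R x" by (intro tendsto_intros s)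
  then show "c *\<^sub>R x \<in> closure S"
    unfolding closure_sequential
    using subspace_scale[OF S s(1)] by (intro exI[of _ "\<lambda>n. c *\<^sub>R s n"] conjI allI)
  assume "y \<in> closure S"
  then obtain t where t: "\<And>n. t n \<in> S" "t \<longlonglongrightarrow> y" unfolding closure_sequential by blast
  have "(\<lambda>n. s n + t n) \<longlonglongrightarrow> x + y" by (intro tendsto_intros s t)
  then show "x + y \<in> closure S"
    unfolding closure_sequential
    using subspace_add[OF S s(1) t(1)] by (intro exI[of _ "\<lambda>n. s n + t n"] conjI allI)
qed

text \<open>Isolates what the error analysis uses, independently of tensor products.
  \<open>T_xi\<close> is the weak form of the eigenvector equation, which avoids the adjoint;
  \<open>T_0\<close> is the exhaustion property, allowing \<open>V\<close> to contain a kernel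
  outside the span of the \<open>xi i\<close>.\<close>

locale singular_system =
  fixes V :: "'a::real_inner set" and T :: "'a \<Rightarrow> 'b::real_inner"
    and c :: enat and lam :: "nat \<Rightarrow> real" and xi :: "nat \<Rightarrow> 'a"
  assumes subspace_V: "subspace V" and complete_V: "complete V" and T: "cont_linear_on V T"
    and xi_in: "\<And>i. i \<in> initial_segment c \<Longrightarrow> xi i \<in> V"
    and ortho: "\<And>i j. i \<in> initial_segment c \<Longrightarrow> j \<in> initial_segment c \<Longrightarrow>
      inner (xi i) (xi j) = (if i = j then 1 else 0)"
    and lam_pos: "\<And>i. i \<in> initial_segment c \<Longrightarrow> lam i > 0"
    and lam_anti: "antimono_on (initial_segment c) lam"
    and lam_fin: "\<And>e. e > 0 \<Longrightarrow> finite {i \<in> initial_segment c. lam i \<ge> e}"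
    and T_xi: "\<And>v i. v \<in> V \<Longrightarrow> i \<in> initial_segment c \<Longrightarrow>
      inner (T v) (T (xi i)) = lam i * inner v (xi i)"
    and T_0: "\<And>v. v \<in> V \<Longrightarrow> (\<And>i. i \<in> initial_segment c \<Longrightarrow> inner v (xi i) = 0) \<Longrightarrow> T v = 0"
begin

abbreviation "J \<equiv> initial_segment c"
abbreviation "W \<equiv> \<lambda>f. adjoint_on V T (T f)"

lemma lin: "linear_on V T" and cont: "continuous_on V T"
  using T by (auto simp: cont_linear_on_def)

lemma sum_xi_in:
  assumes "F \<subseteq> J"
  shows "(\<Sum>i\<in>F. a i *\<^sub>R xi i) \<in> V"
  using assms xi_in by (intro subspace_sum subspace_scale subspace_V) auto

lemma inner_sum_xi:
  assumes "finite F" "F \<subseteq> J" "j \<in> J"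
  shows "inner (\<Sum>i\<in>F. a i *\<^sub>R xi i) (xi j) = (if j \<in> F then a j else 0)"
proof -
  have "inner (\<Sum>i\<in>F. a i *\<^sub>R xi i) (xi j) = (\<Sum>i\<in>F. if i = j then a i else 0)"
    unfolding inner_sum_left using assms by (intro sum.cong) (auto simp: ortho subset_iff)
  then show ?thesis using assms(1) by simp
qed

lemma W_xi:
  assumes "i \<in> J"
  shows "W (xi i) = lam i *\<^sub>R xi i"
  using assms by (intro adjoint_on_eqI subspace_V subspace_scale xi_in) (simp_all add: T_xi)

lemma W_scaleR_sum:
  assumes "F \<subseteq> J"
  shows "W (\<Sum>i\<in>F. a i *\<^sub>R xi i) = (\<Sum>i\<in>F. (a i * lam i) *\<^sub>R xi i)"
proof (rule adjoint_on_eqI[OF subspace_V sum_xi_in[OF assms]])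
  fix v assume v: "v \<in> V"
  have "T (\<Sum>i\<in>F. a i *\<^sub>R xi i) = (\<Sum>i\<in>F. a i *\<^sub>R T (xi i))"
    using assms xi_in by (intro linear_on_sum[OF lin subspace_V]) auto
  then show "inner (T v) (T (\<Sum>i\<in>F. a i *\<^sub>R xi i)) = inner v (\<Sum>i\<in>F. (a i * lam i) *\<^sub>R xi i)"
    using assms v by (auto simp: inner_sum_right T_xi subset_iff intro!: sum.cong)
qed

text \<open>If \<open>x\<close> is an eigenvector for \<open>\<mu>\<close> and \<open>p\<close> its
  projection to the span of the matching \<open>xi i\<close>, then \<open>x - p\<close> is
  orthogonal to every \<open>xi i\<close>, the others because eigenvectors for different eigenvalues
  are orthogonal. So \<open>T (x - p) = 0\<close>, which for \<open>\<mu> > 0\<close> leaves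
  \<open>x = p\<close>.\<close>

lemma nontrivial_eigenpairs: "nontrivial_eigenpairs V W J lam xi"
  unfolding nontrivial_eigenpairs_def
proof (intro conjI ballI allI impI)
  fix \<mu> :: real assume \<mu>: "\<mu> > 0"
  let ?F = "{j \<in> J. lam j = \<mu>}"
  have fin: "finite ?F" by (rule finite_subset[OF _ lam_fin[OF \<mu>]]) auto
  show "{x \<in> V. W x = \<mu> *\<^sub>R x} = span (xi ` ?F)"
  proof (intro equalityI subsetI)
    fix x assume "x \<in> {x \<in> V. W x = \<mu> *\<^sub>R x}"
    then have x: "x \<in> V" "W x = \<mu> *\<^sub>R x" by auto
    have Wx: "inner (T v) (T x) = \<mu> * inner v x" if "v \<in> V" for v
      using adjoint_on(2)[OF subspace_V complete_V T that, of "T x"] x(2) by simp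
    define p where "p = (\<Sum>i\<in>?F. inner x (xi i) *\<^sub>R xi i)"
    have p: "p \<in> V" unfolding p_def by (rule sum_xi_in) auto
    have d: "x - p \<in> V" using subspace_V x(1) p by (rule subspace_diff)
    have Wp: "W p = \<mu> *\<^sub>R p"
      unfolding p_def by (subst W_scaleR_sum) (auto simp: scaleR_sum_right intro!: sum.cong)
    have "inner (x - p) (xi j) = 0" if j: "j \<in> J" for j
    proof (cases "lam j = \<mu>")
      case True
      then show ?thesis
        using j fin unfolding p_def by (simp add: inner_diff_left inner_sum_xi)
    next
      case False
      have "\<mu> * inner (xi j) x = lam j * inner x (xi j)"
        using Wx[OF xi_in[OF j]] T_xi[OF x(1) j] by (metis inner_commute)
      then have "inner x (xi j) = 0" using False by (auto simp: inner_commute)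
      then show ?thesis
        using j fin False unfolding p_def by (simp add: inner_diff_left inner_sum_xi)
    qed
    then have "T (x - p) = 0" using T_0[OF d] by blast
    then have "inner (T (x - p)) (T x) - inner (T (x - p)) (T p) = 0" by simp
    moreover have "inner (T (x - p)) (T p) = \<mu> * inner (x - p) p"
      using adjoint_on(2)[OF subspace_V complete_V T d, of "T p"] Wp by simp
    ultimately have "\<mu> * inner (x - p) (x - p) = 0"
      using Wx[OF d] by (simp add: inner_diff_right algebra_simps)
    then have "x = p" using \<mu> by simp
    then show "x \<in> span (xi ` ?F)"
      unfolding p_def by (metis (no_types, lifting) imageI span_base span_scale span_sum)
  next
    fix x assume "x \<in> span (xi ` ?F)"
    \<comment> \<open>The equation is tested against all \<open>v\<close> in \<open>V\<close>; in
      this form it is visibly linear in \<open>x\<close>.\<close>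
    moreover have "span (xi ` ?F) \<subseteq> {x \<in> V. \<forall>v\<in>V. inner (T v) (T x) = \<mu> * inner v x}"
    proof (rule span_minimal)
      show "xi ` ?F \<subseteq> {x \<in> V. \<forall>v\<in>V. inner (T v) (T x) = \<mu> * inner v x}"
        using xi_in T_xi by auto
      show "subspace {x \<in> V. \<forall>v\<in>V. inner (T v) (T x) = \<mu> * inner v x}"
        using subspace_V by (auto simp: subspace_def linear_on_add[OF lin] linear_on_scaleR[OF lin]
            linear_on_0[OF lin subspace_V] inner_add_right algebra_simps)
    qed
    ultimately have x: "x \<in> V" "\<And>v. v \<in> V \<Longrightarrow> inner (T v) (T x) = \<mu> * inner v x" by auto
    then have "W x = \<mu> *\<^sub>R x"
      by (intro adjoint_on_eqI subspace_V subspace_scale) simp_all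
    then show "x \<in> {x \<in> V. W x = \<mu> *\<^sub>R x}" using x by simp
  qed
qed (simp_all add: lam_pos xi_in W_xi ortho)

text \<open>The square of the optimal error with \<open>n\<close> pieces of information; it is 0
  once the eigenvectors are used up.\<close>

definition "next_lam n = (if n + 1 \<in> J then lam (n + 1) else 0)"

text \<open>The minimum is finite even for infinite \<open>c\<close>, so \<open>the_enat\<close> is
  applied to a proper number.\<close>

definition "rank_at n = the_enat (min (enat n) c)"

definition "approx n f = (\<Sum>i = 1..rank_at n. inner f (xi i) *\<^sub>R T (xi i))"

lemma mem_J: "i \<in> J \<longleftrightarrow> 1 \<le> i \<and> enat i \<le> c"
  unfolding initial_segment_def
  by (cases c) (auto simp: one_enat_def plus_enat_simps)

lemma segment_rank: "{1..rank_at n} = {i \<in> J. i \<le> n}"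
proof -
  have *: "enat i \<le> c \<and> i \<le> n \<longleftrightarrow> i \<le> the_enat (min (enat n) c)" for i
    by (cases c) auto
  show ?thesis
  proof (rule Set.set_eqI)
    show "i \<in> {1..rank_at n} \<longleftrightarrow> i \<in> {i \<in> J. i \<le> n}" for i
      unfolding rank_at_def mem_Collect_eq mem_J atLeastAtMost_iff using *[of i] by blast
  qed
qed

lemma rank_le: "rank_at n \<le> n"
  unfolding rank_at_def by (cases c) auto

lemma next_lam_nonneg: "next_lam n \<ge> 0"
  using lam_pos[of "n + 1"] by (auto simp: next_lam_def)

lemma lam_le_next:
  assumes "i \<in> J" "i > n"
  shows "lam i \<le> next_lam n"
proof -
  have "enat (n + 1) \<le> enat i" using assms by simp
  also have "enat i \<le> c" using assms(1) unfolding mem_J by blast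
  finally have "n + 1 \<in> J" unfolding mem_J by simp
  then show ?thesis using assms lam_anti by (auto simp: next_lam_def monotone_on_def)
qed

lemma norm_sum_xi:
  assumes "finite F" "F \<subseteq> J"
  shows "(norm (\<Sum>i\<in>F. a i *\<^sub>R xi i))\<^sup>2 = (\<Sum>i\<in>F. (a i)\<^sup>2)"
proof -
  have "inner (\<Sum>i\<in>F. a i *\<^sub>R xi i) (\<Sum>j\<in>F. a j *\<^sub>R xi j)
      = (\<Sum>j\<in>F. a j * inner (\<Sum>i\<in>F. a i *\<^sub>R xi i) (xi j))"
    by (subst inner_sum_right) simp
  also have "\<dots> = (\<Sum>j\<in>F. a j * a j)"
    using assms by (intro sum.cong) (auto simp: inner_sum_xi subset_iff)
  finally show ?thesis unfolding power2_norm_eq_inner by (simp add: power2_eq_square)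
qed

lemma norm_T_sum_xi:
  assumes "finite F" "F \<subseteq> J"
  shows "(norm (T (\<Sum>i\<in>F. a i *\<^sub>R xi i)))\<^sup>2 = (\<Sum>i\<in>F. lam i * (a i)\<^sup>2)"
proof -
  let ?x = "\<Sum>i\<in>F. a i *\<^sub>R xi i"
  have T: "T ?x = (\<Sum>i\<in>F. a i *\<^sub>R T (xi i))"
    using assms xi_in by (intro linear_on_sum[OF lin subspace_V]) auto
  have "inner (T ?x) (T ?x) = (\<Sum>j\<in>F. a j * inner (T ?x) (T (xi j)))"
    by (subst (2) T) (simp add: inner_sum_right)
  also have "\<dots> = (\<Sum>j\<in>F. lam j * (a j * a j))"
    using assms sum_xi_in[OF assms(2)]
    by (intro sum.cong) (auto simp: T_xi inner_sum_xi subset_iff)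
  finally show ?thesis unfolding power2_norm_eq_inner by (simp add: power2_eq_square)
qed

text \<open>The error is \<open>T\<close> applied to the part of \<open>x\<close> beyond the first
  \<open>n\<close> eigenvectors. The vectors \<open>T (xi i)\<close> are orthogonal with squared
  norms \<open>lam i\<close>, which there are at most \<open>next_lam n\<close>.\<close>

lemma approx_error_sum_xi:
  assumes F: "finite F" "F \<subseteq> J" and x: "x = (\<Sum>i\<in>F. a i *\<^sub>R xi i)"
  shows "(norm (T x - approx n x))\<^sup>2 \<le> next_lam n * (norm x)\<^sup>2"
proof -
  let ?E = "{1..rank_at n}"
  have E: "?E \<subseteq> J" unfolding segment_rank by blast
  have ip: "inner x (xi i) = (if i \<in> F then a i else 0)" if "i \<in> J" for i
    unfolding x by (rule inner_sum_xi[OF F that])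
  have "approx n x = (\<Sum>i\<in>?E. if i \<in> F then a i *\<^sub>R T (xi i) else 0)"
    unfolding approx_def using E by (intro sum.cong) (auto simp: ip subset_iff)
  also have "\<dots> = (\<Sum>i\<in>F \<inter> ?E. a i *\<^sub>R T (xi i))"
    by (simp add: sum.inter_restrict Int_commute flip: sum.inter_restrict)
  finally have "T x - approx n x = (\<Sum>i\<in>F - ?E. a i *\<^sub>R T (xi i))"
    unfolding x using F xi_in
    by (subst linear_on_sum[OF lin subspace_V])
       (auto simp: sum.Int_Diff[of F _ ?E])
  also have "\<dots> = T (\<Sum>i\<in>F - ?E. a i *\<^sub>R xi i)"
    using F xi_in by (subst linear_on_sum[OF lin subspace_V]) auto
  finally have "(norm (T x - approx n x))\<^sup>2 = (\<Sum>i\<in>F - ?E. lam i * (a i)\<^sup>2)"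
    using F by (simp add: norm_T_sum_xi Diff_subset[THEN subset_trans])
  also have "\<dots> \<le> (\<Sum>i\<in>F - ?E. next_lam n * (a i)\<^sup>2)"
  proof (intro sum_mono mult_right_mono lam_le_next)
    show "i \<in> J" "n < i" if "i \<in> F - ?E" for i using that F(2) unfolding segment_rank by auto
  qed simp
  also have "\<dots> \<le> (\<Sum>i\<in>F. next_lam n * (a i)\<^sup>2)"
    using F next_lam_nonneg by (intro sum_mono2) auto
  also have "\<dots> = next_lam n * (norm x)\<^sup>2"
    unfolding x by (simp add: norm_sum_xi[OF F] sum_distrib_left)
  finally show ?thesis .
qed

text \<open>Neither \<open>T\<close> nor \<open>approx n\<close> changes when \<open>f\<close> is
  replaced by its projection \<open>p\<close> to the closed span of the eigenvectors; for
  \<open>p\<close> the estimate follows from finite combinations by continuity.\<close>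

lemma approx_error:
  assumes f: "f \<in> V"
  shows "norm (T f - approx n f) \<le> sqrt (next_lam n) * norm f"
proof -
  define D where "D = closure (span (xi ` J))"
  have "closed V" by (rule complete_imp_closed[OF complete_V])
  moreover have "span (xi ` J) \<subseteq> V" using xi_in subspace_V by (intro span_minimal) auto
  ultimately have DV: "D \<subseteq> V" unfolding D_def by (simp add: closure_minimal)
  have D: "subspace D" "complete D"
    unfolding D_def using DV complete_V
    by (auto simp: D_def intro: subspace_closure complete_closed_subset)
  obtain p where p: "p \<in> D" "\<And>v. v \<in> D \<Longrightarrow> inner v p = inner v f"
    using orthogonal_projection_exists[OF D] by metis
  have pV: "p \<in> V" using p(1) DV by auto
  have xiD: "xi i \<in> D" if "i \<in> J" for i
    unfolding D_def using that by (meson closure_subset imageI in_mono span_base)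
  have ip: "inner f (xi i) = inner p (xi i)" if "i \<in> J" for i
    using p(2)[OF xiD[OF that]] by (simp add: inner_commute)
  have "T (f - p) = 0"
    using f pV subspace_V by (intro T_0) (auto simp: subspace_diff inner_diff_left ip)
  then have Tf: "T f = T p" using linear_on_diff[OF lin subspace_V f pV] by simp
  have "approx n f = approx n p"
    unfolding approx_def using ip segment_rank by (intro sum.cong) auto
  moreover have "(norm (T p - approx n p))\<^sup>2 \<le> next_lam n * (norm p)\<^sup>2"
  proof -
    obtain s where s: "\<And>k. s k \<in> span (xi ` J)" "s \<longlonglongrightarrow> p"
      using p(1) unfolding D_def closure_sequential by blast
    have "(norm (T (s k) - approx n (s k)))\<^sup>2 \<le> next_lam n * (norm (s k))\<^sup>2" for k
    proof -
      obtain t r where t: "finite t" "t \<subseteq> xi ` J" "s k = (\<Sum>a\<in>t. r a *\<^sub>R a)"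
        using s(1)[of k] unfolding span_explicit by blast
      obtain F where F: "F \<subseteq> J" "inj_on xi F" "t = xi ` F"
        using t(2) subset_image_inj by metis
      then have "s k = (\<Sum>i\<in>F. r (xi i) *\<^sub>R xi i)" using t(3) by (simp add: sum.reindex)
      moreover have "finite F" using F t(1) finite_imageD by blast
      ultimately show ?thesis using F(1) by (intro approx_error_sum_xi) 
    qed
    moreover have "(\<lambda>k. (norm (T (s k) - approx n (s k)))\<^sup>2) \<longlonglongrightarrow> (norm (T p - approx n p))\<^sup>2"
    proof -
      have "s k \<in> V" for k using s(1)[of k] \<open>span (xi ` J) \<subseteq> V\<close> by auto
      then have "(\<lambda>k. T (s k)) \<longlonglongrightarrow> T p"
        using cont s(2) pV unfolding continuous_on_sequentially by (auto simp: o_def)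
      then show ?thesis unfolding approx_def by (intro tendsto_intros s(2))
    qed
    moreover have "(\<lambda>k. next_lam n * (norm (s k))\<^sup>2) \<longlonglongrightarrow> next_lam n * (norm p)\<^sup>2"
      by (intro tendsto_intros s(2))
    ultimately show ?thesis by (intro LIMSEQ_le) auto
  qed
  ultimately have "(norm (T f - approx n f))\<^sup>2 \<le> next_lam n * (norm p)\<^sup>2" using Tf by simp
  then have "norm (T f - approx n f) \<le> sqrt (next_lam n * (norm p)\<^sup>2)"
    by (rule real_le_rsqrt)
  then have "norm (T f - approx n f) \<le> sqrt (next_lam n) * norm p"
    by (simp add: real_sqrt_mult)
  also have "norm p \<le> norm f"
  proof -
    have "norm p * norm p = inner p f" using p(2)[OF p(1)] by (simp flip: power2_norm_eq_inner power2_eq_square)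
    also have "\<dots> \<le> norm p * norm f" by (rule norm_cauchy_schwarz)
    finally show ?thesis by (cases "p = 0") auto
  qed
  then have "sqrt (next_lam n) * norm p \<le> sqrt (next_lam n) * norm f"
    using next_lam_nonneg by (intro mult_left_mono) auto
  finally show ?thesis .
qed

lemma worst_error_approx_le: "worst_error V T (approx n) \<le> ereal (sqrt (next_lam n))"
  unfolding worst_error_def
proof (rule SUP_least)
  fix f assume "f \<in> {f \<in> V. norm f \<le> 1}"
  then have "norm (T f - approx n f) \<le> sqrt (next_lam n) * 1"
    using next_lam_nonneg by (intro order_trans[OF approx_error] mult_left_mono) auto
  then show "ereal (norm (T f - approx n f)) \<le> ereal (sqrt (next_lam n))" by simp
qed

text \<open>An algorithm cannot distinguish \<open>f\<close> from \<open>- f\<close> if both yield the same information.\<close>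

lemma worst_error_ge_if_symmetric:
  assumes f: "f \<in> V" "norm f \<le> 1" and B: "B (- f) = B f"
  shows "worst_error V T B \<ge> ereal (norm (T f))"
proof -
  have m: "- f \<in> V" using f subspace_V by (simp add: subspace_neg)
  have "ereal (norm (T g - B g)) \<le> worst_error V T B" if "g \<in> V" "norm g \<le> 1" for g
    unfolding worst_error_def using that by (intro SUP_upper) auto
  from this[OF f] this[OF m]
  have le: "ereal (max (norm (T f - B f)) (norm (- T f - B f))) \<le> worst_error V T B"
    using f B by (simp add: linear_on_minus[OF lin] max_def)
  have "2 *\<^sub>R T f = (T f - B f) - (- T f - B f)" by (simp add: scaleR_2)
  then have "2 * norm (T f) \<le> norm (T f - B f) + norm (- T f - B f)"
    by (metis abs_numeral norm_scaleR norm_triangle_ineq4)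
  then have "norm (T f) \<le> max (norm (T f - B f)) (norm (- T f - B f))" by linarith
  then show ?thesis using le by (meson ereal_less_eq(3) order_trans)
qed

text \<open>If the functionals chosen after zero answers again answer zero, the adaptive process
  never leaves this branch.\<close>

lemma adaptive_info_zero:
  assumes "\<And>j. j < n \<Longrightarrow> L (Suc j) (replicate j 0) f = 0"
  shows "adaptive_info L n f = replicate n 0"
  using assms
  by (induction n) (auto simp: Let_def replicate_append_same)

text \<open>On the unit sphere spanned by the first \<open>n + 1\<close> eigenvectors
  \<open>T\<close> has squared norm at least \<open>next_lam n\<close>, and Borsuk-Ulam finds on it
  an antipodal pair that the information cannot separate.\<close>

lemma worst_error_ge:
  assumes B: "B \<in> algorithms n V G"
  shows "worst_error V T B \<ge> ereal (sqrt (next_lam n))"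
proof (cases "n + 1 \<in> J")
  \<comment> \<open>Here \<open>next_lam n = 0\<close>, and errors are nonnegative.\<close>
  case False
  have "ereal 0 \<le> ereal (norm (T 0 - B 0))" by simp
  also have "\<dots> \<le> worst_error V T B"
    unfolding worst_error_def using subspace_0[OF subspace_V] by (intro SUP_upper) auto
  finally show ?thesis using False by (simp add: next_lam_def)
next
  case True
  have J: "Suc i \<in> J" if "i \<le> n" for i
    using True that by (auto simp: mem_J intro: order_trans[of _ "enat (n + 1)"])
  \<comment> \<open>Sphere coordinates are numbered from 0 and eigenvectors from 1.\<close>
  define e where "e x = (\<Sum>i\<le>n. x i *\<^sub>R xi (Suc i))" for x :: "nat \<Rightarrow> real"
  have e_alt: "e x = (\<Sum>i\<in>{1..n+1}. x (i - 1) *\<^sub>R xi i)" for x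
    unfolding e_def by (rule sum.reindex_bij_witness[of _ "\<lambda>i. i - 1" Suc]) auto
  have seg: "{1..n+1} \<subseteq> J"
  proof
    fix i assume "i \<in> {1..n+1}"
    then show "i \<in> J" using J[of "i - 1"] by (cases i) auto
  qed
  have eV: "e x \<in> V" for x unfolding e_alt using seg by (rule sum_xi_in)
  have e_minus: "e (\<lambda>i. - x i) = - e x" for x by (simp add: e_def sum_negf)
  have sq: "(\<Sum>i\<in>{1..n+1}. (x (i - 1))\<^sup>2) = (L2_set x {..n})\<^sup>2" for x :: "nat \<Rightarrow> real"
  proof -
    have "(\<Sum>i\<in>{1..n+1}. (x (i - 1))\<^sup>2) = (\<Sum>i\<le>n. (x i)\<^sup>2)"
      by (rule sum.reindex_bij_witness[of _ Suc "\<lambda>i. i - 1"]) auto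
    then show ?thesis by (simp add: L2_set_def sum_nonneg)
  qed
  have e_norm: "norm (e x) = 1" if "x \<in> unit_sphere n" for x
  proof -
    have "(norm (e x))\<^sup>2 = 1"
      using norm_sum_xi[OF _ seg, of "\<lambda>i. x (i - 1)"] sq[of x] that
      by (simp add: e_alt unit_sphere_def)
    then show ?thesis using norm_ge_zero[of "e x"] unfolding power2_eq_1_iff by linarith
  qed
  have Te: "norm (T (e x)) \<ge> sqrt (next_lam n)" if "x \<in> unit_sphere n" for x
  proof -
    have "next_lam n = (\<Sum>i\<in>{1..n+1}. next_lam n * (x (i - 1))\<^sup>2)"
      using sq[of x] that by (simp add: unit_sphere_def flip: sum_distrib_left)
    also have "\<dots> \<le> (\<Sum>i\<in>{1..n+1}. lam i * (x (i - 1))\<^sup>2)"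
    proof (intro sum_mono mult_right_mono)
      fix i assume i: "i \<in> {1..n+1}"
      then show "next_lam n \<le> lam i"
        using True lam_anti seg by (auto simp: next_lam_def monotone_on_def)
    qed simp
    also have "\<dots> = (norm (T (e x)))\<^sup>2"
      using norm_T_sum_xi[OF _ seg, of "\<lambda>i. x (i - 1)"] by (simp add: e_alt)
    finally show ?thesis by (simp add: real_le_lsqrt)
  qed
  have e_cont: "continuous_on (unit_sphere n) e"
    unfolding e_def
    by (intro continuous_intros continuous_on_subset[OF continuous_on_product_coordinates]) auto
  obtain N \<phi> where N: "N \<in> continuous_information n V \<union> adaptive_information n V"
    and BN: "\<And>f. f \<in> V \<Longrightarrow> B f = \<phi> (N f)"
    using B unfolding algorithms_def by blast
  have "\<exists>x\<in>unit_sphere n. N (- e x) = N (e x)"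
    using N
  proof
    assume "N \<in> continuous_information n V"
    then obtain L where L: "\<And>j. j \<in> {1..n} \<Longrightarrow> continuous_on V (L j)"
      and NL: "N = (\<lambda>f. map (\<lambda>j. L j f) [1..<n+1])"
      unfolding continuous_information_def by blast
    obtain x where x: "x \<in> unit_sphere n"
      "\<And>i. i < n \<Longrightarrow> L (Suc i) (e (\<lambda>i. - x i)) = L (Suc i) (e x)"
    proof (rule Borsuk_Ulam[of n "\<lambda>x i. L (Suc i) (e x)"])
      show "continuous_on (unit_sphere n) (\<lambda>x. L (Suc i) (e x))" if "i < n" for i
        using that eV by (intro continuous_on_compose2[OF L e_cont]) auto
    qed blast
    have "L j (- e x) = L j (e x)" if "j \<in> {1..n}" for j
      using that x(2)[of "j - 1"] by (cases j) (auto simp: e_minus)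
    then have "N (- e x) = N (e x)" unfolding NL by auto
    then show ?thesis using x(1) by blast
  next
    assume "N \<in> adaptive_information n V"
    then obtain L where L: "\<And>j ys. j \<in> {1..n} \<Longrightarrow> length ys = j - 1 \<Longrightarrow> cont_linear_on V (L j ys)"
      and NL: "N = adaptive_info L n"
      unfolding adaptive_information_def by blast
    \<comment> \<open>The functionals used as long as all answers are 0. Equal values at
      \<open>e x\<close> and \<open>- e x\<close> vanish by linearity, so both inputs indeed follow
      this branch.\<close>
    let ?l = "\<lambda>i. L (Suc i) (replicate i 0)"
    have l: "cont_linear_on V (?l i)" if "i < n" for i using that by (intro L) auto
    obtain x where x: "x \<in> unit_sphere n" "\<And>i. i < n \<Longrightarrow> ?l i (e (\<lambda>i. - x i)) = ?l i (e x)"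
    proof (rule Borsuk_Ulam[of n "\<lambda>x i. ?l i (e x)"])
      show "continuous_on (unit_sphere n) (\<lambda>x. ?l i (e x))" if "i < n" for i
        using l[OF that] eV e_cont
        by (intro continuous_on_compose2[OF _ e_cont]) (auto simp: cont_linear_on_def)
    qed blast
    have minus: "?l i (- e x) = - ?l i (e x)" if "i < n" for i
      using l[OF that] eV linear_on_minus unfolding cont_linear_on_def by blast
    have zero: "?l i (e x) = 0" if "i < n" for i
      using x(2)[OF that] minus[OF that] by (simp add: e_minus)
    have "N (e x) = replicate n 0" "N (- e x) = replicate n 0"
      unfolding NL using zero minus by (auto intro!: adaptive_info_zero)
    then have "N (- e x) = N (e x)" by (simp only:)
    then show ?thesis using x(1) by blast
  qed
  then obtain x where x: "x \<in> unit_sphere n" "N (- e x) = N (e x)" by blast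
  have "B (- e x) = B (e x)" using BN x(2) eV subspace_V by (simp add: subspace_neg)
  then have "ereal (norm (T (e x))) \<le> worst_error V T B"
    using eV e_norm[OF x(1)] by (intro worst_error_ge_if_symmetric) auto
  then show ?thesis using Te[OF x(1)] by (meson ereal_less_eq(3) order_trans)
qed

lemma approx_in_algorithms:
  assumes G: "subspace G" "\<And>i. i \<in> J \<Longrightarrow> T (xi i) \<in> G"
  shows "approx n \<in> algorithms n V G"
proof -
  define \<phi> where "\<phi> y = (\<Sum>i = 1..rank_at n. y ! (i - 1) *\<^sub>R T (xi i))" for y :: "real list"
  \<comment> \<open>For \<open>n\<close> beyond \<open>c\<close> surplus inner products are recorded
    too; \<open>\<phi>\<close> reads only the first \<open>rank_at n\<close> entries.\<close>
  let ?L = "\<lambda>j f. inner f (xi j)"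
  let ?N = "\<lambda>f. map (\<lambda>j. ?L j f) [1..<n+1]"
  have "?N \<in> continuous_information n V"
    unfolding continuous_information_def
    by (intro CollectI exI[of _ ?L] conjI ballI refl continuous_intros)
  moreover have "\<phi> y \<in> G" for y
    unfolding \<phi>_def using G segment_rank by (intro subspace_sum subspace_scale) auto
  moreover have "approx n f = \<phi> (?N f)" for f
    unfolding approx_def \<phi>_def using rank_le[of n] by (intro sum.cong) (auto simp del: upt_Suc)
  ultimately show ?thesis
    unfolding algorithms_def by (intro CollectI bexI[of _ ?N] exI[of _ \<phi>] conjI allI impI ballI UnI1)
qed

lemma approx_in_linear_algorithms:
  assumes "\<And>i. i \<in> J \<Longrightarrow> T (xi i) \<in> G"
  shows "approx n \<in> linear_algorithms (rank_at n) V G"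
  unfolding linear_algorithms_def
  using assms segment_rank
  by (intro CollectI exI[of _ "\<lambda>j f. inner f (xi j)"] exI[of _ "\<lambda>j. T (xi j)"])
     (auto simp: approx_def cont_linear_on_inner)

lemma approx_optimal:
  assumes G: "subspace G" "\<And>i. i \<in> J \<Longrightarrow> T (xi i) \<in> G"
  shows "minimal_error n V G T = worst_error V T (approx n)"
    and "worst_error V T (approx n) = ereal (sqrt (next_lam n))"
    and "nth_optimal n V G T (approx n)"
proof -
  have in_alg: "approx n \<in> algorithms n V G" using G by (rule approx_in_algorithms)
  show eq: "worst_error V T (approx n) = ereal (sqrt (next_lam n))"
    by (rule antisym[OF worst_error_approx_le worst_error_ge[OF in_alg]])
  show min: "minimal_error n V G T = worst_error V T (approx n)"
    unfolding minimal_error_def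
    by (rule antisym[OF INF_lower[OF in_alg] INF_greatest]) (unfold eq, rule worst_error_ge)
  show "nth_optimal n V G T (approx n)"
    unfolding nth_optimal_def using in_alg min by auto
qed

end

section \<open>Operators on Hilbert space tensor powers\<close>

text \<open>A norm bound for all finite combinations is positivity of a difference of Gram kernels;
  in this form it can be multiplied factor by factor.\<close>

definition psd_on :: "'i set \<Rightarrow> ('i \<Rightarrow> 'i \<Rightarrow> real) \<Rightarrow> bool" where
  "psd_on A K \<longleftrightarrow> (\<forall>c. 0 \<le> (\<Sum>i\<in>A. \<Sum>j\<in>A. c i * c j * K i j))"

lemma psd_onD: "psd_on A K \<Longrightarrow> 0 \<le> (\<Sum>i\<in>A. \<Sum>j\<in>A. c i * c j * K i j)"
  by (simp add: psd_on_def)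

lemma psd_on_add: "psd_on A K \<Longrightarrow> psd_on A L \<Longrightarrow> psd_on A (\<lambda>i j. K i j + L i j)"
  unfolding psd_on_def by (simp add: distrib_left sum.distrib)

lemma norm_sum_squared:
  fixes x :: "'i \<Rightarrow> 'a::real_inner"
  shows "(norm (\<Sum>i\<in>A. c i *\<^sub>R x i))\<^sup>2 = (\<Sum>i\<in>A. \<Sum>j\<in>A. c i * c j * inner (x i) (x j))"
  unfolding power2_norm_eq_inner
  by (simp add: inner_sum_left inner_sum_right mult.assoc sum_distrib_left inner_commute mult.left_commute)

text \<open>Parseval for a family that is orthogonal but not normalized; a zero vector in
  \<open>C\<close> contributes \<open>0 / 0 = 0\<close>.\<close>

lemma inner_orthogonal_expansion:
  fixes C :: "'a::real_inner set"
  assumes "finite C" "pairwise orthogonal C" "y \<in> span C"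
  shows "inner x y = (\<Sum>b\<in>C. inner x b * inner y b / inner b b)"
proof -
  obtain r where y: "y = (\<Sum>b\<in>C. r b *\<^sub>R b)"
    using assms(1,3) span_finite by blast
  have yb: "inner y b = r b * inner b b" if "b \<in> C" for b
  proof -
    have "inner y b = (\<Sum>a\<in>C. if a = b then r b * inner b b else 0)"
      unfolding y inner_sum_left using assms(2) that
      by (intro sum.cong) (auto simp: pairwise_def orthogonal_def)
    then show ?thesis using assms(1) that by simp
  qed
  have "inner x y = (\<Sum>b\<in>C. r b * inner x b)" by (simp add: y inner_sum_right)
  also have "\<dots> = (\<Sum>b\<in>C. inner x b * inner y b / inner b b)"
    by (intro sum.cong refl) (auto simp: yb)
  finally show ?thesis .
qed

text \<open>A form of the Schur product theorem.\<close>

lemma psd_on_mult_gram: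
  fixes x :: "'i \<Rightarrow> 'a::real_inner"
  assumes "finite A" "psd_on A K"
  shows "psd_on A (\<lambda>i j. K i j * inner (x i) (x j))"
  unfolding psd_on_def
proof
  fix c :: "'i \<Rightarrow> real"
  obtain C where C: "finite C" "span C = span (x ` A)" "pairwise orthogonal C"
    using basis_orthogonal[of "x ` A"] assms(1) by auto
  have xC: "x i \<in> span C" if "i \<in> A" for i using that C(2) by (simp add: span_base)
  \<comment> \<open>Each basis vector \<open>b\<close> contributes the quadratic form of
    \<open>K\<close> with coefficients \<open>c i * inner (x i) b\<close>, divided by
    \<open>inner b b\<close>.\<close>
  have "(\<Sum>i\<in>A. \<Sum>j\<in>A. c i * c j * (K i j * inner (x i) (x j)))
      = (\<Sum>i\<in>A. \<Sum>j\<in>A. \<Sum>b\<in>C. (c i * inner (x i) b) * (c j * inner (x j) b) * K i j / inner b b)"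
  proof (intro sum.cong refl)
    fix i j assume "i \<in> A" "j \<in> A"
    then show "c i * c j * (K i j * inner (x i) (x j))
        = (\<Sum>b\<in>C. (c i * inner (x i) b) * (c j * inner (x j) b) * K i j / inner b b)"
      using inner_orthogonal_expansion[OF C(1,3) xC, of j "x i"]
      by (simp add: sum_distrib_left mult_ac)
  qed
  also have "\<dots> = (\<Sum>b\<in>C. \<Sum>i\<in>A. \<Sum>j\<in>A. (c i * inner (x i) b) * (c j * inner (x j) b) * K i j / inner b b)"
    unfolding sum.swap[of _ C A] by (rule refl)
  also have "\<dots> = (\<Sum>b\<in>C. (\<Sum>i\<in>A. \<Sum>j\<in>A. (c i * inner (x i) b) * (c j * inner (x j) b) * K i j) / inner b b)"
    by (simp add: sum_divide_distrib)
  also have "\<dots> \<ge> 0"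
    by (intro sum_nonneg divide_nonneg_nonneg psd_onD[OF assms(2)]) simp
  finally show "0 \<le> (\<Sum>i\<in>A. \<Sum>j\<in>A. c i * c j * (K i j * inner (x i) (x j)))" .
qed

lemma psd_on_mult_prod_gram:
  fixes x :: "'l \<Rightarrow> 'i \<Rightarrow> 'a::real_inner"
  assumes "finite A" "psd_on A K" "finite D"
  shows "psd_on A (\<lambda>i j. K i j * (\<Prod>l\<in>D. inner (x l i) (x l j)))"
  using assms(3)
proof (induction D)
  case (insert l D)
  have "psd_on A (\<lambda>i j. K i j * (\<Prod>l\<in>D. inner (x l i) (x l j)) * inner (x l i) (x l j))"
    by (rule psd_on_mult_gram[OF assms(1) insert.IH])
  then show ?case using insert.hyps by (simp add: mult_ac)
qed (simp add: assms(2))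

text \<open>Telescoping: with \<open>P\<close>, \<open>Q\<close> the products over \<open>D\<close>
  and \<open>a\<close>, \<open>b\<close> the new factors,
  \<open>P a - Q b = (P - Q) a + (a - b) Q\<close>. Both summands are Schur products with Gram
  kernels, and \<open>a - b\<close> is positive semidefinite by the norm bound for
  \<open>S\<close>.\<close>

lemma psd_on_prod_diff:
  fixes x :: "'l \<Rightarrow> 'i \<Rightarrow> 'a::real_inner" and S :: "'a \<Rightarrow> 'b::real_inner"
  assumes S: "bounded_linear S" and K: "\<And>y. norm (S y) \<le> K * norm y" and "K \<ge> 0"
    and A: "finite A" and D: "finite D"
  shows "psd_on A (\<lambda>i j. (\<Prod>l\<in>D. K\<^sup>2 * inner (x l i) (x l j)) - (\<Prod>l\<in>D. inner (S (x l i)) (S (x l j))))"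
  using D
proof (induction D)
  case empty
  then show ?case by (simp add: psd_on_def)
next
  case (insert l D)
  interpret S: bounded_linear S by (rule S)
  let ?P = "\<lambda>i j. \<Prod>l\<in>D. K\<^sup>2 * inner (x l i) (x l j)"
  let ?Q = "\<lambda>i j. \<Prod>l\<in>D. inner (S (x l i)) (S (x l j))"
  let ?a = "\<lambda>i j. inner (K *\<^sub>R x l i) (K *\<^sub>R x l j)"
  let ?b = "\<lambda>i j. inner (S (x l i)) (S (x l j))"
  have 1: "psd_on A (\<lambda>i j. (?P i j - ?Q i j) * ?a i j)"
    by (rule psd_on_mult_gram[OF A insert.IH])
  have "psd_on A (\<lambda>i j. ?a i j - ?b i j)"
    unfolding psd_on_def
  proof
    fix c :: "'i \<Rightarrow> real"
    let ?s = "\<Sum>i\<in>A. c i *\<^sub>R x l i"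
    have "(norm (S ?s))\<^sup>2 \<le> (K * norm ?s)\<^sup>2" by (intro power_mono K) simp
    also have "\<dots> = (norm (K *\<^sub>R ?s))\<^sup>2" using \<open>K \<ge> 0\<close> by simp
    also have "K *\<^sub>R ?s = (\<Sum>i\<in>A. c i *\<^sub>R (K *\<^sub>R x l i))"
      by (simp add: scaleR_sum_right mult.commute)
    also have "S ?s = (\<Sum>i\<in>A. c i *\<^sub>R S (x l i))" by (simp add: S.sum S.scaleR)
    finally show "0 \<le> (\<Sum>i\<in>A. \<Sum>j\<in>A. c i * c j * (?a i j - ?b i j))"
      unfolding norm_sum_squared right_diff_distrib sum_subtractf by linarith
  qed
  then have 2: "psd_on A (\<lambda>i j. (?a i j - ?b i j) * ?Q i j)"
    by (rule psd_on_mult_prod_gram[OF A _ insert.hyps(1)])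
  have "(\<Prod>l\<in>insert l D. K\<^sup>2 * inner (x l i) (x l j)) - (\<Prod>l\<in>insert l D. inner (S (x l i)) (S (x l j)))
      = (?P i j - ?Q i j) * ?a i j + (?a i j - ?b i j) * ?Q i j" for i j
    using insert.hyps by (simp add: power2_eq_square algebra_simps)
  then show ?case using psd_on_add[OF 1 2] by simp
qed

section \<open>Extension of maps from elementary tensors\<close>

locale tensor_power =
  fixes d :: nat and X :: "'k::real_inner set" and t :: "(nat \<Rightarrow> 'h::real_inner) \<Rightarrow> 'k"
  assumes tensor_power: "hilbert_tensor_power d X t"
begin

lemma t_linear: "i \<in> {1..d} \<Longrightarrow> linear (\<lambda>x. t (f(i := x)))"
  and t_inner: "inner (t f) (t g) = (\<Prod>i=1..d. inner (f i) (g i))"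
  and X_eq: "X = closure (span (range t))"
  and complete_X: "complete X"
  using tensor_power unfolding hilbert_tensor_power_def by blast+

lemma subspace_X: "subspace X"
  unfolding X_eq by (rule subspace_closure[OF subspace_span])

lemma t_in: "t f \<in> X"
  unfolding X_eq by (meson closure_subset in_mono rangeI span_base)

text \<open>The inner product formula gives \<open>t f - t g\<close> norm zero.\<close>

lemma t_cong:
  assumes "\<And>i. i \<in> {1..d} \<Longrightarrow> f i = g i"
  shows "t f = t g"
proof -
  have "inner (t f) (t g) = inner (t f) (t f)" "inner (t g) (t g) = inner (t f) (t f)"
    unfolding t_inner using assms by (auto intro!: prod.cong)
  then have "inner (t f - t g) (t f - t g) = 0"
    by (simp add: inner_diff_left inner_diff_right inner_commute)
  then show ?thesis by simp
qed

lemma cont_linear_on_eqI: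
  assumes A: "cont_linear_on X A" and B: "cont_linear_on X B"
    and eq: "\<And>f. A (t f) = B (t f)" and x: "x \<in> X"
  shows "A x = B x"
proof -
  have lA: "linear_on X A" and cA: "continuous_on X A" and lB: "linear_on X B" and cB: "continuous_on X B"
    using A B by (auto simp: cont_linear_on_def)
  have "span (range t) \<subseteq> {x \<in> X. A x = B x}"
  proof (rule span_minimal)
    show "range t \<subseteq> {x \<in> X. A x = B x}" using eq t_in by auto
    show "subspace {x \<in> X. A x = B x}"
      using subspace_X linear_on_0[OF lA subspace_X] linear_on_0[OF lB subspace_X]
      by (auto simp: subspace_def linear_on_add[OF lA] linear_on_add[OF lB]
          linear_on_scaleR[OF lA] linear_on_scaleR[OF lB])
  qed
  moreover obtain s where s: "\<And>n. s n \<in> span (range t)" "s \<longlonglongrightarrow> x"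
    using x unfolding X_eq closure_sequential by blast
  ultimately have sX: "\<And>n. s n \<in> X" and AB: "\<And>n. A (s n) = B (s n)" by auto
  have "(\<lambda>n. A (s n)) \<longlonglongrightarrow> A x" "(\<lambda>n. B (s n)) \<longlonglongrightarrow> B x"
    using cA cB s(2) sX x unfolding continuous_on_sequentially by (auto simp: o_def)
  then show ?thesis using AB LIMSEQ_unique by simp
qed

lemma orthogonal_t_eq_0:
  assumes "x \<in> X" "\<And>f. inner x (t f) = 0"
  shows "x = 0"
proof -
  have "inner x x = (0::real)"
  proof (rule cont_linear_on_eqI[where A = "\<lambda>v. inner v x" and B = "\<lambda>v. 0"])
    show "inner (t f) x = 0" for f using assms(2)[of f] by (simp add: inner_commute)
  qed (use assms(1) in \<open>auto simp: cont_linear_on_inner\<close>, auto simp: cont_linear_on_def linear_on_def)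
  then show ?thesis by simp
qed

end

text \<open>The extension is obtained from the closure of its graph.\<close>

lemma (in tensor_power) tensor_extension:
  fixes F :: "(nat \<Rightarrow> 'h) \<Rightarrow> 'l::real_inner"
  assumes Y: "subspace Y" "complete Y" and F: "\<And>f. F f \<in> Y" and K: "K \<ge> 0"
    and bound: "\<And>A c. finite A \<Longrightarrow> norm (\<Sum>f\<in>A. c f *\<^sub>R F f) \<le> K * norm (\<Sum>f\<in>A. c f *\<^sub>R t f)"
  defines "T \<equiv> tensor_extension X t F"
  shows "cont_linear_on X T" "\<And>f. T (t f) = F f" "\<And>x. x \<in> X \<Longrightarrow> T x \<in> Y"
proof -
  define g where "g f = (t f, F f)" for f
  define \<Gamma> where "\<Gamma> = closure (span (range g))"
  have sub: "subspace \<Gamma>" unfolding \<Gamma>_def by (rule subspace_closure[OF subspace_span])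
  \<comment> \<open>The bound on finite combinations holds on the span of the graph and survives
    closure; applied to a difference over the same \<open>x\<close> it shows that
    \<open>\<Gamma>\<close> is single-valued.\<close>
  have "span (range g) \<subseteq> {p. norm (snd p) \<le> K * norm (fst p)}"
  proof
    fix p assume "p \<in> span (range g)"
    then obtain B r where B: "finite B" "B \<subseteq> range g" and p: "p = (\<Sum>a\<in>B. r a *\<^sub>R a)"
      unfolding span_explicit by blast
    obtain A where A: "inj_on g A" "B = g ` A"
      using B(2) subset_image_inj[of B g UNIV] by blast
    have "finite A" using A B(1) finite_imageD by blast
    moreover have "p = (\<Sum>f\<in>A. r (g f) *\<^sub>R g f)" unfolding p A(2) by (simp add: sum.reindex A(1))
    then have "fst p = (\<Sum>f\<in>A. r (g f) *\<^sub>R t f)" "snd p = (\<Sum>f\<in>A. r (g f) *\<^sub>R F f)"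
      by (simp_all add: fst_sum snd_sum g_def)
    ultimately show "p \<in> {p. norm (snd p) \<le> K * norm (fst p)}" using bound by simp
  qed
  moreover have "closed {p :: 'k \<times> 'l. norm (snd p) \<le> K * norm (fst p)}"
    by (intro closed_Collect_le continuous_intros)
  ultimately have "\<Gamma> \<subseteq> {p. norm (snd p) \<le> K * norm (fst p)}"
    unfolding \<Gamma>_def by (rule closure_minimal)
  then have \<Gamma>_bound: "norm y \<le> K * norm x" if "(x, y) \<in> \<Gamma>" for x y using that by auto
  have \<Gamma>_unique: "y = y'" if "(x, y) \<in> \<Gamma>" "(x, y') \<in> \<Gamma>" for x y y'
    using \<Gamma>_bound[of 0 "y - y'"] subspace_diff[OF sub that] by simp
  have "span (range g) \<subseteq> UNIV \<times> Y"
  proof (rule span_minimal)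
    show "subspace (UNIV \<times> Y :: ('k \<times> 'l) set)" using Y(1) by (auto simp: subspace_def zero_prod_def)
  qed (auto simp: g_def F)
  moreover have "closed (UNIV \<times> Y :: ('k \<times> 'l) set)"
    using complete_imp_closed[OF Y(2)] by (intro closed_Times) auto
  ultimately have \<Gamma>Y: "\<Gamma> \<subseteq> UNIV \<times> Y" unfolding \<Gamma>_def by (rule closure_minimal)
  \<comment> \<open>Approximants of \<open>x\<close> lift to the graph; the bound makes their second
    components Cauchy, and \<open>Y\<close> is complete.\<close>
  have ex: "\<exists>y. (x, y) \<in> \<Gamma>" if x: "x \<in> X" for x
  proof -
    obtain s where s: "\<And>n. s n \<in> span (range t)" "s \<longlonglongrightarrow> x"
      using x unfolding X_eq closure_sequential by blast
    have "range t = fst ` range g" by (auto simp: g_def image_image)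
    then have "span (range t) = fst ` span (range g)"
      using linear_span_image[OF linear_fst, of "range g"] by simp
    then have "\<exists>y. (s n, y) \<in> span (range g)" for n using s(1)[of n] by force
    then obtain y where y: "\<And>n. (s n, y n) \<in> span (range g)" by metis
    have y\<Gamma>: "(s n, y n) \<in> \<Gamma>" for n unfolding \<Gamma>_def using y closure_subset by blast
    have yY: "y n \<in> Y" for n using y\<Gamma>[of n] \<Gamma>Y by auto
    have le: "dist (y m) (y n) \<le> K * dist (s m) (s n)" for m n
      using \<Gamma>_bound[of "s m - s n" "y m - y n"] subspace_diff[OF sub y\<Gamma>[of m] y\<Gamma>[of n]]
      by (simp add: dist_norm)
    have "Cauchy y"
      unfolding Cauchy_def
    proof (intro allI impI)
      fix e :: real assume "e > 0"
      \<comment> \<open>\<open>K + 1\<close> covers the case \<open>K = 0\<close>.\<close>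
      then have "e / (K + 1) > 0" using K by simp
      moreover have "Cauchy s" using s(2) by (rule LIMSEQ_imp_Cauchy)
      ultimately obtain M where M: "\<And>m n. m \<ge> M \<Longrightarrow> n \<ge> M \<Longrightarrow> dist (s m) (s n) < e / (K + 1)"
        unfolding Cauchy_def by blast
      have "dist (y m) (y n) < e" if "m \<ge> M" "n \<ge> M" for m n
      proof -
        have "dist (y m) (y n) \<le> K * dist (s m) (s n)" by (rule le)
        also have "\<dots> \<le> (K + 1) * dist (s m) (s n)" by (intro mult_right_mono) auto
        also have "\<dots> < (K + 1) * (e / (K + 1))" using M[OF that] K by (intro mult_strict_left_mono) auto
        finally show ?thesis using K by simp
      qed
      then show "\<exists>M. \<forall>m\<ge>M. \<forall>n\<ge>M. dist (y m) (y n) < e" by blast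
    qed
    then obtain z where "y \<longlonglongrightarrow> z" using Y(2) yY unfolding complete_def by blast
    then have "(\<lambda>n. (s n, y n)) \<longlonglongrightarrow> (x, z)" using s(2) by (intro tendsto_Pair)
    then show ?thesis
      unfolding \<Gamma>_def closure_sequential using y
      by (intro exI[of _ z] exI[of _ "\<lambda>n. (s n, y n)"] conjI allI)
  qed
  define T0 where "T0 = (\<lambda>x\<in>X. SOME y. (x, y) \<in> \<Gamma>)"
  have T0: "(x, T0 x) \<in> \<Gamma>" if "x \<in> X" for x
    unfolding T0_def using someI_ex[OF ex[OF that]] that by simp
  have lin: "linear_on X T0"
    unfolding linear_on_def
  proof (intro conjI allI ballI)
    show "T0 (x + y) = T0 x + T0 y" if "x \<in> X" "y \<in> X" for x y
      using T0[OF subspace_add[OF subspace_X that]] subspace_add[OF sub T0[OF that(1)] T0[OF that(2)]]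
      by (intro \<Gamma>_unique) auto
    show "T0 (c *\<^sub>R x) = c *\<^sub>R T0 x" if "x \<in> X" for c x
      using T0[OF subspace_scale[OF subspace_X that]] subspace_scale[OF sub T0[OF that]]
      by (intro \<Gamma>_unique) auto
  qed
  have "K-lipschitz_on X T0"
  proof (rule lipschitz_onI[OF _ K])
    show "dist (T0 x) (T0 y) \<le> K * dist x y" if "x \<in> X" "y \<in> X" for x y
      using \<Gamma>_bound[OF T0[OF subspace_diff[OF subspace_X that]]] linear_on_diff[OF lin subspace_X that]
      by (simp add: dist_norm)
  qed
  then have cl: "cont_linear_on X T0"
    using lin by (simp add: cont_linear_on_def lipschitz_on_continuous_on)
  have "(t f, F f) \<in> \<Gamma>" for f
    unfolding \<Gamma>_def using closure_subset span_base[of "g f" "range g"] by (auto simp: g_def)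
  then have T0t: "T0 (t f) = F f" for f by (rule \<Gamma>_unique[OF T0[OF t_in]])
  have "T = T0"
    unfolding T_def tensor_extension_def
  proof (rule the_equality)
    show "T0 \<in> extensional X \<and> cont_linear_on X T0 \<and> (\<forall>f. T0 (t f) = F f)"
      using cl T0t by (simp add: T0_def)
    fix T' assume "T' \<in> extensional X \<and> cont_linear_on X T' \<and> (\<forall>f. T' (t f) = F f)"
    then have T': "T' \<in> extensional X" "cont_linear_on X T'" "\<And>f. T' (t f) = F f" by blast+
    show "T' = T0"
    proof (rule extensionalityI[OF T'(1)])
      show "T0 \<in> extensional X" by (simp add: T0_def)
      show "T' x = T0 x" if "x \<in> X" for x
        by (rule cont_linear_on_eqI[OF T'(2) cl _ that]) (simp only: T'(3) T0t)
    qed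
  qed
  then show "cont_linear_on X T" "\<And>f. T (t f) = F f" "\<And>x. x \<in> X \<Longrightarrow> T x \<in> Y"
    using cl T0t T0 \<Gamma>Y by auto
qed

text \<open>With \<open>K\<close> bounding \<open>S\<close>, the kernel of
  \<open>psd_on_prod_diff\<close> evaluated at \<open>c\<close> is a difference of squared norms;
  this is the bound \<open>K ^ d\<close> required for extension.\<close>

lemma tensor_power_operator:
  fixes S :: "'h::real_inner \<Rightarrow> 'g::real_inner"
  assumes H: "hilbert_tensor_power d X t" and G: "hilbert_tensor_power d Y u"
    and S: "bounded_linear S"
  shows "cont_linear_on X (tensor_power_operator X t u S)"
    and "\<And>f. tensor_power_operator X t u S (t f) = u (\<lambda>i. S (f i))"
    and "\<And>x. x \<in> X \<Longrightarrow> tensor_power_operator X t u S x \<in> Y"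
proof -
  interpret H: tensor_power d X t using H by unfold_locales
  interpret G: tensor_power d Y u using G by unfold_locales
  obtain K where K: "K \<ge> 0" "\<And>y. norm (S y) \<le> K * norm y"
    using bounded_linear.nonneg_bounded[OF S] by (auto simp: mult.commute)
  have bound: "norm (\<Sum>f\<in>A. c f *\<^sub>R u (\<lambda>i. S (f i))) \<le> K ^ d * norm (\<Sum>f\<in>A. c f *\<^sub>R t f)"
    if A: "finite A" for A c
  proof -
    have KK: "(K\<^sup>2) ^ d = (K ^ d)\<^sup>2" by (simp add: mult.commute flip: power_mult)
    have "0 \<le> (\<Sum>f\<in>A. \<Sum>g\<in>A. c f * c g *
        ((\<Prod>l=1..d. K\<^sup>2 * inner (f l) (g l)) - (\<Prod>l=1..d. inner (S (f l)) (S (g l)))))"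
      using psd_onD[OF psd_on_prod_diff[OF S K(2,1) A, of "{1..d}" "\<lambda>l f. f l"]] by simp
    also have "\<dots> = (K\<^sup>2) ^ d * (norm (\<Sum>f\<in>A. c f *\<^sub>R t f))\<^sup>2 - (norm (\<Sum>f\<in>A. c f *\<^sub>R u (\<lambda>i. S (f i))))\<^sup>2"
      unfolding norm_sum_squared H.t_inner G.t_inner prod.distrib
      by (simp add: right_diff_distrib sum_subtractf sum_distrib_left mult_ac)
    finally have "(norm (\<Sum>f\<in>A. c f *\<^sub>R u (\<lambda>i. S (f i))))\<^sup>2 \<le> (K ^ d * norm (\<Sum>f\<in>A. c f *\<^sub>R t f))\<^sup>2"
      by (simp add: power_mult_distrib KK)
    then show ?thesis by (rule power2_le_imp_le) (use K(1) in simp)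
  qed
  have Kd: "K ^ d \<ge> 0" using K(1) by simp
  note ext = H.tensor_extension[where F = "\<lambda>f. u (\<lambda>i. S (f i))" and K = "K ^ d",
      OF G.subspace_X G.complete_X G.t_in Kd bound, folded tensor_power_operator_def]
  show "cont_linear_on X (tensor_power_operator X t u S)" by (rule ext(1))
  show "tensor_power_operator X t u S (t f) = u (\<lambda>i. S (f i))" for f by (rule ext(2))
  show "tensor_power_operator X t u S x \<in> Y" if "x \<in> X" for x
    by (rule ext(3)) (assumption | rule that)+
qed

section \<open>Symmetrizers and antisymmetrizers\<close>

lemma cont_linear_on_const_0: "cont_linear_on X (\<lambda>_. 0)"
  by (simp add: cont_linear_on_def linear_on_def)

lemma cont_linear_on_scaleR: "cont_linear_on X A \<Longrightarrow> cont_linear_on X (\<lambda>x. c *\<^sub>R A x)"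
  by (auto simp: cont_linear_on_def linear_on_def scaleR_add_right intro!: continuous_on_scaleR continuous_on_const)

lemma cont_linear_on_add:
  "cont_linear_on X A \<Longrightarrow> cont_linear_on X B \<Longrightarrow> cont_linear_on X (\<lambda>x. A x + B x)"
  by (auto simp: cont_linear_on_def linear_on_def scaleR_add_right intro!: continuous_on_add)

lemma cont_linear_on_sum:
  "(\<And>i. i \<in> A \<Longrightarrow> cont_linear_on X (T i)) \<Longrightarrow> cont_linear_on X (\<lambda>x. \<Sum>i\<in>A. T i x)"
  by (induction A rule: infinite_finite_induct)
     (auto simp: cont_linear_on_const_0 intro: cont_linear_on_add)

lemma cont_linear_on_compose:
  assumes "cont_linear_on X A" "cont_linear_on Y B" "\<And>x. x \<in> X \<Longrightarrow> A x \<in> Y"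
  shows "cont_linear_on X (\<lambda>x. B (A x))"
proof -
  have "continuous_on X (\<lambda>x. B (A x))"
    by (rule continuous_on_compose2[of Y B X A]) (use assms in \<open>auto simp: cont_linear_on_def\<close>)
  then show ?thesis using assms by (simp add: cont_linear_on_def linear_on_def)
qed

lemma cont_linear_on_inner_right: "cont_linear_on X A \<Longrightarrow> cont_linear_on X (\<lambda>x. inner y (A x))"
  using cont_linear_on_inner_left[of X A y] by (simp add: inner_commute)

lemma cont_linear_on_id: "cont_linear_on X (\<lambda>x. x)"
  by (simp add: cont_linear_on_def linear_on_def)

lemma cont_linear_on_subset: "cont_linear_on X A \<Longrightarrow> V \<subseteq> X \<Longrightarrow> cont_linear_on V A"
  unfolding cont_linear_on_def linear_on_def using continuous_on_subset by blast

context tensor_power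
begin

lemma inner_t_permuted:
  assumes \<pi>: "\<pi> permutes {1..d}"
  shows "inner (t (\<lambda>i. f (\<pi> i))) (t (\<lambda>i. g (\<pi> i))) = inner (t f) (t g)"
  unfolding t_inner
  by (rule prod.permute[OF \<pi>, of "\<lambda>i. inner (f i) (g i)", unfolded o_def, symmetric])

text \<open>Permuting factors preserves the inner products of elementary tensors, so the map is
  isometric on finite combinations and extends with bound 1.\<close>

lemma perm_operator:
  assumes \<pi>: "\<pi> permutes {1..d}"
  shows "cont_linear_on X (perm_operator X t \<pi>)"
    and "perm_operator X t \<pi> (t f) = t (\<lambda>i. f (\<pi> i))"
    and "x \<in> X \<Longrightarrow> perm_operator X t \<pi> x \<in> X"
proof -
  have "(norm (\<Sum>f\<in>A. c f *\<^sub>R t (\<lambda>i. f (\<pi> i))))\<^sup>2 = (norm (\<Sum>f\<in>A. c f *\<^sub>R t f))\<^sup>2" for A c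
    unfolding norm_sum_squared inner_t_permuted[OF \<pi>] by (rule refl)
  then have bound: "norm (\<Sum>f\<in>A. c f *\<^sub>R t (\<lambda>i. f (\<pi> i))) \<le> 1 * norm (\<Sum>f\<in>A. c f *\<^sub>R t f)" for A c
    by simp
  note ext = tensor_extension[where F = "\<lambda>f. t (\<lambda>i. f (\<pi> i))" and K = 1,
      OF subspace_X complete_X t_in zero_le_one bound, folded perm_operator_def]
  show "cont_linear_on X (perm_operator X t \<pi>)" by (rule ext(1))
  show "perm_operator X t \<pi> (t f) = t (\<lambda>i. f (\<pi> i))" by (rule ext(2))
  show "perm_operator X t \<pi> x \<in> X" if "x \<in> X" by (rule ext(3)) (assumption | rule that)+
qed

text \<open>Permutations act by precomposition on the index, which reverses the order of the
  product.\<close>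

lemma perm_operator_compose:
  assumes \<pi>: "\<pi> permutes {1..d}" and \<sigma>: "\<sigma> permutes {1..d}" and x: "x \<in> X"
  shows "perm_operator X t \<pi> (perm_operator X t \<sigma> x) = perm_operator X t (\<sigma> \<circ> \<pi>) x"
proof (rule cont_linear_on_eqI[OF _ _ _ x])
  have \<sigma>\<pi>: "\<sigma> \<circ> \<pi> permutes {1..d}" using \<pi> \<sigma> by (rule permutes_compose)
  show "cont_linear_on X (\<lambda>x. perm_operator X t \<pi> (perm_operator X t \<sigma> x))"
    by (rule cont_linear_on_compose[OF perm_operator(1)[OF \<sigma>] perm_operator(1)[OF \<pi>] perm_operator(3)[OF \<sigma>]])
  show "cont_linear_on X (perm_operator X t (\<sigma> \<circ> \<pi>))" by (rule perm_operator(1)[OF \<sigma>\<pi>])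
  show "perm_operator X t \<pi> (perm_operator X t \<sigma> (t f)) = perm_operator X t (\<sigma> \<circ> \<pi>) (t f)" for f
    by (simp add: perm_operator(2)[OF \<pi>] perm_operator(2)[OF \<sigma>] perm_operator(2)[OF \<sigma>\<pi>])
qed

text \<open>Checked on pairs of elementary tensors, then extended by density in one argument at a
  time.\<close>

lemma perm_operator_adjoint:
  assumes \<pi>: "\<pi> permutes {1..d}" and x: "x \<in> X" and y: "y \<in> X"
  shows "inner (perm_operator X t \<pi> x) y = inner x (perm_operator X t (inv_into UNIV \<pi>) y)"
proof -
  have i: "inv_into UNIV \<pi> permutes {1..d}" using \<pi> by (rule permutes_inv)
  have tt: "inner (perm_operator X t \<pi> (t f)) (t g) = inner (t f) (perm_operator X t (inv_into UNIV \<pi>) (t g))" for f g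
    using inner_t_permuted[OF \<pi>, of f "\<lambda>i. g (inv_into UNIV \<pi> i)"]
    by (simp add: perm_operator(2)[OF \<pi>] perm_operator(2)[OF i] permutes_inverses(2)[OF \<pi>])
  have ty: "inner (perm_operator X t \<pi> (t f)) y = inner (t f) (perm_operator X t (inv_into UNIV \<pi>) y)" for f
    by (rule cont_linear_on_eqI[OF cont_linear_on_inner_right[OF cont_linear_on_id]
          cont_linear_on_inner_right[OF perm_operator(1)[OF i]] tt y])
  show ?thesis
    by (rule cont_linear_on_eqI[OF cont_linear_on_inner_left[OF perm_operator(1)[OF \<pi>]]
          cont_linear_on_inner ty x])
qed

end

section \<open>Weights of permutations and the orthogonal projections\<close>

lemma permutes_imp_permutation: "\<pi> permutes I \<Longrightarrow> finite I \<Longrightarrow> permutation \<pi>"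
  using permutation_permutes by blast

lemma perm_weight_compose:
  assumes "\<pi> permutes I" "\<sigma> permutes I" "finite I"
  shows "perm_weight P (\<pi> \<circ> \<sigma>) = perm_weight P \<pi> * perm_weight P \<sigma>"
  using assms by (cases P) (simp_all add: sign_compose permutes_imp_permutation)

lemma perm_weight_square: "perm_weight P \<pi> * perm_weight P \<pi> = 1"
  by (cases P) (simp_all flip: of_int_mult)

lemma perm_weight_inv: "\<pi> permutes I \<Longrightarrow> finite I \<Longrightarrow> perm_weight P (inv_into UNIV \<pi>) = perm_weight P \<pi>"
  by (cases P) (simp_all add: sign_inverse permutes_imp_permutation)

locale tensor_symmetrization = tensor_power d X t
  for d :: nat and X :: "'k::real_inner set" and t :: "(nat \<Rightarrow> 'h::real_inner) \<Rightarrow> 'k" +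
  fixes P :: projector_kind and I :: "nat set"
  assumes I: "I \<subseteq> {1..d}"
begin

abbreviation "U \<equiv> perm_operator X t"
abbreviation "Pr \<equiv> tensor_projector P X t I"
abbreviation "V \<equiv> projected_space P X t I"
abbreviation "N \<equiv> real (card {\<pi>. \<pi> permutes I})"

lemma finite_I: "finite I" using I finite_subset by blast

lemma permutes_d: "\<pi> permutes I \<Longrightarrow> \<pi> permutes {1..d}"
  using I by (rule permutes_subset[rotated])

lemma finite_perms: "finite {\<pi>. \<pi> permutes I}"
  using finite_I by (rule finite_permutations)

lemma N_pos: "N > 0"
  using finite_I by (simp add: card_permutations[OF refl])

lemma Pr_cont: "cont_linear_on X Pr"
  unfolding tensor_projector_def
  by (intro cont_linear_on_scaleR cont_linear_on_sum perm_operator(1) permutes_d) simp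

lemma Pr_in: "x \<in> X \<Longrightarrow> Pr x \<in> X"
  unfolding tensor_projector_def
  by (intro subspace_scale subspace_sum subspace_X perm_operator(3) permutes_d) simp_all

text \<open>Reindexing the sum by right composition with \<open>\<sigma>\<close>; weights are
  multiplicative and square to 1.\<close>

lemma U_Pr:
  assumes \<sigma>: "\<sigma> permutes I" and x: "x \<in> X"
  shows "U \<sigma> (Pr x) = perm_weight P \<sigma> *\<^sub>R Pr x"
proof -
  let ?w = "perm_weight P"
  have lin: "linear_on X (U \<sigma>)"
    using perm_operator(1)[OF permutes_d[OF \<sigma>]] by (simp add: cont_linear_on_def)
  have Ux: "U \<pi> x \<in> X" if "\<pi> permutes I" for \<pi> using perm_operator(3)[OF permutes_d[OF that] x] .
  have "U \<sigma> (Pr x) = (1 / N) *\<^sub>R (\<Sum>\<pi> | \<pi> permutes I. ?w \<pi> *\<^sub>R U \<sigma> (U \<pi> x))"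
    unfolding tensor_projector_def
    by (subst linear_on_scaleR[OF lin], rule subspace_sum[OF subspace_X],
        rule subspace_scale[OF subspace_X], simp add: Ux,
        subst linear_on_sum[OF lin subspace_X]) (simp_all add: Ux)
  also have "(\<Sum>\<pi> | \<pi> permutes I. ?w \<pi> *\<^sub>R U \<sigma> (U \<pi> x))
      = (\<Sum>\<pi> | \<pi> permutes I. ?w \<sigma> *\<^sub>R (?w (\<pi> \<circ> \<sigma>) *\<^sub>R U (\<pi> \<circ> \<sigma>) x))"
  proof (intro sum.cong refl)
    fix \<pi> assume "\<pi> \<in> {\<pi>. \<pi> permutes I}"
    then have \<pi>: "\<pi> permutes I" by simp
    have "?w \<pi> = ?w \<sigma> * ?w (\<pi> \<circ> \<sigma>)"
      using perm_weight_square[of P \<sigma>] by (simp add: perm_weight_compose[OF \<pi> \<sigma> finite_I])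
    then show "?w \<pi> *\<^sub>R U \<sigma> (U \<pi> x) = ?w \<sigma> *\<^sub>R (?w (\<pi> \<circ> \<sigma>) *\<^sub>R U (\<pi> \<circ> \<sigma>) x)"
      using perm_operator_compose[OF permutes_d[OF \<sigma>] permutes_d[OF \<pi>] x] by simp
  qed
  also have "\<dots> = (\<Sum>\<pi> | \<pi> permutes I. ?w \<sigma> *\<^sub>R (?w \<pi> *\<^sub>R U \<pi> x))"
    by (rule sum_permutations_compose_right[OF \<sigma>, symmetric])
  finally show ?thesis
    unfolding tensor_projector_def by (simp add: scaleR_sum_right mult.commute)
qed

text \<open>The mirror image of \<open>U_Pr\<close>, reindexing by left composition.\<close>

lemma Pr_U:
  assumes \<sigma>: "\<sigma> permutes I" and x: "x \<in> X"
  shows "Pr (U \<sigma> x) = perm_weight P \<sigma> *\<^sub>R Pr x"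
proof -
  let ?w = "perm_weight P"
  have "(\<Sum>\<pi> | \<pi> permutes I. ?w \<pi> *\<^sub>R U \<pi> (U \<sigma> x))
      = (\<Sum>\<pi> | \<pi> permutes I. ?w \<sigma> *\<^sub>R (?w (\<sigma> \<circ> \<pi>) *\<^sub>R U (\<sigma> \<circ> \<pi>) x))"
  proof (intro sum.cong refl)
    fix \<pi> assume "\<pi> \<in> {\<pi>. \<pi> permutes I}"
    then have \<pi>: "\<pi> permutes I" by simp
    have "?w \<pi> = ?w \<sigma> * ?w (\<sigma> \<circ> \<pi>)"
      using perm_weight_square[of P \<sigma>]
      by (simp add: perm_weight_compose[OF \<sigma> \<pi> finite_I] flip: mult.assoc)
    then show "?w \<pi> *\<^sub>R U \<pi> (U \<sigma> x) = ?w \<sigma> *\<^sub>R (?w (\<sigma> \<circ> \<pi>) *\<^sub>R U (\<sigma> \<circ> \<pi>) x)"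
      using perm_operator_compose[OF permutes_d[OF \<pi>] permutes_d[OF \<sigma>] x] by simp
  qed
  also have "\<dots> = (\<Sum>\<pi> | \<pi> permutes I. ?w \<sigma> *\<^sub>R (?w \<pi> *\<^sub>R U \<pi> x))"
    by (rule setum_permutations_compose_left[OF \<sigma>, symmetric])
  finally show ?thesis
    unfolding tensor_projector_def by (simp add: scaleR_sum_right mult.commute)
qed

lemma Pr_idem:
  assumes "x \<in> X"
  shows "Pr (Pr x) = Pr x"
proof -
  have "Pr (Pr x) = (1 / N) *\<^sub>R (\<Sum>\<pi> | \<pi> permutes I. perm_weight P \<pi> *\<^sub>R U \<pi> (Pr x))"
    by (rule tensor_projector_def)
  also have "(\<Sum>\<pi> | \<pi> permutes I. perm_weight P \<pi> *\<^sub>R U \<pi> (Pr x)) = (\<Sum>\<pi> | \<pi> permutes I. Pr x)"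
    using assms by (intro sum.cong refl) (simp add: U_Pr perm_weight_square)
  finally show ?thesis using N_pos by (simp add: sum_constant_scaleR)
qed

text \<open>The adjoint of a permutation operator belongs to the inverse permutation, which has the
  same weight, so inversion reindexes the sum.\<close>

lemma Pr_self_adjoint:
  assumes x: "x \<in> X" and y: "y \<in> X"
  shows "inner (Pr x) y = inner x (Pr y)"
proof -
  let ?w = "perm_weight P"
  have "inner (Pr x) y = (1 / N) * (\<Sum>\<pi> | \<pi> permutes I. ?w \<pi> * inner (U \<pi> x) y)"
    by (simp add: tensor_projector_def inner_sum_left)
  also have "(\<Sum>\<pi> | \<pi> permutes I. ?w \<pi> * inner (U \<pi> x) y)
      = (\<Sum>\<pi> | \<pi> permutes I. ?w (inv_into UNIV \<pi>) * inner x (U (inv_into UNIV \<pi>) y))"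
  proof (intro sum.cong refl)
    fix \<pi> assume "\<pi> \<in> {\<pi>. \<pi> permutes I}"
    then have \<pi>: "\<pi> permutes I" by simp
    show "?w \<pi> * inner (U \<pi> x) y = ?w (inv_into UNIV \<pi>) * inner x (U (inv_into UNIV \<pi>) y)"
      unfolding perm_operator_adjoint[OF permutes_d[OF \<pi>] x y] perm_weight_inv[OF \<pi> finite_I] by (rule refl)
  qed
  also have "\<dots> = (\<Sum>\<pi> | \<pi> permutes I. ?w \<pi> * inner x (U \<pi> y))"
    by (rule sum_permutations_inverse[symmetric])
  finally show ?thesis by (simp add: tensor_projector_def inner_sum_right)
qed

text \<open>The range of an idempotent is its fixed space, a description that passes to limits by
  continuity.\<close>

lemma V_eq: "V = {x \<in> X. Pr x = x}"
  unfolding projected_space_def using Pr_in Pr_idem by (auto simp: image_iff) metis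

lemma Pr_in_V: "x \<in> X \<Longrightarrow> Pr x \<in> V"
  unfolding projected_space_def by (rule imageI)

lemma V_subset: "V \<subseteq> X"
  unfolding V_eq by blast

lemma subspace_V: "subspace V"
proof -
  have lin: "linear_on X Pr" using Pr_cont by (simp add: cont_linear_on_def)
  show ?thesis
    unfolding V_eq subspace_def
    using subspace_0[OF subspace_X] subspace_add[OF subspace_X] subspace_scale[OF subspace_X]
      linear_on_0[OF lin subspace_X]
    by (simp add: linear_on_add[OF lin] linear_on_scaleR[OF lin])
qed

lemma complete_V: "complete V"
proof (rule complete_closed_subset[OF _ V_subset complete_X])
  show "closed V"
    unfolding closed_sequential_limits
  proof (intro allI impI)
    fix s l assume "(\<forall>n. s n \<in> V) \<and> s \<longlonglongrightarrow> l"
    then have s: "s n \<in> X" "Pr (s n) = s n" "s \<longlonglongrightarrow> l" for n unfolding V_eq by auto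
    have l: "l \<in> X"
      using complete_imp_closed[OF complete_X] s(1,3) unfolding closed_sequential_limits by blast
    have "continuous_on X Pr" using Pr_cont by (simp add: cont_linear_on_def)
    then have "(\<lambda>n. Pr (s n)) \<longlonglongrightarrow> Pr l"
      using s(1,3) l unfolding continuous_on_sequentially by (auto simp: o_def)
    then have "s \<longlonglongrightarrow> Pr l" by (simp only: s(2))
    then have "Pr l = l" using LIMSEQ_unique[OF s(3)] by metis
    then show "l \<in> V" using l unfolding V_eq by blast
  qed
qed

end

text \<open>\<open>S\<close> acts on every factor alike, so its tensor power intertwines the
  permutation operators of source and target.\<close>

lemma tensor_power_operator_projector:
  fixes S :: "'h::real_inner \<Rightarrow> 'g::real_inner"
  assumes H: "hilbert_tensor_power d X t" and G: "hilbert_tensor_power d Y u"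
    and S: "bounded_linear S" and I: "I \<subseteq> {1..d}" and x: "x \<in> X"
  shows "tensor_power_operator X t u S (tensor_projector P X t I x) =
    tensor_projector P Y u I (tensor_power_operator X t u S x)"
proof -
  interpret H: tensor_symmetrization d X t P I using H I by unfold_locales
  interpret G: tensor_symmetrization d Y u P I using G I by unfold_locales
  let ?S = "tensor_power_operator X t u S"
  note S' = tensor_power_operator[OF H G S]
  have lin: "linear_on X ?S" using S'(1) by (simp add: cont_linear_on_def)
  have SU: "?S (H.U \<pi> x) = G.U \<pi> (?S x)" if "\<pi> permutes I" for \<pi>
  proof (rule H.cont_linear_on_eqI[OF _ _ _ x])
    note \<pi> = H.permutes_d[OF that]
    show "cont_linear_on X (\<lambda>x. ?S (H.U \<pi> x))"
      by (rule cont_linear_on_compose[OF H.perm_operator(1)[OF \<pi>] S'(1) H.perm_operator(3)[OF \<pi>]])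
    show "cont_linear_on X (\<lambda>x. G.U \<pi> (?S x))"
      by (rule cont_linear_on_compose[OF S'(1) G.perm_operator(1)[OF \<pi>] S'(3)])
    show "?S (H.U \<pi> (t f)) = G.U \<pi> (?S (t f))" for f
      by (simp add: H.perm_operator(2)[OF \<pi>] G.perm_operator(2)[OF \<pi>] S'(2))
  qed
  have Ux: "H.U \<pi> x \<in> X" if "\<pi> permutes I" for \<pi> using H.perm_operator(3)[OF H.permutes_d[OF that] x] .
  show ?thesis
    unfolding tensor_projector_def
    by (subst linear_on_scaleR[OF lin], rule subspace_sum[OF H.subspace_X],
        rule subspace_scale[OF H.subspace_X], simp add: Ux,
        subst linear_on_sum[OF lin H.subspace_X]) (simp_all add: Ux SU)
qed

section \<open>The eigenvectors of the restricted problem\<close>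

text \<open>The stabilizer of \<open>k\<close> is the product of the symmetric groups of its level
  sets: \<open>?r\<close> restricts to the level sets and \<open>?g\<close> glues the
  pieces.\<close>

lemma card_perms_preserving:
  assumes "finite I"
  shows "card {\<pi>. \<pi> permutes I \<and> (\<forall>i\<in>I. k (\<pi> i) = k i)} = mult_fact I k"
proof -
  let ?F = "\<lambda>m. {i \<in> I. k i = m}"
  let ?A = "{\<pi>. \<pi> permutes I \<and> (\<forall>i\<in>I. k (\<pi> i) = k i)}"
  let ?B = "Pi\<^sub>E (k ` I) (\<lambda>m. {p. p permutes ?F m})"
  let ?r = "\<lambda>\<pi>. \<lambda>m\<in>k ` I. \<lambda>i. if i \<in> ?F m then \<pi> i else i"
  let ?g = "\<lambda>p i. if i \<in> I then p (k i) i else i"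
  have r: "?r \<pi> \<in> ?B" if "\<pi> \<in> ?A" for \<pi>
  proof (rule restrict_PiE_iff[THEN iffD2], rule ballI, rule CollectI)
    fix m
    have \<pi>: "\<pi> permutes I" "\<And>i. i \<in> I \<Longrightarrow> k (\<pi> i) = k i" using that by auto
    show "(\<lambda>i. if i \<in> ?F m then \<pi> i else i) permutes ?F m"
    proof (rule bij_imp_permutes)
      have inj: "inj_on (\<lambda>i. if i \<in> ?F m then \<pi> i else i) (?F m)"
        using permutes_inj[OF \<pi>(1)] by (auto simp: inj_on_def inj_def)
      have sub: "(\<lambda>i. if i \<in> ?F m then \<pi> i else i) ` ?F m \<subseteq> ?F m"
        using permutes_in_image[OF \<pi>(1)] \<pi>(2) by auto
      show "bij_betw (\<lambda>i. if i \<in> ?F m then \<pi> i else i) (?F m) (?F m)"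
        unfolding bij_betw_def by (intro conjI inj endo_inj_surj[OF _ sub inj]) (use assms in simp)
    qed auto
  qed
  have g: "?g p \<in> ?A" if "p \<in> ?B" for p
  proof -
    have p: "p (k i) permutes ?F (k i)" if "i \<in> I" for i using \<open>p \<in> ?B\<close> that by (auto simp: PiE_iff)
    have pin: "p (k i) i \<in> ?F (k i)" if "i \<in> I" for i
      using permutes_in_image[OF p[OF that], of i] that by simp
    have "?g p permutes I"
    proof (rule bij_imp_permutes)
      have inj: "inj_on (?g p) I"
      proof (rule inj_onI)
        fix i j assume ij: "i \<in> I" "j \<in> I" "?g p i = ?g p j"
        then have eq: "p (k i) i = p (k j) j" by simp
        then have "k i = k j" using pin[OF ij(1)] pin[OF ij(2)] by simp
        then show "i = j" using eq permutes_inj[OF p[OF ij(1)]] by (simp add: inj_eq)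
      qed
      have sub: "?g p ` I \<subseteq> I" using pin by auto
      show "bij_betw (?g p) I I"
        unfolding bij_betw_def by (intro conjI inj endo_inj_surj[OF assms sub inj])
    qed auto
    then show ?thesis using pin by auto
  qed
  have "bij_betw ?r ?A ?B"
  proof (rule bij_betw_byWitness[where f' = ?g])
    show "\<forall>\<pi>\<in>?A. ?g (?r \<pi>) = \<pi>" by (auto simp: fun_eq_iff permutes_def)
    show "\<forall>p\<in>?B. ?r (?g p) = p"
    proof
      fix p assume p: "p \<in> ?B"
      show "?r (?g p) = p"
      proof
        fix m
        show "?r (?g p) m = p m"
        proof (cases "m \<in> k ` I")
          case True
          then have pm: "p m permutes ?F m" using p by (auto simp: PiE_iff)
          have "(if i \<in> ?F m then ?g p i else i) = p m i" for i
            using permutes_not_in[OF pm, of i] by auto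
          then show ?thesis using True by simp
        qed (use PiE_arb[OF p, of m] in simp)
      qed
    qed
  qed (use r g in blast)+
  then have "card ?A = card ?B" by (rule bij_betw_same_card)
  also have "\<dots> = (\<Prod>m\<in>k ` I. card {p. p permutes ?F m})" using assms by (intro card_PiE) simp
  also have "\<dots> = mult_fact I k"
    unfolding mult_fact_def using assms by (intro prod.cong refl) (simp add: card_permutations)
  finally show ?thesis .
qed

text \<open>Listed in increasing order of the index, \<open>k\<close> and \<open>j\<close> give
  sorted lists with the same multiset of values.\<close>

lemma sorted_rearrangement_unique:
  fixes k j :: "nat \<Rightarrow> nat"
  assumes I: "finite I" and k: "mono_on I k" and j: "mono_on I j"
    and \<pi>: "\<pi> permutes I" and eq: "\<And>i. i \<in> I \<Longrightarrow> k (\<pi> i) = j i" and i: "i \<in> I"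
  shows "k i = j i"
proof -
  let ?l = "sorted_list_of_set I"
  have l: "set ?l = I" "sorted ?l" "distinct ?l" using I by auto
  have sorted: "sorted (map k ?l)" "sorted (map j ?l)"
    using k j l by (auto intro: sorted_map_mono)
  have mset_l: "mset ?l = mset_set I" using mset_set_set[OF l(3)] l(1) by simp
  have "mset (map j ?l) = image_mset j (mset_set I)" by (simp only: mset_map mset_l)
  also have "\<dots> = image_mset k (image_mset \<pi> (mset_set I))"
    using eq I by (auto simp: multiset.map_comp intro!: image_mset_cong)
  also have "image_mset \<pi> (mset_set I) = mset_set I"
    using image_mset_mset_set[OF permutes_inj_on[OF \<pi>]] permutes_image[OF \<pi>] by simp
  also have "image_mset k (mset_set I) = mset (map k ?l)"
    by (simp only: mset_map mset_l)
  finally have "map j ?l = map k ?l"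
    using sorted properties_for_sort by metis
  then show ?thesis using l(1) i by auto
qed

text \<open>A permutation \<open>\<pi>\<close> maximizing \<open>\<Sum>i\<in>I. i * k (\<pi> i)\<close> sorts \<open>k\<close>.\<close>

lemma sorting_perm_exists:
  fixes k :: "nat \<Rightarrow> nat"
  assumes I: "finite I"
  obtains \<pi> where "\<pi> permutes I" "mono_on I (\<lambda>i. k (\<pi> i))"
proof -
  define f where "f \<pi> = (\<Sum>i\<in>I. i * k (\<pi> i))" for \<pi> :: "nat \<Rightarrow> nat"
  have "finite {\<pi>. \<pi> permutes I}" "{\<pi>. \<pi> permutes I} \<noteq> {}"
    using I permutes_id finite_permutations by blast+
  then obtain \<pi> where \<pi>: "\<pi> permutes I" and max: "\<And>\<sigma>. \<sigma> permutes I \<Longrightarrow> f \<sigma> \<le> f \<pi>"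
    using obtains_MAX[of "{\<pi>. \<pi> permutes I}" f] by (metis Max_ge finite_imageI image_eqI mem_Collect_eq)
  have "k (\<pi> a) \<le> k (\<pi> b)" if ab: "a \<in> I" "b \<in> I" "a \<le> b" for a b
  proof (rule ccontr)
    assume "\<not> ?thesis"
    then have gt: "k (\<pi> b) < k (\<pi> a)" and ne: "a < b" using ab(3) by (auto simp: le_less)
    \<comment> \<open>Exchanging two values in the wrong order would raise the sum by
      \<open>(b - a) * (k (\<pi> a) - k (\<pi> b))\<close>.\<close>
    let ?\<sigma> = "\<pi> \<circ> Transposition.transpose a b"
    have "?\<sigma> permutes I" using permutes_swap_id[OF ab(1,2)] \<pi> by (rule permutes_compose)
    then have "f ?\<sigma> \<le> f \<pi>" by (rule max)
    moreover have split: "f \<rho> = a * k (\<rho> a) + b * k (\<rho> b) + (\<Sum>i\<in>I - {a, b}. i * k (\<rho> i))" for \<rho>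
    proof -
      have "f \<rho> = (\<Sum>i\<in>{a, b}. i * k (\<rho> i)) + (\<Sum>i\<in>I - {a, b}. i * k (\<rho> i))"
        unfolding f_def using I ab by (subst sum.subset_diff[of "{a, b}"]) auto
      then show ?thesis using ne by simp
    qed
    moreover have "(\<Sum>i\<in>I - {a, b}. i * k (?\<sigma> i)) = (\<Sum>i\<in>I - {a, b}. i * k (\<pi> i))"
      by (intro sum.cong refl) auto
    ultimately have "a * k (\<pi> b) + b * k (\<pi> a) \<le> a * k (\<pi> a) + b * k (\<pi> b)"
      using split[of ?\<sigma>] split[of \<pi>] by simp
    moreover obtain c where c: "b = a + c" "c > 0" using ne less_imp_add_positive by blast
    ultimately have "c * k (\<pi> a) \<le> c * k (\<pi> b)" by (simp add: algebra_simps)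
    then show False using gt c(2) by simp
  qed
  then show thesis using that[OF \<pi>] by (simp add: mono_on_def)
qed

section \<open>Orthonormality and completeness of the projected basis tensors\<close>

locale symmetrized_basis = tensor_symmetrization d X t P I
  for d :: nat and X :: "'k::real_inner set" and t :: "(nat \<Rightarrow> 'h::real_inner) \<Rightarrow> 'k"
    and P :: projector_kind and I :: "nat set" +
  fixes v :: enat and \<phi> :: "nat \<Rightarrow> 'h"
  assumes ortho: "\<And>m n. m \<in> initial_segment v \<Longrightarrow> n \<in> initial_segment v \<Longrightarrow>
    inner (\<phi> m) (\<phi> n) = (if m = n then 1 else 0)"
begin

abbreviation "M \<equiv> initial_segment v"
abbreviation "Nab \<equiv> nabla P v d I"
abbreviation "E k \<equiv> t (\<lambda>i. \<phi> (k i))"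
abbreviation "xi \<equiv> xi_tilde P X t I \<phi>"

lemma Nab_in: "k \<in> Nab \<Longrightarrow> k \<in> {1..d} \<rightarrow>\<^sub>E M"
  by (simp add: nabla_def)

lemma Nab_M: "k \<in> Nab \<Longrightarrow> i \<in> {1..d} \<Longrightarrow> k i \<in> M"
  using Nab_in by blast

lemma Nab_mono: "k \<in> Nab \<Longrightarrow> mono_on I k"
  by (cases P) (auto simp: nabla_def intro: strict_mono_on_imp_mono_on)

lemma U_E: "\<pi> permutes I \<Longrightarrow> U \<pi> (E k) = E (k \<circ> \<pi>)"
  by (simp add: perm_operator(2)[OF permutes_d])

lemma inner_E:
  assumes "\<And>i. i \<in> {1..d} \<Longrightarrow> k i \<in> M" "\<And>i. i \<in> {1..d} \<Longrightarrow> j i \<in> M"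
  shows "inner (E k) (E j) = (if \<forall>i\<in>{1..d}. k i = j i then 1 else 0)"
proof -
  have "inner (E k) (E j) = (\<Prod>i=1..d. if k i = j i then 1 else 0)"
    unfolding t_inner using assms by (intro prod.cong refl) (simp add: ortho)
  then show ?thesis by (auto intro!: prod.neutral prod_zero)
qed

lemma perm_in_d: "\<pi> permutes I \<Longrightarrow> i \<in> {1..d} \<Longrightarrow> \<pi> i \<in> {1..d}"
  using permutes_in_image[OF permutes_d] by blast

lemma inner_Pr_E:
  assumes k: "\<And>i. i \<in> {1..d} \<Longrightarrow> k i \<in> M" and j: "\<And>i. i \<in> {1..d} \<Longrightarrow> j i \<in> M"
  shows "inner (Pr (E k)) (E j) =
    (1 / N) * (\<Sum>\<pi> | \<pi> permutes I \<and> (\<forall>i\<in>{1..d}. k (\<pi> i) = j i). perm_weight P \<pi>)"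
proof -
  have "inner (Pr (E k)) (E j) = (1 / N) * (\<Sum>\<pi> | \<pi> permutes I. perm_weight P \<pi> * inner (U \<pi> (E k)) (E j))"
    by (simp add: tensor_projector_def inner_sum_left)
  also have "(\<Sum>\<pi> | \<pi> permutes I. perm_weight P \<pi> * inner (U \<pi> (E k)) (E j))
      = (\<Sum>\<pi> | \<pi> permutes I. if \<forall>i\<in>{1..d}. k (\<pi> i) = j i then perm_weight P \<pi> else 0)"
  proof (intro sum.cong refl)
    fix \<pi> assume "\<pi> \<in> {\<pi>. \<pi> permutes I}"
    then have \<pi>: "\<pi> permutes I" by simp
    have "inner (E (k \<circ> \<pi>)) (E j) = (if \<forall>i\<in>{1..d}. (k \<circ> \<pi>) i = j i then 1 else 0)"
      using k[OF perm_in_d[OF \<pi>]] j by (intro inner_E) auto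
    then show "perm_weight P \<pi> * inner (U \<pi> (E k)) (E j)
        = (if \<forall>i\<in>{1..d}. k (\<pi> i) = j i then perm_weight P \<pi> else 0)"
      unfolding U_E[OF \<pi>] by simp
  qed
  also have "\<dots> = (\<Sum>\<pi> | \<pi> permutes I \<and> (\<forall>i\<in>{1..d}. k (\<pi> i) = j i). perm_weight P \<pi>)"
    by (simp add: sum.inter_filter[OF finite_perms, symmetric])
  finally show ?thesis .
qed

text \<open>Off the diagonal no permutation contributes, as a monotone rearrangement is unique. On
  the diagonal the stabilizer of \<open>k\<close> is counted; its weights are 1, since in the
  antisymmetric case \<open>k\<close> is injective on \<open>I\<close> and the stabilizer
  trivial.\<close>

lemma inner_Pr_E_Nab:
  assumes k: "k \<in> Nab" and j: "j \<in> Nab"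
  shows "inner (Pr (E k)) (E j) = (if k = j then mult_fact I k / N else 0)"
proof (cases "k = j")
  case False
  have "\<not> (\<pi> permutes I \<and> (\<forall>i\<in>{1..d}. k (\<pi> i) = j i))" for \<pi>
  proof
    assume \<pi>: "\<pi> permutes I \<and> (\<forall>i\<in>{1..d}. k (\<pi> i) = j i)"
    have "k i = j i" if "i \<in> {1..d}" for i
    proof (cases "i \<in> I")
      case True
      then show ?thesis
        using sorted_rearrangement_unique[OF finite_I Nab_mono[OF k] Nab_mono[OF j], of \<pi> i] \<pi> I by blast
    next
      case False
      then show ?thesis using \<pi> permutes_not_in[of \<pi> I i] that by metis
    qed
    then have "k = j" by (rule PiE_ext[OF Nab_in[OF k] Nab_in[OF j]])
    then show False using \<open>k \<noteq> j\<close> by simp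
  qed
  then have none: "{\<pi>. \<pi> permutes I \<and> (\<forall>i\<in>{1..d}. k (\<pi> i) = j i)} = {}" by blast
  have "inner (Pr (E k)) (E j) =
      (1 / N) * (\<Sum>\<pi> | \<pi> permutes I \<and> (\<forall>i\<in>{1..d}. k (\<pi> i) = j i). perm_weight P \<pi>)"
    using k j by (intro inner_Pr_E Nab_M)
  then show ?thesis unfolding none using False by simp
next
  case True
  let ?A = "{\<pi>. \<pi> permutes I \<and> (\<forall>i\<in>I. k (\<pi> i) = k i)}"
  have A: "{\<pi>. \<pi> permutes I \<and> (\<forall>i\<in>{1..d}. k (\<pi> i) = k i)} = ?A"
  proof (intro equalityI subsetI)
    fix \<pi> assume "\<pi> \<in> ?A"
    then have \<pi>: "\<pi> permutes I" "\<And>i. i \<in> I \<Longrightarrow> k (\<pi> i) = k i" by auto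
    have "k (\<pi> i) = k i" for i
      using \<pi>(2)[of i] permutes_not_in[OF \<pi>(1), of i] by (cases "i \<in> I") auto
    then show "\<pi> \<in> {\<pi>. \<pi> permutes I \<and> (\<forall>i\<in>{1..d}. k (\<pi> i) = k i)}" using \<pi>(1) by blast
  qed (use I in blast)
  have w: "perm_weight P \<pi> = 1" if "\<pi> \<in> ?A" for \<pi>
  proof (cases P)
    case Antisymmetrizer
    then have "inj_on k I" using k by (auto simp: nabla_def intro: strict_mono_on_imp_inj_on)
    then have "\<pi> i = i" for i
      using that permutes_in_image[of \<pi> I i] permutes_not_in[of \<pi> I i]
      by (cases "i \<in> I") (auto dest: inj_onD)
    then have "\<pi> = id" by auto
    then show ?thesis using Antisymmetrizer by simp
  qed simp
  have "(\<Sum>\<pi>\<in>?A. perm_weight P \<pi>) = real (card ?A)"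
    using w by simp
  moreover have "inner (Pr (E k)) (E k) =
      (1 / N) * (\<Sum>\<pi> | \<pi> permutes I \<and> (\<forall>i\<in>{1..d}. k (\<pi> i) = k i). perm_weight P \<pi>)"
    using k by (intro inner_Pr_E Nab_M)
  ultimately show ?thesis
    using True unfolding A card_perms_preserving[OF finite_I] by simp
qed

lemma mult_fact_pos: "0 < mult_fact I k"
  unfolding mult_fact_def by (rule prod_pos) simp

lemma xi_eq: "xi k = sqrt (N / mult_fact I k) *\<^sub>R Pr (E k)"
  by (simp add: xi_tilde_def)

lemma xi_in: "xi k \<in> V"
  unfolding xi_eq by (intro subspace_scale subspace_V Pr_in_V t_in)

text \<open>The diagonal value \<open>mult_fact I k / N\<close> is the squared norm of
  \<open>Pr (E k)\<close>, which explains the normalizing root in \<open>xi_tilde\<close>.\<close>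

lemma xi_ortho:
  assumes k: "k \<in> Nab" and j: "j \<in> Nab"
  shows "inner (xi k) (xi j) = (if k = j then 1 else 0)"
proof -
  have "inner (xi k) (xi j) = sqrt (N / mult_fact I k) * sqrt (N / mult_fact I j) * inner (Pr (E k)) (Pr (E j))"
    by (simp add: xi_eq)
  also have "inner (Pr (E k)) (Pr (E j)) = inner (Pr (E k)) (E j)"
    using Pr_self_adjoint[OF Pr_in[OF t_in] t_in] Pr_idem[OF t_in] by metis
  also have "\<dots> = (if k = j then mult_fact I k / N else 0)" by (rule inner_Pr_E_Nab[OF k j])
  finally show ?thesis using N_pos mult_fact_pos[of k] mult_fact_pos[of j] by (cases "k = j") simp_all
qed

text \<open>Sorting \<open>k\<close> changes \<open>Pr (E k)\<close> only by a sign, so the sorted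
  index \<open>?k\<close> decides. If it is not in \<open>Nab\<close>, then it repeats a value on
  \<open>I\<close> in the antisymmetric case; the transposition of equal factors fixes the tensor
  but negates its projection, which therefore vanishes.\<close>

lemma orthogonal_E:
  assumes x: "x \<in> V" and orth: "\<And>k. k \<in> Nab \<Longrightarrow> inner x (xi k) = 0"
    and k: "\<And>i. i \<in> {1..d} \<Longrightarrow> k i \<in> M"
  shows "inner x (E k) = 0"
proof -
  have xX: "x \<in> X" and Prx: "Pr x = x" using x unfolding V_eq by auto
  obtain \<pi> where \<pi>: "\<pi> permutes I" and mono: "mono_on I (\<lambda>i. k (\<pi> i))"
    using sorting_perm_exists[OF finite_I] by blast
  let ?k = "restrict (k \<circ> \<pi>) {1..d}"
  have kM: "?k \<in> {1..d} \<rightarrow>\<^sub>E M" using k perm_in_d[OF \<pi>] by auto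
  have mono': "mono_on I ?k" using mono I by (auto simp: mono_on_def subset_iff)
  have Ek: "E ?k = U \<pi> (E k)" unfolding U_E[OF \<pi>] by (rule t_cong) simp
  have "inner x (Pr (E ?k)) = 0"
  proof (cases "?k \<in> Nab")
    case True
    then show ?thesis
      using orth[OF True] N_pos mult_fact_pos[of ?k] by (simp add: xi_eq)
  next
    case False
    then have P: "P = Antisymmetrizer" and "\<not> strict_mono_on I ?k"
      using kM mono' by (cases P; simp add: nabla_def)+
    then obtain a b where ab: "a \<in> I" "b \<in> I" "a < b" "\<not> ?k a < ?k b"
      by (auto simp: strict_mono_on_def)
    then have eq: "?k a = ?k b" using mono' unfolding mono_on_def by (meson less_imp_le linorder_not_less order_antisym)
    let ?\<tau> = "Transposition.transpose a b"
    have \<tau>: "?\<tau> permutes I" using ab(1,2) by (rule permutes_swap_id)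
    have "U ?\<tau> (E ?k) = E ?k"
      unfolding U_E[OF \<tau>] using eq by (intro t_cong arg_cong[of _ _ \<phi>]) (auto simp: Transposition.transpose_def)
    then have "Pr (E ?k) = - Pr (E ?k)"
      using Pr_U[OF \<tau> t_in, of "\<lambda>i. \<phi> (?k i)"] ab(3) P by (simp add: sign_swap_id)
    then have "2 *\<^sub>R Pr (E ?k) = 0" by (simp add: scaleR_2 eq_neg_iff_add_eq_0)
    then show ?thesis by simp
  qed
  also have "Pr (E ?k) = perm_weight P \<pi> *\<^sub>R Pr (E k)" unfolding Ek by (rule Pr_U[OF \<pi> t_in])
  finally have "perm_weight P \<pi> * inner x (Pr (E k)) = 0" by simp
  then have "inner x (Pr (E k)) = 0" using perm_weight_square[of P \<pi>] by auto
  then show ?thesis using Pr_self_adjoint[OF xX t_in] Prx by simp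
qed

end

section \<open>From basis tensors to the kernel of the tensor power operator\<close>

lemma (in tensor_power) bounded_linear_t_update:
  assumes i: "i \<in> {1..d}"
  shows "bounded_linear (\<lambda>x. t (f(i := x)))"
proof -
  have lin: "linear (\<lambda>x. t (f(i := x)))" using i by (rule t_linear)
  let ?C = "\<Prod>l\<in>{1..d} - {i}. inner (f l) (f l)"
  have C: "?C \<ge> 0" by (intro prod_nonneg) simp
  have "norm (t (f(i := x))) \<le> norm x * sqrt ?C" for x
  proof -
    have "inner (t (f(i := x))) (t (f(i := x))) = inner x x * ?C"
      unfolding t_inner using i by (subst prod.remove[of _ i]) auto
    then have "(norm (t (f(i := x))))\<^sup>2 = (norm x * sqrt ?C)\<^sup>2"
      using C by (simp add: power_mult_distrib power2_norm_eq_inner)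
    then show ?thesis by (rule power2_le_imp_le[OF eq_refl])
      (intro mult_nonneg_nonneg norm_ge_zero real_sqrt_ge_zero C)
  qed
  then show ?thesis
    by (intro bounded_linear_intro[of _ "sqrt ?C"] linear_add[OF lin] linear_cmul[OF lin])
qed

text \<open>Factors are released one at a time: \<open>A\<close> is the set of positions already
  allowed in the closed span, and in a single slot the condition cuts out a closed subspace.\<close>

lemma (in tensor_power) orthogonal_t_closure:
  assumes x: "\<And>k. (\<And>i. i \<in> {1..d} \<Longrightarrow> k i \<in> M) \<Longrightarrow> inner x (t (\<lambda>i. \<phi> (k i))) = 0"
    and f: "\<And>i. i \<in> {1..d} \<Longrightarrow> f i \<in> closure (span (\<phi> ` M))"
  shows "inner x (t f) = 0"
proof -
  let ?D = "closure (span (\<phi> ` M))"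
  have "\<forall>f. (\<forall>i\<in>A. f i \<in> ?D) \<longrightarrow> (\<forall>i\<in>{1..d} - A. f i \<in> \<phi> ` M) \<longrightarrow> inner x (t f) = 0"
    if "finite A" "A \<subseteq> {1..d}" for A
    using that
  proof (induction A)
    case empty
    show ?case
    proof (intro allI impI)
      fix f assume "\<forall>i\<in>{1..d} - {}. f i \<in> \<phi> ` M"
      then have "\<forall>i\<in>{1..d}. \<exists>m\<in>M. f i = \<phi> m" by auto
      then obtain k where k: "\<And>i. i \<in> {1..d} \<Longrightarrow> k i \<in> M" "\<And>i. i \<in> {1..d} \<Longrightarrow> f i = \<phi> (k i)" by metis
      have "t f = t (\<lambda>i. \<phi> (k i))" using k(2) by (rule t_cong)
      then show "inner x (t f) = 0" using x[OF k(1)] by simp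
    qed
  next
    case (insert a A)
    show ?case
    proof (intro allI impI)
      fix f assume f: "\<forall>i\<in>insert a A. f i \<in> ?D" "\<forall>i\<in>{1..d} - insert a A. f i \<in> \<phi> ` M"
      interpret bounded_linear "\<lambda>y. inner x (t (f(a := y)))"
        using insert.prems bounded_linear_compose[OF bounded_linear_inner_right bounded_linear_t_update] by simp
      let ?Z = "{y. inner x (t (f(a := y))) = 0}"
      have "\<phi> ` M \<subseteq> ?Z"
      proof
        fix y assume y: "y \<in> \<phi> ` M"
        have "\<forall>i\<in>A. (f(a := y)) i \<in> ?D" "\<forall>i\<in>{1..d} - A. (f(a := y)) i \<in> \<phi> ` M"
          using f y insert.hyps by auto
        then show "y \<in> ?Z" using insert.IH insert.prems by simp
      qed
      moreover have "subspace ?Z" by (auto simp: subspace_def zero add scaleR)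
      ultimately have "span (\<phi> ` M) \<subseteq> ?Z" by (rule span_minimal)
      moreover have "closed ?Z" by (intro closed_Collect_eq continuous_on_const continuous_on continuous_on_id)
      ultimately have "?D \<subseteq> ?Z" by (rule closure_minimal)
      then have "f a \<in> ?Z" using f(1) by auto
      then show "inner x (t f) = 0" by simp
    qed
  qed
  from this[of "{1..d}"] show ?thesis using f by simp
qed

text \<open>The residual \<open>?q\<close> of the projection is orthogonal to all eigenvectors, so
  \<open>S ?q = 0\<close>; hence \<open>?q\<close> is orthogonal to \<open>adjoint S g\<close> and
  to \<open>p\<close>, and so to itself.\<close>

lemma adjoint_in_closure_eigenvectors:
  fixes S :: "'h::{real_inner, complete_space} \<Rightarrow> 'g::real_inner"
  assumes S: "compact_operator S"
    and eig: "nontrivial_eigenpairs UNIV (adjoint S \<circ> S) M lam \<phi>"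
  shows "adjoint S g \<in> closure (span (\<phi> ` M))"
proof -
  let ?D = "closure (span (\<phi> ` M))"
  have D: "subspace ?D" "complete ?D"
    by (auto simp: complete_eq_closed intro: subspace_closure)
  obtain p where p: "p \<in> ?D" "\<And>v. v \<in> ?D \<Longrightarrow> inner v p = inner v (adjoint S g)"
    using orthogonal_projection_exists[OF D] by metis
  let ?q = "adjoint S g - p"
  have q: "inner v ?q = 0" if "v \<in> ?D" for v using p(2)[OF that] by (simp add: inner_diff_right)
  have "inner ?q (\<phi> m) = 0" if "m \<in> M" for m
  proof -
    have "\<phi> m \<in> ?D" using that by (meson closure_subset imageI in_mono span_base)
    then show ?thesis using q by (simp add: inner_commute)
  qed
  then have "S ?q = 0" by (rule eigenvectors_complete[OF S eig])
  then have "inner ?q (adjoint S g) = 0"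
    by (simp add: adjoint_Hilbert[OF compact_operator_bounded_linear[OF S]])
  moreover have "inner ?q p = 0" using q[OF p(1)] by (simp add: inner_commute)
  ultimately have "inner ?q ?q = 0" by (simp add: inner_diff_right)
  then show ?thesis using p(1) by simp
qed

text \<open>Testing against elementary tensors \<open>u g\<close> allows the one-dimensional adjoint
  to be moved across factor by factor.\<close>

lemma tensor_power_operator_eq_0:
  fixes S :: "'h::{real_inner, complete_space} \<Rightarrow> 'g::real_inner"
  assumes H: "hilbert_tensor_power d X t" and G: "hilbert_tensor_power d Y u"
    and S: "compact_operator S"
    and eig: "nontrivial_eigenpairs UNIV (adjoint S \<circ> S) M lam \<phi>"
    and x: "x \<in> X" and orth: "\<And>k. (\<And>i. i \<in> {1..d} \<Longrightarrow> k i \<in> M) \<Longrightarrow> inner x (t (\<lambda>i. \<phi> (k i))) = 0"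
  shows "tensor_power_operator X t u S x = 0"
proof -
  interpret H: tensor_power d X t using H by unfold_locales
  interpret G: tensor_power d Y u using G by unfold_locales
  note bl = compact_operator_bounded_linear[OF S]
  note S' = tensor_power_operator[OF H G bl]
  have adj: "inner (tensor_power_operator X t u S y) (u g) = inner y (t (\<lambda>i. adjoint S (g i)))"
    if "y \<in> X" for y g
    by (rule H.cont_linear_on_eqI[OF cont_linear_on_inner_left[OF S'(1)] cont_linear_on_inner _ that])
       (simp add: S'(2) G.t_inner H.t_inner adjoint_Hilbert[OF bl])
  show ?thesis
  proof (rule G.orthogonal_t_eq_0[OF S'(3)[OF x]])
    fix g
    have "inner x (t (\<lambda>i. adjoint S (g i))) = 0"
      by (rule H.orthogonal_t_closure[OF orth]) (auto intro: adjoint_in_closure_eigenvectors[OF S eig])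
    then show "inner (tensor_power_operator X t u S x) (u g) = 0" using adj[OF x] by simp
  qed
qed

lemma initial_segment_antimono_bound:
  fixes lam :: "nat \<Rightarrow> real"
  assumes "antimono_on (initial_segment v) lam" "m \<in> initial_segment v"
  shows "lam m \<le> max 1 (lam 1)"
proof -
  have "1 \<in> initial_segment v" "1 \<le> m"
    using assms(2) by (cases v; auto simp: initial_segment_def one_enat_def plus_enat_simps)+
  then have "lam m \<le> lam 1" using assms unfolding monotone_on_def by blast
  then show ?thesis by (rule max.coboundedI2)
qed

text \<open>With all factors at most \<open>?L\<close>, a product of size at least \<open>e\<close>
  forces each factor to be at least \<open>e / ?L ^ d\<close>. The maximum with 1 in
  \<open>?L\<close> allows the exponent \<open>d\<close> in place of \<open>d - 1\<close>.\<close>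

lemma finite_lam_tilde_ge:
  assumes anti: "antimono_on (initial_segment v) lam"
    and pos: "\<And>m. m \<in> initial_segment v \<Longrightarrow> lam m > 0"
    and fin: "\<And>e. e > 0 \<Longrightarrow> finite {m \<in> initial_segment v. lam m \<ge> e}" and e: "e > 0"
  shows "finite {k \<in> {1..d} \<rightarrow>\<^sub>E initial_segment v. lam_tilde d lam k \<ge> e}"
proof -
  let ?L = "max 1 (lam 1)"
  let ?F = "{m \<in> initial_segment v. lam m \<ge> e / ?L ^ d}"
  have "finite ?F" using e by (intro fin divide_pos_pos zero_less_power) auto
  moreover have "{k \<in> {1..d} \<rightarrow>\<^sub>E initial_segment v. lam_tilde d lam k \<ge> e} \<subseteq> {1..d} \<rightarrow>\<^sub>E ?F"
  proof
    fix k assume "k \<in> {k \<in> {1..d} \<rightarrow>\<^sub>E initial_segment v. lam_tilde d lam k \<ge> e}"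
    then have k: "k \<in> {1..d} \<rightarrow>\<^sub>E initial_segment v" and ge: "lam_tilde d lam k \<ge> e" by auto
    have "k i \<in> ?F" if i: "i \<in> {1..d}" for i
    proof -
      have kM: "k l \<in> initial_segment v" if "l \<in> {1..d}" for l using k that by blast
      have "e \<le> lam (k i) * (\<Prod>l\<in>{1..d} - {i}. lam (k l))"
        using ge i unfolding lam_tilde_def by (simp add: prod.remove)
      also have "(\<Prod>l\<in>{1..d} - {i}. lam (k l)) \<le> (\<Prod>l\<in>{1..d} - {i}. ?L)"
        using kM pos initial_segment_antimono_bound[OF anti] by (intro prod_mono) (auto simp: less_imp_le)
      also have "\<dots> \<le> ?L ^ d"
        using i by (simp add: power_increasing)
      finally have "e \<le> lam (k i) * ?L ^ d" using pos[OF kM[OF i]] by (simp add: mult_left_mono)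
      then show ?thesis using kM[OF i] by (simp add: pos_divide_le_eq)
    qed
    then show "k \<in> {1..d} \<rightarrow>\<^sub>E ?F" using k by (auto simp: PiE_iff)
  qed
  ultimately show ?thesis by (meson finite_PiE finite_atLeastAtMost finite_subset)
qed

theorem theorem5p4:
  fixes S1 :: "'h::{real_inner, complete_space} \<Rightarrow> 'g::{real_inner, complete_space}"
    and H :: "nat \<Rightarrow> 'hk::real_inner set" and tH :: "nat \<Rightarrow> (nat \<Rightarrow> 'h) \<Rightarrow> 'hk"
    and G :: "nat \<Rightarrow> 'gk::real_inner set" and tG :: "nat \<Rightarrow> (nat \<Rightarrow> 'g) \<Rightarrow> 'gk"
    and P :: projector_kind
    and I :: "nat \<Rightarrow> nat set"
    and v :: enat and lam1 :: "nat \<Rightarrow> real" and \<phi> :: "nat \<Rightarrow> 'h"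
    and \<psi> :: "nat \<Rightarrow> nat \<Rightarrow> (nat \<Rightarrow> nat)"
  assumes S1: "compact_operator S1" "\<exists>x. S1 x \<noteq> 0"
    and tensor_H: "\<And>d. d \<ge> 1 \<Longrightarrow> hilbert_tensor_power d (H d) (tH d)"
    and tensor_G: "\<And>d. d \<ge> 1 \<Longrightarrow> hilbert_tensor_power d (G d) (tG d)"
    and I: "\<And>d. d \<ge> 1 \<Longrightarrow> I d \<noteq> {} \<and> I d \<subseteq> {1..d}"
    and eigenpairs: "nontrivial_eigenpairs UNIV (adjoint S1 \<circ> S1) (initial_segment v) lam1 \<phi>"
      "antimono_on (initial_segment v) lam1"
    and \<psi>: "\<And>d. d \<ge> 1 \<Longrightarrow>
        bij_betw (\<psi> d) (initial_segment (ecard (nabla P v d (I d)))) (nabla P v d (I d)) \<and>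
        antimono_on (initial_segment (ecard (nabla P v d (I d)))) (\<lambda>i. lam_tilde d lam1 (\<psi> d i))"
  shows "\<forall>d\<ge>1.
    (let V = projected_space P (H d) (tH d) (I d);
         Sd = tensor_power_operator (H d) (tH d) (tG d) S1;
         W = (\<lambda>f. adjoint_on V Sd (Sd f));
         Nab = nabla P v d (I d);
         J = initial_segment (ecard Nab);
         lam = (\<lambda>i. if i \<in> J then lam_tilde d lam1 (\<psi> d i) else 0);
         xi = (\<lambda>i. xi_tilde P (H d) (tH d) (I d) \<phi> (\<psi> d i));
         A = (\<lambda>n f. \<Sum>i = 1..the_enat (min (enat n) (ecard Nab)). inner f (xi i) *\<^sub>R Sd (xi i))
     in {(lam i, xi i) | i. i \<in> J} =
          {(lam_tilde d lam1 k, xi_tilde P (H d) (tH d) (I d) \<phi> k) | k. k \<in> Nab} \<and>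
        nontrivial_eigenpairs V W J lam xi \<and>
        (\<forall>n. (\<exists>m\<le>n. A n \<in> linear_algorithms m V (projected_space P (G d) (tG d) (I d))) \<and>
             A n \<in> V \<rightarrow> projected_space P (G d) (tG d) (I d) \<and>
             nth_optimal n V (G d) Sd (A n) \<and>
             minimal_error n V (G d) Sd = worst_error V Sd (A n) \<and>
             worst_error V Sd (A n) = ereal (sqrt (lam (n + 1)))))"
proof (intro allI impI)
  fix d :: nat assume d: "1 \<le> d"
  have bl: "bounded_linear S1" using S1(1) by (rule compact_operator_bounded_linear)
  have H: "hilbert_tensor_power d (H d) (tH d)" and G: "hilbert_tensor_power d (G d) (tG d)"
    and Id: "I d \<subseteq> {1..d}"
    using tensor_H[OF d] tensor_G[OF d] I[OF d] by blast+
  have eig_ortho: "\<forall>m\<in>initial_segment v. \<forall>n\<in>initial_segment v.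
      inner (\<phi> m) (\<phi> n) = (if m = n then 1 else 0)"
    and eig_pos: "\<And>m. m \<in> initial_segment v \<Longrightarrow> lam1 m > 0"
    and eig_vec: "\<And>m. m \<in> initial_segment v \<Longrightarrow> adjoint S1 (S1 (\<phi> m)) = lam1 m *\<^sub>R \<phi> m"
    using eigenpairs(1) unfolding nontrivial_eigenpairs_def by auto
  interpret H: symmetrized_basis d "H d" "tH d" P "I d" v \<phi>
    by unfold_locales (use H Id eig_ortho in blast)+
  interpret G: tensor_symmetrization d "G d" "tG d" P "I d"
    by unfold_locales (use G Id in blast)+
  let ?S = "tensor_power_operator (H d) (tH d) (tG d) S1"
  let ?J = "initial_segment (ecard H.Nab)"
  let ?xi = "\<lambda>i. H.xi (\<psi> d i)"
  let ?lam = "\<lambda>i. if i \<in> ?J then lam_tilde d lam1 (\<psi> d i) else 0"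
  note S' = tensor_power_operator[OF H G bl]
  note SP = tensor_power_operator_projector[OF H G bl Id]
  have linS: "linear_on (H d) ?S" using S'(1) by (simp add: cont_linear_on_def)
  have bij: "bij_betw (\<psi> d) ?J H.Nab"
    and anti: "antimono_on ?J (\<lambda>i. lam_tilde d lam1 (\<psi> d i))"
    using \<psi>[OF d] by auto
  have \<psi>_in: "\<psi> d i \<in> H.Nab" if "i \<in> ?J" for i using bij_betwE[OF bij] that by blast
  \<comment> \<open>On elementary tensors both sides are products over the factors, where the
    one-dimensional eigenvector equation applies.\<close>
  have S_E: "inner (?S x) (?S (H.E k)) = lam_tilde d lam1 k * inner x (H.E k)"
    if x: "x \<in> H d" and k: "k \<in> H.Nab" for x k
  proof (rule H.cont_linear_on_eqI[OF _ _ _ x, where A = "\<lambda>x. inner (?S x) (?S (H.E k))"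
        and B = "\<lambda>x. lam_tilde d lam1 k * inner x (H.E k)"])
    show "cont_linear_on (H d) (\<lambda>x. lam_tilde d lam1 k * inner x (H.E k))"
      using cont_linear_on_scaleR[OF cont_linear_on_inner] by simp
    show "inner (?S (tH d f)) (?S (H.E k)) = lam_tilde d lam1 k * inner (tH d f) (H.E k)" for f
    proof -
      have "inner (S1 (f i)) (S1 (\<phi> (k i))) = lam1 (k i) * inner (f i) (\<phi> (k i))"
        if "i \<in> {1..d}" for i
        using eig_vec[OF H.Nab_M[OF k that]] adjoint_Hilbert[OF bl, of "f i" "S1 (\<phi> (k i))"] by simp
      then show ?thesis
        unfolding S'(2) G.t_inner H.t_inner lam_tilde_def prod.distrib[symmetric]
        by (intro prod.cong refl)
    qed
  qed (rule cont_linear_on_inner_left[OF S'(1)])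
  have S_xi: "inner (?S x) (?S (H.xi k)) = lam_tilde d lam1 k * inner x (H.xi k)"
    if x: "x \<in> H d" and k: "k \<in> H.Nab" for x k
  proof -
    let ?Px = "H.Pr x" and ?E = "H.E k"
    \<comment> \<open>The projector passes through \<open>?S\<close>, is moved to the other argument
      in the target space, and returns through \<open>?S\<close>.\<close>
    have "inner (?S x) (?S (H.Pr ?E)) = inner (?S ?Px) (?S ?E)"
      unfolding SP[OF H.t_in] SP[OF x] by (rule G.Pr_self_adjoint[OF S'(3)[OF x] S'(3)[OF H.t_in], symmetric])
    also have "\<dots> = lam_tilde d lam1 k * inner ?Px ?E" by (rule S_E[OF H.Pr_in[OF x] k])
    also have "inner ?Px ?E = inner x (H.Pr ?E)" by (rule H.Pr_self_adjoint[OF x H.t_in])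
    finally show ?thesis
      unfolding H.xi_eq linear_on_scaleR[OF linS H.Pr_in[OF H.t_in]] by simp
  qed
  interpret W: singular_system H.V ?S "ecard H.Nab" ?lam ?xi
  proof unfold_locales
    show "subspace H.V" by (rule H.subspace_V)
    show "complete H.V" by (rule H.complete_V)
    show "cont_linear_on H.V ?S" by (rule cont_linear_on_subset[OF S'(1) H.V_subset])
    show "?xi i \<in> H.V" for i by (rule H.xi_in)
    show "inner (?xi i) (?xi j) = (if i = j then 1 else 0)" if "i \<in> ?J" "j \<in> ?J" for i j
      unfolding H.xi_ortho[OF \<psi>_in[OF that(1)] \<psi>_in[OF that(2)]]
        inj_on_eq_iff[OF bij_betw_imp_inj_on[OF bij] that] by (rule refl)
    show "?lam i > 0" if "i \<in> ?J" for i
    proof -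
      have "lam_tilde d lam1 (\<psi> d i) > 0"
        unfolding lam_tilde_def using eig_pos H.Nab_M[OF \<psi>_in[OF that]] by (intro prod_pos) blast
      then show ?thesis using that by simp
    qed
    show "antimono_on ?J ?lam" using anti by (simp add: monotone_on_def)
    \<comment> \<open>The injective \<open>\<psi> d\<close> sends these indices into a finite set of
      multi-indices with large eigenvalue product.\<close>
    show "finite {i \<in> ?J. ?lam i \<ge> e}" if e: "e > 0" for e
    proof (rule inj_on_finite)
      show "inj_on (\<psi> d) {i \<in> ?J. ?lam i \<ge> e}"
        using bij_betw_imp_inj_on[OF bij] by (rule inj_on_subset) blast
      show "\<psi> d ` {i \<in> ?J. ?lam i \<ge> e} \<subseteq> {k \<in> {1..d} \<rightarrow>\<^sub>E initial_segment v. lam_tilde d lam1 k \<ge> e}"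
        using H.Nab_in[OF \<psi>_in] by auto
      show "finite {k \<in> {1..d} \<rightarrow>\<^sub>E initial_segment v. lam_tilde d lam1 k \<ge> e}"
        by (rule finite_lam_tilde_ge[OF eigenpairs(2) eig_pos eigenvalues_finite_above[OF S1(1) eigenpairs(1)] e])
    qed
    show "inner (?S x) (?S (?xi i)) = ?lam i * inner x (?xi i)" if "x \<in> H.V" "i \<in> ?J" for x i
      using S_xi[OF subsetD[OF H.V_subset that(1)] \<psi>_in[OF that(2)]] that(2) by simp
    show "?S x = 0" if x: "x \<in> H.V" and orth: "\<And>i. i \<in> ?J \<Longrightarrow> inner x (?xi i) = 0" for x
    proof (rule tensor_power_operator_eq_0[OF H G S1(1) eigenpairs(1) subsetD[OF H.V_subset x]])
      have xi0: "inner x (H.xi k) = 0" if "k \<in> H.Nab" for k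
      proof -
        have "k \<in> \<psi> d ` ?J" using that unfolding bij_betw_imp_surj_on[OF bij] .
        then obtain i where "i \<in> ?J" "k = \<psi> d i" by (rule imageE)
        then show ?thesis using orth by (simp only:)
      qed
      show "inner x (H.E k) = 0" if "\<And>i. i \<in> {1..d} \<Longrightarrow> k i \<in> initial_segment v" for k
        using x xi0 that by (rule H.orthogonal_E)
    qed
  qed
  have A: "(\<lambda>f. \<Sum>i = 1..the_enat (min (enat n) (ecard H.Nab)). inner f (?xi i) *\<^sub>R ?S (?xi i)) = W.approx n" for n
    by (rule ext) (simp only: W.approx_def W.rank_at_def)
  have SV: "?S x \<in> G.V" if "x \<in> H.V" for x
  proof -
    have x: "x \<in> H d" "H.Pr x = x" using that unfolding H.V_eq by auto
    then have "?S x = G.Pr (?S x)" using SP[OF x(1), of P] by (simp only:)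
    then show ?thesis using G.Pr_in_V[OF S'(3)[OF x(1)]] by (simp only:)
  qed
  have pairs: "{(?lam i, ?xi i) | i. i \<in> ?J} = {(lam_tilde d lam1 k, H.xi k) | k. k \<in> H.Nab}"
  proof -
    have "{(?lam i, ?xi i) | i. i \<in> ?J} = (\<lambda>k. (lam_tilde d lam1 k, H.xi k)) ` \<psi> d ` ?J" by auto
    then show ?thesis unfolding bij_betw_imp_surj_on[OF bij] by auto
  qed
  have alg: "(\<exists>m\<le>n. W.approx n \<in> linear_algorithms m H.V G.V) \<and>
      W.approx n \<in> H.V \<rightarrow> G.V \<and> nth_optimal n H.V (G d) ?S (W.approx n) \<and>
      minimal_error n H.V (G d) ?S = worst_error H.V ?S (W.approx n) \<and>
      worst_error H.V ?S (W.approx n) = ereal (sqrt (?lam (n + 1)))" for n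
  proof (intro conjI)
    show "\<exists>m\<le>n. W.approx n \<in> linear_algorithms m H.V G.V"
      using W.rank_le W.approx_in_linear_algorithms[OF SV[OF H.xi_in]] by blast
    show "W.approx n \<in> H.V \<rightarrow> G.V"
      unfolding W.approx_def
      by (intro Pi_I subspace_sum subspace_scale G.subspace_V SV H.xi_in)
    have SG: "?S (?xi i) \<in> G d" for i by (rule subsetD[OF G.V_subset SV[OF H.xi_in]])
    show "nth_optimal n H.V (G d) ?S (W.approx n)"
      and "minimal_error n H.V (G d) ?S = worst_error H.V ?S (W.approx n)"
      by (rule W.approx_optimal[OF G.subspace_X SG])+
    have "W.next_lam n = ?lam (n + 1)" by (simp add: W.next_lam_def)
    then show "worst_error H.V ?S (W.approx n) = ereal (sqrt (?lam (n + 1)))"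
      using W.approx_optimal(2)[OF G.subspace_X SG, of n] by simp
  qed
  show "let V = projected_space P (H d) (tH d) (I d);
         Sd = tensor_power_operator (H d) (tH d) (tG d) S1;
         W = (\<lambda>f. adjoint_on V Sd (Sd f));
         Nab = nabla P v d (I d);
         J = initial_segment (ecard Nab);
         lam = (\<lambda>i. if i \<in> J then lam_tilde d lam1 (\<psi> d i) else 0);
         xi = (\<lambda>i. xi_tilde P (H d) (tH d) (I d) \<phi> (\<psi> d i));
         A = (\<lambda>n f. \<Sum>i = 1..the_enat (min (enat n) (ecard Nab)). inner f (xi i) *\<^sub>R Sd (xi i))
     in {(lam i, xi i) | i. i \<in> J} =
          {(lam_tilde d lam1 k, xi_tilde P (H d) (tH d) (I d) \<phi> k) | k. k \<in> Nab} \<and>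
        nontrivial_eigenpairs V W J lam xi \<and>
        (\<forall>n. (\<exists>m\<le>n. A n \<in> linear_algorithms m V (projected_space P (G d) (tG d) (I d))) \<and>
             A n \<in> V \<rightarrow> projected_space P (G d) (tG d) (I d) \<and>
             nth_optimal n V (G d) Sd (A n) \<and>
             minimal_error n V (G d) Sd = worst_error V Sd (A n) \<and>
             worst_error V Sd (A n) = ereal (sqrt (lam (n + 1))))"
    unfolding Let_def A
    by (intro conjI allI pairs W.nontrivial_eigenpairs alg[THEN conjunct1]
        alg[THEN conjunct2, THEN conjunct1] alg[THEN conjunct2, THEN conjunct2, THEN conjunct1]
        alg[THEN conjunct2, THEN conjunct2, THEN conjunct2, THEN conjunct1]
        alg[THEN conjunct2, THEN conjunct2, THEN conjunct2, THEN conjunct2])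
qed

end
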